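(* Let $G$ be a $3$-dimensional non-unimodular Lie group with Lie algebra $\mathfrak{g}$ and let $\mathfrak{u}=\{x\in\mathfrak{g}\mid\mathrm{tr}\,\mathrm{ad}_x=0\}$ be the unimodular kernel of $\mathfrak{g}$. All odd generalized Einstein metrics below are taken on Courant algebroids $E_{H,F}$ of type $B_3$ over $G$ with $F\neq0$. i) There are odd generalized Einstein metrics $E_-=\{X-g(X)\mid X\in TG\}$ on $G$ with $g|_{\mathfrak{u}\times\mathfrak{u}}$ degenerate. If $\mathfrak{g}$ is isomorphic to $\tau_2(\mathbb{R})\oplus\mathbb{R}$, $\tau_3(\mathbb{R})$ or $\tau_{3,\lambda}(\mathbb{R})$, then $E_-$ can be chosen to be divergence-free or with non-zero divergence. If $\mathfrak{g}$ is isomorphic to $\tau'_{3,\lambda}(\mathbb{R})$, then $E_-$ has necessarily non-zero divergence. ii) There are odd generalized Einstein metrics $E_-=\{X-g(X)\mid X\in TG\}$ on $G$ with $g|_{\mathfrak{u}\times\mathfrak{u}}$ non-degenerate if and only if $\mathfrak{g}$ is isomorphic to $\tau_2(\mathbb{R})\oplus\mathbb{R}$, $\tau_{3,\frac12}(\mathbb{R})$ or $\tau_{3,-\frac12}(\mathbb{R})$. All such metrics have non-zero divergence.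
   Context: Lie algebras. A $3$-dimensional non-unimodular Lie algebra is a semi-direct product $\mathbb{R}\ltimes_{\mathbf A}\mathbb{R}^2$ (with $\mathbb{R}^2=\mathfrak u$ abelian and the generator of $\mathbb{R}$ acting on $\mathbb{R}^2$ by $\mathbf A$, $\mathrm{tr}\,\mathbf A\neq0$). The isomorphism classes are: $\tau_2(\mathbb{R})\oplus\mathbb{R}$ for $\mathbf A=\begin{pmatrix}1&0\\0&0\end{pmatrix}$; $\tau_3(\mathbb{R})$ for $\mathbf A=\begin{pmatrix}1&1\\0&1\end{pmatrix}$; $\tau_{3,\lambda}(\mathbb{R})$ for $\mathbf A=\begin{pmatrix}1&0\\0&\lambda\end{pmatrix}$, $\lambda\neq-1$, $0<|\lambda|\le1$; $\tau'_{3,\lambda}(\mathbb{R})$ for $\mathbf A=\begin{pmatrix}\lambda&-1\\1&\lambda\end{pmatrix}$, $\lambda\neq0$. Courant algebroid of type $B_n$. Let $G$ be a Lie group of dimension $n$ (here $n=3$) with Lie algebra $\mathfrak{g}$ (identified with left-invariant vector fields) and let $H\in\Omega^3(G)$, $F\in\Omega^2(G)$ be left-invariant with $dF=0$ and $dH+F\wedge F=0$ (for $n=3$ only $dF=0$ is a condition). $E=E_{H,F}$ is the bundle $TG\oplus T^*G\oplus\mathbb{R}$ with anchor $\pi:E\to TG$ the projection, scalar product $\langle X+\xi+\lambda,Y+\eta+\mu\rangle=\frac12(\xi(Y)+\eta(X))+\lambda\mu$ and Dorfman bracket $$[X+\xi+\lambda,Y+\eta+\mu]_{H,F}=\mathcal{L}_X(Y+\eta)-i_Yd\xi+2\mu\,d\lambda+i_Xi_YH-2(\mu\,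 i_XF-\lambda\, i_YF)+X(\mu)-Y(\lambda)+F(X,Y).$$ $G$ acts on $E$ by left translations (trivially on the $\mathbb{R}$-fibre); the left-invariant sections of $E$ form the vector space $\tilde E=\mathfrak{g}\oplus\mathfrak{g}^*\oplus\mathbb{R}$. Generalized metrics, connections, divergence. A generalized metric is a subbundle $E_-\subset E$ with $\langle\cdot,\cdot\rangle|_{E_-}$ non-degenerate and $\pi|_{E_-}:E_-\to TG$ an isomorphism; $E_+:=E_-^\perp$. For a left-invariant pseudo-Riemannian metric $g$ (of any signature) on $G$, $E_-=\{X-g(X)\mid X\in TG\}$ with $g(X):=g(X,\cdot)$ is a left-invariant generalized metric. A generalized connection is a linear map $D:\Gamma(E)\to\Gamma(E^*\otimes E)$, $v\mapsto (u\mapsto D_uv)$, with $D_u(fv)=\pi(u)(f)v+fD_uv$ and $\pi(u)\langle v,w\rangle=\langle D_uv,w\rangle+\langle v,D_uw\rangle$. Its torsion is $T^D(u,v,w)=\langle D_uv-D_vu-[u,v]_{H,F},w\rangle+\langle v,D_wu\rangle$. $D$ is a Levi-Civita generalized connection of $E_-$ if $T^D=0$ and $D_u\Gamma(E_-)\subset\Gamma(E_-)$ for all $u$. A divergence operator is an additive map $\delta:\Gamma(E)\to C^\infty(G)$ with $\delta(fu)=\pi(u)(f)+f\delta(u)$; the divergence of $D$ is $\delta^D(u)=\mathrm{tr}\,Du$. A divergence operator is left-invariant if it maps left-invariant sections to constants; it is then identified with an element of $\tilde E^*$. Ricci tensor and Einstein condition. For a Levi-Civita generalized connection $D$ of $E_-$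 with $\delta^D=\delta$ put $R^D(u,v)w=D_uD_vw-D_vD_uw-D_{[u,v]_{H,F}}w$ and $\mathrm{Ric}^{\delta,+}(u,v)=\mathrm{tr}(E_+\ni w\mapsto R^D(w,u)v)$ for $u\in E_-,v\in E_+$; $\mathrm{Ric}^{\delta,-}(u,v)=\mathrm{tr}(E_-\ni w\mapsto R^D(w,u)v)$ for $u\in E_+,v\in E_-$. These are tensors depending only on $(E_-,\delta)$. An odd generalized Einstein metric on $G$ with divergence $\delta$ is a left-invariant generalized metric $E_-$ on some $E_{H,F}$ ($H,F$ left-invariant) with $\mathrm{Ric}^{\delta,+}=0$ and $\mathrm{Ric}^{\delta,-}=0$, where $\delta\in\tilde E^*$ is a left-invariant divergence operator. Divergence-free means $\delta=0$. *)

theory Defs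
  imports "HOL-Analysis.Analysis"
begin

section \<open>Smooth manifolds and Lie groups\<close>

primrec Ck_on :: "nat \<Rightarrow> ('a::euclidean_space \<Rightarrow> 'b::real_normed_vector) \<Rightarrow> 'a set \<Rightarrow> bool" where
  "Ck_on 0 f S \<longleftrightarrow> continuous_on S f"
| "Ck_on (Suc k) f S \<longleftrightarrow> f differentiable_on S \<and>
     (\<forall>v. Ck_on k (\<lambda>x. frechet_derivative f (at x) v) S)"

text \<open>Only used for open \<open>S\<close>.\<close>

definition smooth_on :: "'a::euclidean_space set \<Rightarrow> ('a \<Rightarrow> 'b::real_normed_vector) \<Rightarrow> bool" where
  "smooth_on S f \<longleftrightarrow> (\<forall>k. Ck_on k f S)"

type_synonym ('p, 'm) chart = "'p set \<times> ('p \<Rightarrow> 'm)"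

definition smooth_atlas :: "('p::topological_space, 'm::euclidean_space) chart set \<Rightarrow> bool" where
  "smooth_atlas \<A> \<longleftrightarrow>
     (\<forall>(U, \<phi>) \<in> \<A>. open U \<and> open (\<phi> ` U) \<and> homeomorphism U (\<phi> ` U) \<phi> (inv_into U \<phi>)) \<and>
     (\<Union>(U, \<phi>) \<in> \<A>. U) = UNIV \<and>
     (\<forall>(U, \<phi>) \<in> \<A>. \<forall>(V, \<psi>) \<in> \<A>. smooth_on (\<phi> ` (U \<inter> V)) (\<psi> \<circ> inv_into U \<phi>))"

definition smooth_map ::
  "('p::topological_space, 'm::euclidean_space) chart set \<Rightarrow> ('p \<Rightarrow> 'b::real_normed_vector) \<Rightarrow> bool" where
  "smooth_map \<A> f \<longleftrightarrow> (\<forall>(U, \<phi>) \<in> \<A>. smooth_on (\<phi> ` U) (f \<circ> inv_into U \<phi>))"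

text \<open>The group is written additively, as the class \<^class>\<open>group_add\<close> does not require
  commutativity.\<close>

definition lie_group ::
  "('p::{topological_group_add, t2_space, second_countable_topology}, 'm::euclidean_space) chart set \<Rightarrow> bool"
where
  "lie_group \<A> \<longleftrightarrow> smooth_atlas \<A> \<and>
     (\<forall>(U, \<phi>) \<in> \<A>. \<forall>(V, \<psi>) \<in> \<A>. \<forall>(W, \<theta>) \<in> \<A>.
        smooth_on {(\<phi> a, \<psi> b) | a b. a \<in> U \<and> b \<in> V \<and> a + b \<in> W}
          (\<lambda>(x, y). \<theta> (inv_into U \<phi> x + inv_into V \<psi> y))) \<and>
     (\<forall>(U, \<phi>) \<in> \<A>. \<forall>(V, \<psi>) \<in> \<A>.
        smooth_on {\<phi> a | a. a \<in> U \<and> - a \<in> V} (\<lambda>x. \<psi> (- inv_into U \<phi> x)))"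

text \<open>Vector fields are the derivations of the algebra of smooth functions. The value on non-smooth
  functions is fixed, so that a vector field is represented by exactly one operator.\<close>

definition vector_field ::
  "('p::topological_space, 'm::euclidean_space) chart set \<Rightarrow> (('p \<Rightarrow> real) \<Rightarrow> 'p \<Rightarrow> real) \<Rightarrow> bool" where
  "vector_field \<A> V \<longleftrightarrow>
     (\<forall>f. smooth_map \<A> f \<longrightarrow> smooth_map \<A> (V f)) \<and>
     (\<forall>f h. smooth_map \<A> f \<and> smooth_map \<A> h \<longrightarrow> V (\<lambda>p. f p + h p) = (\<lambda>p. V f p + V h p)) \<and>
     (\<forall>c f. smooth_map \<A> f \<longrightarrow> V (\<lambda>p. c * f p) = (\<lambda>p. c * V f p)) \<and>
     (\<forall>f h. smooth_map \<A> f \<and> smooth_map \<A> h \<longrightarrow>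
        V (\<lambda>p. f p * h p) = (\<lambda>p. V f p * h p + f p * V h p)) \<and>
     (\<forall>f. \<not> smooth_map \<A> f \<longrightarrow> V f = (\<lambda>p. 0))"

definition left_invariant_field ::
  "('p::{topological_space, group_add}, 'm::euclidean_space) chart set \<Rightarrow>
   (('p \<Rightarrow> real) \<Rightarrow> 'p \<Rightarrow> real) \<Rightarrow> bool" where
  "left_invariant_field \<A> V \<longleftrightarrow> vector_field \<A> V \<and>
     (\<forall>a f. smooth_map \<A> f \<longrightarrow> V (\<lambda>p. f (a + p)) = (\<lambda>p. V f (a + p)))"

section \<open>Lie algebras\<close>

definition lie_bracket :: "('a::real_vector \<Rightarrow> 'a \<Rightarrow> 'a) \<Rightarrow> bool" where
  "lie_bracket br \<longleftrightarrow> bilinear br \<and> (\<forall>x. br x x = 0) \<and>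
     (\<forall>x y z. br x (br y z) + br y (br z x) + br z (br x y) = 0)"

text \<open>The Lie algebra of a Lie group consists of the left-invariant vector fields with the commutator
  as bracket. It is presented by its coordinates \<open>real^'n\<close> with respect to some basis: \<open>br\<close> is the
  bracket in these coordinates and \<open>\<rho> x\<close> is the left-invariant vector field with coordinates \<open>x\<close>.\<close>

definition lie_algebra_of ::
  "('p::{topological_space, group_add}, real^'n) chart set \<Rightarrow> (real^'n \<Rightarrow> real^'n \<Rightarrow> real^'n) \<Rightarrow>
   (real^'n \<Rightarrow> ('p \<Rightarrow> real) \<Rightarrow> 'p \<Rightarrow> real) \<Rightarrow> bool" where
  "lie_algebra_of \<A> br \<rho> \<longleftrightarrow> lie_bracket br \<and>
     bij_betw \<rho> UNIV {V. left_invariant_field \<A> V} \<and>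
     (\<forall>x y f p. \<rho> (x + y) f p = \<rho> x f p + \<rho> y f p) \<and>
     (\<forall>c x f p. \<rho> (c *\<^sub>R x) f p = c * \<rho> x f p) \<and>
     (\<forall>x y f. smooth_map \<A> f \<longrightarrow> \<rho> (br x y) f = (\<lambda>p. \<rho> x (\<rho> y f) p - \<rho> y (\<rho> x f) p))"

definition unimodular_kernel :: "(real^'n \<Rightarrow> real^'n \<Rightarrow> real^'n) \<Rightarrow> (real^'n) set" where
  "unimodular_kernel br = {x. trace (matrix (br x)) = 0}"

definition lie_isomorphic ::
  "('a::real_vector \<Rightarrow> 'a \<Rightarrow> 'a) \<Rightarrow> ('b::real_vector \<Rightarrow> 'b \<Rightarrow> 'b) \<Rightarrow> bool" where
  "lie_isomorphic br br' \<longleftrightarrow>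
     (\<exists>\<Phi>. linear \<Phi> \<and> bij \<Phi> \<and> (\<forall>x y. \<Phi> (br x y) = br' (\<Phi> x) (\<Phi> y)))"

definition semidirect :: "real^2^2 \<Rightarrow> real \<times> (real^2) \<Rightarrow> real \<times> (real^2) \<Rightarrow> real \<times> (real^2)" where
  "semidirect M = (\<lambda>(s, x) (t, y). (0, s *\<^sub>R (M *v y) - t *\<^sub>R (M *v x)))"

definition \<tau>2_plus_R :: "real \<times> (real^2) \<Rightarrow> real \<times> (real^2) \<Rightarrow> real \<times> (real^2)" where
  "\<tau>2_plus_R = semidirect (vector [vector [1, 0], vector [0, 0]])"

definition \<tau>3 :: "real \<times> (real^2) \<Rightarrow> real \<times> (real^2) \<Rightarrow> real \<times> (real^2)" where
  "\<tau>3 = semidirect (vector [vector [1, 1], vector [0, 1]])"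

definition \<tau>3_diag :: "real \<Rightarrow> real \<times> (real^2) \<Rightarrow> real \<times> (real^2) \<Rightarrow> real \<times> (real^2)" where
  "\<tau>3_diag l = semidirect (vector [vector [1, 0], vector [0, l]])"

definition \<tau>3_rot :: "real \<Rightarrow> real \<times> (real^2) \<Rightarrow> real \<times> (real^2) \<Rightarrow> real \<times> (real^2)" where
  "\<tau>3_rot l = semidirect (vector [vector [l, -1], vector [1, l]])"

section \<open>Left-invariant tensors on the group\<close>

definition pseudo_metric :: "(real^'n \<Rightarrow> real^'n \<Rightarrow> real) \<Rightarrow> bool" where
  "pseudo_metric g \<longleftrightarrow> bilinear g \<and> (\<forall>x y. g x y = g y x) \<and> (\<forall>x. (\<forall>y. g x y = 0) \<longrightarrow> x = 0)"

definition degenerate_on :: "(real^'n \<Rightarrow> real^'n \<Rightarrow> real) \<Rightarrow> (real^'n) set \<Rightarrow> bool" where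
  "degenerate_on g U \<longleftrightarrow> (\<exists>x\<in>U. x \<noteq> 0 \<and> (\<forall>y\<in>U. g x y = 0))"

definition two_form :: "(real^'n \<Rightarrow> real^'n \<Rightarrow> real) \<Rightarrow> bool" where
  "two_form F \<longleftrightarrow> bilinear F \<and> (\<forall>x. F x x = 0)"

definition three_form :: "(real^'n \<Rightarrow> real^'n \<Rightarrow> real^'n \<Rightarrow> real) \<Rightarrow> bool" where
  "three_form H \<longleftrightarrow>
     (\<forall>y z. linear (\<lambda>x. H x y z)) \<and> (\<forall>x z. linear (\<lambda>y. H x y z)) \<and> (\<forall>x y. linear (\<lambda>z. H x y z)) \<and>
     (\<forall>x y. H x x y = 0 \<and> H x y y = 0 \<and> H x y x = 0)"

text \<open>The exterior derivative of a left-invariant two-form, evaluated on left-invariant vector fields.\<close>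

definition closed_two_form ::
  "(real^'n \<Rightarrow> real^'n \<Rightarrow> real^'n) \<Rightarrow> (real^'n \<Rightarrow> real^'n \<Rightarrow> real) \<Rightarrow> bool" where
  "closed_two_form br F \<longleftrightarrow> (\<forall>x y z. - F (br x y) z + F (br x z) y - F (br y z) x = 0)"

section \<open>The Courant algebroid\<close>

text \<open>Left translation trivialises the bundle, so a section of \<open>TG \<oplus> T*G \<oplus> \<real>\<close> is a smooth map from the
  group to \<open>real^'n \<times> real^'n \<times> real\<close>; left-invariant sections are the constant maps. Covectors are
  given by coordinates in the dual basis, so that \<open>\<xi>(Y) = \<xi> \<bullet> Y\<close>. If \<open>X\<close> is the tangent part of a
  section, the derivative of a function \<open>f\<close> along \<open>X\<close> at \<open>p\<close> is \<open>\<rho> (X p) f p\<close>.\<close>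

type_synonym 'n fibre = "(real^'n) \<times> (real^'n) \<times> real"
type_synonym ('p, 'n) sect = "'p \<Rightarrow> 'n fibre"
type_synonym ('p, 'n) frame = "real^'n \<Rightarrow> ('p \<Rightarrow> real) \<Rightarrow> 'p \<Rightarrow> real"

definition vec_part :: "'n fibre \<Rightarrow> real^'n" where "vec_part e = fst e"
definition form_part :: "'n fibre \<Rightarrow> real^'n" where "form_part e = fst (snd e)"
definition scal_part :: "'n fibre \<Rightarrow> real" where "scal_part e = snd (snd e)"

definition pairing :: "('n::finite) fibre \<Rightarrow> 'n fibre \<Rightarrow> real" where
  "pairing e e' = (form_part e \<bullet> vec_part e' + form_part e' \<bullet> vec_part e) / 2 + scal_part e * scal_part e'"

abbreviation evec :: "'n::finite \<Rightarrow> real^'n" where "evec i \<equiv> axis i 1"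

definition field_bracket ::
  "('p, 'n::finite) frame \<Rightarrow> (real^'n \<Rightarrow> real^'n \<Rightarrow> real^'n) \<Rightarrow>
   ('p \<Rightarrow> real^'n) \<Rightarrow> ('p \<Rightarrow> real^'n) \<Rightarrow> 'p \<Rightarrow> real^'n" where
  "field_bracket \<rho> br X Y p =
     (\<chi> i. \<rho> (X p) (\<lambda>q. Y q $ i) p - \<rho> (Y p) (\<lambda>q. X q $ i) p) + br (X p) (Y p)"

definition d_fun :: "('p, 'n::finite) frame \<Rightarrow> ('p \<Rightarrow> real) \<Rightarrow> 'p \<Rightarrow> real^'n" where
  "d_fun \<rho> f p = (\<chi> i. \<rho> (evec i) f p)"

definition d_one_form ::
  "('p, 'n::finite) frame \<Rightarrow> (real^'n \<Rightarrow> real^'n \<Rightarrow> real^'n) \<Rightarrow>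
   ('p \<Rightarrow> real^'n) \<Rightarrow> 'p \<Rightarrow> real^'n \<Rightarrow> real^'n \<Rightarrow> real" where
  "d_one_form \<rho> br \<xi> p x y =
     \<rho> x (\<lambda>q. \<xi> q \<bullet> y) p - \<rho> y (\<lambda>q. \<xi> q \<bullet> x) p - \<xi> p \<bullet> br x y"

text \<open>\<open>(L\<^sub>X \<eta>)(Z) = X(\<eta>(Z)) - \<eta>([X,Z])\<close> for \<open>Z\<close> in the left-invariant frame.\<close>

definition lie_deriv_form ::
  "('p, 'n::finite) frame \<Rightarrow> (real^'n \<Rightarrow> real^'n \<Rightarrow> real^'n) \<Rightarrow>
   ('p \<Rightarrow> real^'n) \<Rightarrow> ('p \<Rightarrow> real^'n) \<Rightarrow> 'p \<Rightarrow> real^'n" where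
  "lie_deriv_form \<rho> br X \<eta> p =
     (\<chi> i. \<rho> (X p) (\<lambda>q. \<eta> q \<bullet> evec i) p - \<eta> p \<bullet> field_bracket \<rho> br X (\<lambda>q. evec i) p)"

text \<open>Contractions put the vector into the first argument, so \<open>i\<^sub>X i\<^sub>Y H = H(Y, X, _)\<close>.\<close>

definition dorfman ::
  "('p, 'n::finite) frame \<Rightarrow> (real^'n \<Rightarrow> real^'n \<Rightarrow> real^'n) \<Rightarrow>
   (real^'n \<Rightarrow> real^'n \<Rightarrow> real^'n \<Rightarrow> real) \<Rightarrow> (real^'n \<Rightarrow> real^'n \<Rightarrow> real) \<Rightarrow>
   ('p, 'n) sect \<Rightarrow> ('p, 'n) sect \<Rightarrow> ('p, 'n) sect" where
  "dorfman \<rho> br H F u v =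
    (let X = vec_part \<circ> u; \<xi> = form_part \<circ> u; lam = scal_part \<circ> u;
         Y = vec_part \<circ> v; \<eta> = form_part \<circ> v; mu = scal_part \<circ> v
     in (\<lambda>p.
       (field_bracket \<rho> br X Y p,
        lie_deriv_form \<rho> br X \<eta> p - (\<chi> i. d_one_form \<rho> br \<xi> p (Y p) (evec i))
          + (2 * mu p) *\<^sub>R d_fun \<rho> lam p
          + (\<chi> i. H (Y p) (X p) (evec i))
          - 2 *\<^sub>R (mu p *\<^sub>R (\<chi> i. F (X p) (evec i)) - lam p *\<^sub>R (\<chi> i. F (Y p) (evec i))),
        \<rho> (X p) mu p - \<rho> (Y p) lam p + F (X p) (Y p))))"

section \<open>Generalized metrics, connections and divergence operators\<close>

text \<open>A left-invariant subbundle is given by its fibre \<open>W\<close> in the left-invariant trivialisation.\<close>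

definition generalized_metric :: "('n::finite) fibre set \<Rightarrow> bool" where
  "generalized_metric W \<longleftrightarrow> subspace W \<and>
     (\<forall>w\<in>W. (\<forall>w'\<in>W. pairing w w' = 0) \<longrightarrow> w = 0) \<and> bij_betw vec_part W UNIV"

definition orth :: "('n::finite) fibre set \<Rightarrow> 'n fibre set" where
  "orth W = {e. \<forall>w\<in>W. pairing e w = 0}"

definition E_minus :: "(real^'n \<Rightarrow> real^'n \<Rightarrow> real) \<Rightarrow> ('n::finite) fibre set" where
  "E_minus g = {(x, - (\<chi> i. g x (evec i)), 0) | x. True}"

definition sections_in ::
  "('p::topological_space, real^'n) chart set \<Rightarrow> ('n::finite) fibre set \<Rightarrow> ('p, 'n) sect set" where
  "sections_in \<A> W = {u. smooth_map \<A> u \<and> range u \<subseteq> W}"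

abbreviation sections :: "('p::topological_space, real^'n) chart set \<Rightarrow> ('p, 'n::finite) sect set" where
  "sections \<A> \<equiv> sections_in \<A> UNIV"

definition generalized_connection ::
  "('p::topological_space, real^'n) chart set \<Rightarrow> ('p, 'n::finite) frame \<Rightarrow>
   (('p, 'n) sect \<Rightarrow> ('p, 'n) sect \<Rightarrow> ('p, 'n) sect) \<Rightarrow> bool" where
  "generalized_connection \<A> \<rho> D \<longleftrightarrow>
     (\<forall>u\<in>sections \<A>. \<forall>v\<in>sections \<A>. D u v \<in> sections \<A>) \<and>
     (\<forall>u\<in>sections \<A>. \<forall>u'\<in>sections \<A>. \<forall>v\<in>sections \<A>.
        D (\<lambda>p. u p + u' p) v = (\<lambda>p. D u v p + D u' v p)) \<and>
     (\<forall>f. \<forall>u\<in>sections \<A>. \<forall>v\<in>sections \<A>. smooth_map \<A> f \<longrightarrow>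
        D (\<lambda>p. f p *\<^sub>R u p) v = (\<lambda>p. f p *\<^sub>R D u v p)) \<and>
     (\<forall>u\<in>sections \<A>. \<forall>v\<in>sections \<A>. \<forall>v'\<in>sections \<A>.
        D u (\<lambda>p. v p + v' p) = (\<lambda>p. D u v p + D u v' p)) \<and>
     (\<forall>f. \<forall>u\<in>sections \<A>. \<forall>v\<in>sections \<A>. smooth_map \<A> f \<longrightarrow>
        D u (\<lambda>p. f p *\<^sub>R v p) = (\<lambda>p. \<rho> (vec_part (u p)) f p *\<^sub>R v p + f p *\<^sub>R D u v p)) \<and>
     (\<forall>u\<in>sections \<A>. \<forall>v\<in>sections \<A>. \<forall>w\<in>sections \<A>. \<forall>p.
        \<rho> (vec_part (u p)) (\<lambda>q. pairing (v q) (w q)) p =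
          pairing (D u v p) (w p) + pairing (v p) (D u w p))"

definition gen_torsion ::
  "('p, 'n::finite) frame \<Rightarrow> (real^'n \<Rightarrow> real^'n \<Rightarrow> real^'n) \<Rightarrow>
   (real^'n \<Rightarrow> real^'n \<Rightarrow> real^'n \<Rightarrow> real) \<Rightarrow> (real^'n \<Rightarrow> real^'n \<Rightarrow> real) \<Rightarrow>
   (('p, 'n) sect \<Rightarrow> ('p, 'n) sect \<Rightarrow> ('p, 'n) sect) \<Rightarrow>
   ('p, 'n) sect \<Rightarrow> ('p, 'n) sect \<Rightarrow> ('p, 'n) sect \<Rightarrow> 'p \<Rightarrow> real" where
  "gen_torsion \<rho> br H F D u v w p =
     pairing (D u v p - D v u p - dorfman \<rho> br H F u v p) (w p) + pairing (v p) (D w u p)"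

definition levi_civita ::
  "('p::topological_space, real^'n) chart set \<Rightarrow> ('p, 'n::finite) frame \<Rightarrow>
   (real^'n \<Rightarrow> real^'n \<Rightarrow> real^'n) \<Rightarrow>
   (real^'n \<Rightarrow> real^'n \<Rightarrow> real^'n \<Rightarrow> real) \<Rightarrow> (real^'n \<Rightarrow> real^'n \<Rightarrow> real) \<Rightarrow>
   'n fibre set \<Rightarrow> (('p, 'n) sect \<Rightarrow> ('p, 'n) sect \<Rightarrow> ('p, 'n) sect) \<Rightarrow> bool" where
  "levi_civita \<A> \<rho> br H F W D \<longleftrightarrow> generalized_connection \<A> \<rho> D \<and>
     (\<forall>u\<in>sections \<A>. \<forall>v\<in>sections \<A>. \<forall>w\<in>sections \<A>. \<forall>p. gen_torsion \<rho> br H F D u v w p = 0) \<and>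
     (\<forall>u\<in>sections \<A>. \<forall>v\<in>sections_in \<A> W. D u v \<in> sections_in \<A> W)"

definition divergence_operator ::
  "('p::topological_space, real^'n) chart set \<Rightarrow> ('p, 'n::finite) frame \<Rightarrow>
   (('p, 'n) sect \<Rightarrow> 'p \<Rightarrow> real) \<Rightarrow> bool" where
  "divergence_operator \<A> \<rho> \<delta> \<longleftrightarrow>
     (\<forall>u\<in>sections \<A>. smooth_map \<A> (\<delta> u)) \<and>
     (\<forall>u\<in>sections \<A>. \<forall>v\<in>sections \<A>. \<delta> (\<lambda>p. u p + v p) = (\<lambda>p. \<delta> u p + \<delta> v p)) \<and>
     (\<forall>f. \<forall>u\<in>sections \<A>. smooth_map \<A> f \<longrightarrow>
        \<delta> (\<lambda>p. f p *\<^sub>R u p) = (\<lambda>p. \<rho> (vec_part (u p)) f p + f p * \<delta> u p))"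

definition left_invariant_divergence :: "(('p, 'n::finite) sect \<Rightarrow> 'p \<Rightarrow> real) \<Rightarrow> bool" where
  "left_invariant_divergence \<delta> \<longleftrightarrow> (\<forall>e. \<exists>c. \<delta> (\<lambda>p. e) = (\<lambda>p. c))"

text \<open>A left-invariant divergence operator is identified with its restriction to the left-invariant
  sections; being divergence-free means that this restriction is zero. (The operator itself is never
  zero on all sections, by the Leibniz rule.)\<close>

definition divergence_free :: "(('p, 'n::finite) sect \<Rightarrow> 'p \<Rightarrow> real) \<Rightarrow> bool" where
  "divergence_free \<delta> \<longleftrightarrow> (\<forall>e. \<delta> (\<lambda>p. e) = (\<lambda>p. 0))"

text \<open>Trace of an endomorphism \<open>f\<close> of the finite-dimensional subspace \<open>S\<close>; it does not depend on the
  basis.\<close>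

definition subspace_trace :: "'a::euclidean_space set \<Rightarrow> ('a \<Rightarrow> 'a) \<Rightarrow> real" where
  "subspace_trace S f =
     (let B = (SOME B. B \<subseteq> S \<and> independent B \<and> span B = S)
      in \<Sum>b\<in>B. representation B (f b) b)"

text \<open>The traces below are traces of \<open>C\<^sup>\<infinity>\<close>-linear operators on sections, hence of endomorphisms of the
  fibres; the value at a vector \<open>e\<close> of a fibre is obtained by extending \<open>e\<close> to a left-invariant section.\<close>

definition divergence_of ::
  "(('p, 'n::finite) sect \<Rightarrow> ('p, 'n) sect \<Rightarrow> ('p, 'n) sect) \<Rightarrow> ('p, 'n) sect \<Rightarrow> 'p \<Rightarrow> real" where
  "divergence_of D u p = subspace_trace UNIV (\<lambda>e. D (\<lambda>q. e) u p)"

definition curvature ::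
  "('p, 'n::finite) frame \<Rightarrow> (real^'n \<Rightarrow> real^'n \<Rightarrow> real^'n) \<Rightarrow>
   (real^'n \<Rightarrow> real^'n \<Rightarrow> real^'n \<Rightarrow> real) \<Rightarrow> (real^'n \<Rightarrow> real^'n \<Rightarrow> real) \<Rightarrow>
   (('p, 'n) sect \<Rightarrow> ('p, 'n) sect \<Rightarrow> ('p, 'n) sect) \<Rightarrow>
   ('p, 'n) sect \<Rightarrow> ('p, 'n) sect \<Rightarrow> ('p, 'n) sect \<Rightarrow> ('p, 'n) sect" where
  "curvature \<rho> br H F D u v w =
     (\<lambda>p. D u (D v w) p - D v (D u w) p - D (dorfman \<rho> br H F u v) w p)"

text \<open>For \<open>V = E\<^sub>+\<close> this is the tensor \<open>Ric\<^sup>+\<close> on \<open>E\<^sub>- \<times> E\<^sub>+\<close>, for \<open>V = E\<^sub>-\<close> it is \<open>Ric\<^sup>-\<close> on \<open>E\<^sub>+ \<times> E\<^sub>-\<close>.\<close>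

definition ricci_on ::
  "('n::finite) fibre set \<Rightarrow> ('p, 'n) frame \<Rightarrow> (real^'n \<Rightarrow> real^'n \<Rightarrow> real^'n) \<Rightarrow>
   (real^'n \<Rightarrow> real^'n \<Rightarrow> real^'n \<Rightarrow> real) \<Rightarrow> (real^'n \<Rightarrow> real^'n \<Rightarrow> real) \<Rightarrow>
   (('p, 'n) sect \<Rightarrow> ('p, 'n) sect \<Rightarrow> ('p, 'n) sect) \<Rightarrow>
   ('p, 'n) sect \<Rightarrow> ('p, 'n) sect \<Rightarrow> 'p \<Rightarrow> real" where
  "ricci_on V \<rho> br H F D u v p = subspace_trace V (\<lambda>e. curvature \<rho> br H F D (\<lambda>q. e) u v p)"

text \<open>The tensors \<open>Ric\<^sup>\<plusminus>\<close> are computed with a Levi-Civita generalized connection of divergence \<open>\<delta>\<close>;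
  such connections exist and the tensors do not depend on the choice.\<close>

definition ricci_flat ::
  "('p::topological_space, real^'n) chart set \<Rightarrow> ('p, 'n::finite) frame \<Rightarrow>
   (real^'n \<Rightarrow> real^'n \<Rightarrow> real^'n) \<Rightarrow>
   (real^'n \<Rightarrow> real^'n \<Rightarrow> real^'n \<Rightarrow> real) \<Rightarrow> (real^'n \<Rightarrow> real^'n \<Rightarrow> real) \<Rightarrow>
   'n fibre set \<Rightarrow> (('p, 'n) sect \<Rightarrow> 'p \<Rightarrow> real) \<Rightarrow> bool" where
  "ricci_flat \<A> \<rho> br H F W \<delta> \<longleftrightarrow>
     (\<exists>D. levi_civita \<A> \<rho> br H F W D \<and>
        (\<forall>u\<in>sections \<A>. divergence_of D u = \<delta> u) \<and>
        (\<forall>u\<in>sections_in \<A> W. \<forall>v\<in>sections_in \<A> (orth W). \<forall>p.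
           ricci_on (orth W) \<rho> br H F D u v p = 0) \<and>
        (\<forall>u\<in>sections_in \<A> (orth W). \<forall>v\<in>sections_in \<A> W. \<forall>p.
           ricci_on W \<rho> br H F D u v p = 0))"

text \<open>In dimension three the condition \<open>dH + F \<and> F = 0\<close> is void, as both sides are four-forms.\<close>

definition odd_einstein ::
  "('p::topological_space, real^3) chart set \<Rightarrow> ('p, 3) frame \<Rightarrow>
   (real^3 \<Rightarrow> real^3 \<Rightarrow> real^3) \<Rightarrow>
   (real^3 \<Rightarrow> real^3 \<Rightarrow> real^3 \<Rightarrow> real) \<Rightarrow> (real^3 \<Rightarrow> real^3 \<Rightarrow> real) \<Rightarrow>
   3 fibre set \<Rightarrow> (('p, 3) sect \<Rightarrow> 'p \<Rightarrow> real) \<Rightarrow> bool" where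
  "odd_einstein \<A> \<rho> br H F W \<delta> \<longleftrightarrow>
     three_form H \<and> two_form F \<and> closed_two_form br F \<and> generalized_metric W \<and>
     divergence_operator \<A> \<rho> \<delta> \<and> left_invariant_divergence \<delta> \<and> ricci_flat \<A> \<rho> br H F W \<delta>"

definition odd_einstein_metric ::
  "('p::topological_space, real^3) chart set \<Rightarrow> ('p, 3) frame \<Rightarrow>
   (real^3 \<Rightarrow> real^3 \<Rightarrow> real^3) \<Rightarrow>
   (real^3 \<Rightarrow> real^3 \<Rightarrow> real) \<Rightarrow> (('p, 3) sect \<Rightarrow> 'p \<Rightarrow> real) \<Rightarrow> bool" where
  "odd_einstein_metric \<A> \<rho> br g \<delta> \<longleftrightarrow> pseudo_metric g \<and>
     (\<exists>H F. F \<noteq> (\<lambda>x y. 0) \<and> odd_einstein \<A> \<rho> br H F (E_minus g) \<delta>)"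

end

theory Submission
  imports Defs
begin

text \<open>
  Two steps lead to the theorem: the Einstein condition is a system of polynomial equations on the Lie
  algebra, and these equations can be solved completely in suitable bases.

  A Levi-Civita generalized connection is far from unique, but torsion-freeness determines its mixed
  part \<open>D\<^sub>u v = [u, v]\<^sub>+\<close> for \<open>u \<in> E\<^sub>-\<close>, \<open>v \<in> E\<^sub>+\<close>. In the trace that defines \<open>Ric\<^sup>+\<close> the undetermined part enters
  once through \<open>D\<^sub>u\<close> composed with \<open>w \<mapsto> D\<^sub>w v\<close>, in both orders and with opposite signs, and
  otherwise through the divergence (\<open>ricci_formula\<close>):
  \<open>Ric\<^sup>+(u, v) = \<delta>([u, v]\<^sub>+) - tr (w \<mapsto> [[w, u]\<^sub>-, v]\<^sub>+)\<close>, and similarly for \<open>Ric\<^sup>-\<close>. If the connection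
  is not left-invariant, the additional term is the derivative of a divergence and vanishes
  (\<open>ricci_const\<close>). Conversely every linear form on the left-invariant sections is the divergence of an
  explicit connection (\<open>conn_divergence\<close>). So Einstein metrics correspond to solutions of
  \<open>einstein_equations\<close>, in which the brackets of \<open>E\<^sub>-\<close> with \<open>E\<^sub>+\<close> are the coefficients of the metric
  connections \<open>\<nabla> \<mp> H/2\<close> (\<open>odd_einstein_metric_imp_equations\<close>, \<open>equations_imp_odd_einstein_metric\<close>).

  A non-unimodular Lie algebra of dimension three has a basis \<open>e, u, v\<close> whose last two vectors span
  the unimodular kernel, an abelian ideal, on which \<open>ad\<^sub>e\<close> acts by a matrix with rows \<open>(a, b)\<close>, \<open>(c, d)\<close> and
  \<open>a + d \<noteq> 0\<close>. Closed two-forms vanish on the ideal.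

  If \<open>g\<close> is degenerate on the ideal, \<open>u\<close> can be chosen in the radical. For vanishing divergence the
  equations force \<open>c = 0\<close> (\<open>divergence_free_imp_eigenvector\<close>), which is impossible if \<open>ad\<^sub>e\<close> has no real
  eigenvector. If \<open>c = 0\<close>, the choice \<open>H = 0\<close> leaves one equation for \<open>\<delta>(e)\<close>, which can be satisfied
  with or without divergence when \<open>a \<noteq> 0\<close> (\<open>isotropic_kernel_solution\<close>). If \<open>c \<noteq> 0\<close>, a suitable \<open>H\<close> gives a solution with
  divergence (\<open>twisted_kernel_solution\<close>).

  If \<open>g\<close> is non-degenerate on the ideal, take \<open>e\<close> orthogonal to it and \<open>u\<close> dual to \<open>F(e, \<sqdot>)\<close>. The equations
  on \<open>E\<^sub>- \<times> \<real>\<close> say that \<open>u\<close> is an eigenvector of \<open>ad\<^sub>e + 2 T\<close> with eigenvalue \<open>- \<delta>(e)\<close>, where the skew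
  endomorphism \<open>T\<close> is \<open>H(e, \<sqdot>, \<sqdot>)/2\<close>. The remaining equations leave the ratios \<open>0\<close> and \<open>1/2\<close> of the eigenvalues
  of \<open>ad\<^sub>e\<close> if \<open>u\<close> is not null (\<open>orth_frame_classification\<close>), \<open>0\<close> and \<open>-1/2\<close> if it is
  (\<open>isotropic_frame_classification\<close>), and \<open>\<delta>(e) \<noteq> 0\<close> in every case. For each ratio a solution is
  written down (\<open>orthogonal_solution\<close>, \<open>isotropic_solution\<close>).
\<close>


section \<open>Smooth functions on an atlas\<close>

text \<open>As \<open>S\<close> is open, derivatives at its points do not see values outside of \<open>S\<close>. This allows the
  derivative of a composite to be replaced by the expression that a differentiation rule gives for it.\<close>

lemma Ck_on_cong:
  assumes "open S" "\<And>x. x \<in> S \<Longrightarrow> f x = g x"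
  shows "Ck_on k f S \<longleftrightarrow> Ck_on k g S"
  using assms(2)
proof (induction k arbitrary: f g)
  case 0
  then show ?case using continuous_on_cong by fastforce
next
  case (Suc k)
  have "frechet_derivative f (at x) v = frechet_derivative g (at x) v" if "x \<in> S" for x v
  proof -
    have "(f has_derivative D) (at x) \<longleftrightarrow> (g has_derivative D) (at x)" for D
      using has_derivative_transform_within_open[OF _ assms(1) that, of f D UNIV g]
        has_derivative_transform_within_open[OF _ assms(1) that, of g D UNIV f] Suc.prems by auto
    then show ?thesis by (simp add: frechet_derivative_def)
  qed
  then have "Ck_on k (\<lambda>x. frechet_derivative f (at x) v) S \<longleftrightarrow>
      Ck_on k (\<lambda>x. frechet_derivative g (at x) v) S" for v
    by (rule Suc.IH)
  moreover have "f differentiable_on S \<longleftrightarrow> g differentiable_on S"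
    unfolding differentiable_on_def
    by (metis Suc.prems differentiable_transform_within zero_less_one)
  ultimately show ?case by simp
qed

lemma frechet_on:
  assumes "open S" "f differentiable_on S" "x \<in> S"
  shows "(f has_derivative frechet_derivative f (at x)) (at x)"
  using assms by (metis differentiable_on_eq_differentiable_at frechet_derivative_works)

lemma Ck_on_const: "Ck_on k (\<lambda>x. c) S"
proof (induction k arbitrary: c)
  case (Suc k)
  have "frechet_derivative (\<lambda>x::'a. c) (at x) v = 0" for x v
    using frechet_derivative_at[OF has_derivative_const, of c x] by metis
  then show ?case using Suc by (simp add: differentiable_on_const)
qed simp

lemma Ck_on_Suc_imp:
  assumes "Ck_on (Suc k) f S"
  shows "Ck_on k f S"
  using assms
proof (induction k arbitrary: f)
  case 0
  then show ?case by (simp add: differentiable_imp_continuous_on)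
qed simp

lemma Ck_on_bounded_linear:
  assumes "open S" "bounded_linear L" "Ck_on k f S"
  shows "Ck_on k (\<lambda>x. L (f x)) S"
  using assms(3)
proof (induction k arbitrary: f)
  case 0
  then show ?case using assms(2) bounded_linear.continuous_on by fastforce
next
  case (Suc k)
  have d: "((\<lambda>x. L (f x)) has_derivative (\<lambda>v. L (frechet_derivative f (at x) v))) (at x)"
    if "x \<in> S" for x
    using bounded_linear.has_derivative[OF assms(2) frechet_on[OF assms(1) _ that]] Suc.prems by simp
  have "Ck_on k (\<lambda>x. frechet_derivative (\<lambda>x. L (f x)) (at x) v) S" for v
    using Suc.IH[of "\<lambda>x. frechet_derivative f (at x) v"] Suc.prems
      Ck_on_cong[OF assms(1), of "\<lambda>x. frechet_derivative (\<lambda>x. L (f x)) (at x) v"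
        "\<lambda>x. L (frechet_derivative f (at x) v)"]
    by (simp add: frechet_derivative_at[OF d, symmetric])
  moreover have "(\<lambda>x. L (f x)) differentiable_on S"
    using d assms(1) by (meson differentiable_def differentiable_on_eq_differentiable_at)
  ultimately show ?case by simp
qed

lemma Ck_on_add:
  assumes "open S" "Ck_on k f S" "Ck_on k g S"
  shows "Ck_on k (\<lambda>x. f x + g x) S"
  using assms(2,3)
proof (induction k arbitrary: f g)
  case 0
  then show ?case by (simp add: continuous_on_add)
next
  case (Suc k)
  have d: "((\<lambda>x. f x + g x) has_derivative
      (\<lambda>v. frechet_derivative f (at x) v + frechet_derivative g (at x) v)) (at x)" if "x \<in> S" for x
    using Suc.prems that by (intro has_derivative_add frechet_on[OF assms(1)]) auto
  have "Ck_on k (\<lambda>x. frechet_derivative (\<lambda>x. f x + g x) (at x) v) S" for v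
    using Suc.IH[of "\<lambda>x. frechet_derivative f (at x) v" "\<lambda>x. frechet_derivative g (at x) v"] Suc.prems
      Ck_on_cong[OF assms(1), of "\<lambda>x. frechet_derivative (\<lambda>x. f x + g x) (at x) v"
        "\<lambda>x. frechet_derivative f (at x) v + frechet_derivative g (at x) v"]
    by (simp add: frechet_derivative_at[OF d, symmetric])
  moreover have "(\<lambda>x. f x + g x) differentiable_on S"
    using d assms(1) by (meson differentiable_def differentiable_on_eq_differentiable_at)
  ultimately show ?case by simp
qed

text \<open>Each summand of the product rule keeps one factor undifferentiated, so that factor has to be
  demoted from \<open>C\<^sup>k\<^sup>+\<^sup>1\<close> to \<open>C\<^sup>k\<close> before the induction hypothesis applies.\<close>

lemma Ck_on_bounded_bilinear:
  assumes "open S" "bounded_bilinear h" "Ck_on k f S" "Ck_on k g S"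
  shows "Ck_on k (\<lambda>x. h (f x) (g x)) S"
  using assms(3,4)
proof (induction k arbitrary: f g)
  case 0
  then show ?case using assms(2) bounded_bilinear.continuous_on by fastforce
next
  case (Suc k)
  have d: "((\<lambda>x. h (f x) (g x)) has_derivative
      (\<lambda>v. h (f x) (frechet_derivative g (at x) v) + h (frechet_derivative f (at x) v) (g x))) (at x)"
    if "x \<in> S" for x
    using Suc.prems that
    by (intro bounded_bilinear.FDERIV[OF assms(2)] frechet_on[OF assms(1)]) auto
  have "Ck_on k (\<lambda>x. h (f x) (frechet_derivative g (at x) v)
      + h (frechet_derivative f (at x) v) (g x)) S" for v
    using Suc.prems by (intro Ck_on_add[OF assms(1)] Suc.IH Ck_on_Suc_imp[of k f]
        Ck_on_Suc_imp[of k g]) auto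
  then have "Ck_on k (\<lambda>x. frechet_derivative (\<lambda>x. h (f x) (g x)) (at x) v) S" for v
    using Ck_on_cong[OF assms(1), of "\<lambda>x. frechet_derivative (\<lambda>x. h (f x) (g x)) (at x) v"
        "\<lambda>x. h (f x) (frechet_derivative g (at x) v) + h (frechet_derivative f (at x) v) (g x)"]
    by (simp add: frechet_derivative_at[OF d, symmetric])
  moreover have "(\<lambda>x. h (f x) (g x)) differentiable_on S"
    using d assms(1) by (meson differentiable_def differentiable_on_eq_differentiable_at)
  ultimately show ?case by simp
qed

lemma smooth_map_const: "smooth_map \<A> (\<lambda>p. c)"
  by (auto simp: smooth_map_def smooth_on_def comp_def Ck_on_const)

lemma smooth_map_bounded_linear:
  assumes "smooth_atlas \<A>" "bounded_linear L" "smooth_map \<A> f"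
  shows "smooth_map \<A> (\<lambda>p. L (f p))"
  using assms Ck_on_bounded_linear[OF _ assms(2)]
  unfolding smooth_map_def smooth_on_def smooth_atlas_def comp_def by fastforce

lemma smooth_map_bounded_bilinear:
  assumes "smooth_atlas \<A>" "bounded_bilinear h" "smooth_map \<A> f" "smooth_map \<A> g"
  shows "smooth_map \<A> (\<lambda>p. h (f p) (g p))"
  using assms Ck_on_bounded_bilinear[OF _ assms(2)]
  unfolding smooth_map_def smooth_on_def smooth_atlas_def comp_def by fastforce

lemma smooth_map_add:
  assumes "smooth_atlas \<A>" "smooth_map \<A> f" "smooth_map \<A> g"
  shows "smooth_map \<A> (\<lambda>p. f p + g p)"
  using assms Ck_on_add
  unfolding smooth_map_def smooth_on_def smooth_atlas_def comp_def by fastforce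

lemma smooth_map_sum:
  assumes "smooth_atlas \<A>" "finite I" "\<And>i. i \<in> I \<Longrightarrow> smooth_map \<A> (f i)"
  shows "smooth_map \<A> (\<lambda>p. \<Sum>i\<in>I. f i p)"
  using assms(2,3) by (induction I) (auto simp: smooth_map_const intro: smooth_map_add[OF assms(1)])

section \<open>Traces\<close>

definition ftrace :: "('a::euclidean_space \<Rightarrow> 'a) \<Rightarrow> real" where
  "ftrace L = (\<Sum>b\<in>Basis. L b \<bullet> b)"

text \<open>Every change of basis in a trace below is an instance of this: dual bases write an
  endomorphism as a sum of rank-one maps.\<close>

lemma ftrace_rank_one_sum:
  assumes "finite I" "\<And>i. i \<in> I \<Longrightarrow> linear (\<phi> i)" "\<And>x. L x = (\<Sum>i\<in>I. \<phi> i x *\<^sub>R u i)"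
  shows "ftrace L = (\<Sum>i\<in>I. \<phi> i (u i))"
proof -
  have "ftrace L = (\<Sum>b\<in>Basis. \<Sum>i\<in>I. \<phi> i b * (u i \<bullet> b))"
    by (simp add: ftrace_def assms(3) inner_sum_left)
  also have "\<dots> = (\<Sum>i\<in>I. \<Sum>b\<in>Basis. \<phi> i b * (u i \<bullet> b))"
    by (rule sum.swap)
  also have "\<dots> = (\<Sum>i\<in>I. \<phi> i (u i))"
  proof (rule sum.cong[OF refl])
    fix i assume "i \<in> I"
    have "\<phi> i (u i) = \<phi> i (\<Sum>b\<in>Basis. (u i \<bullet> b) *\<^sub>R b)"
      by (simp add: euclidean_representation)
    also have "\<dots> = (\<Sum>b\<in>Basis. \<phi> i b * (u i \<bullet> b))"
      using assms(2)[OF \<open>i \<in> I\<close>] by (simp add: linear_sum linear_scale mult.commute)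
    finally show "(\<Sum>b\<in>Basis. \<phi> i b * (u i \<bullet> b)) = \<phi> i (u i)" ..
  qed
  finally show ?thesis .
qed

lemma ftrace_comp_commute:
  fixes L :: "'a::euclidean_space \<Rightarrow> 'b::euclidean_space" and M :: "'b \<Rightarrow> 'a"
  assumes "linear L" "linear M"
  shows "ftrace (\<lambda>x. L (M x)) = ftrace (\<lambda>x. M (L x))"
proof -
  have "L (M x) = (\<Sum>b\<in>Basis. (M x \<bullet> b) *\<^sub>R L b)" for x
  proof -
    have "L (M x) = L (\<Sum>b\<in>Basis. (M x \<bullet> b) *\<^sub>R b)"
      by (simp add: euclidean_representation)
    then show ?thesis using assms(1) by (simp add: linear_sum linear_scale)
  qed
  then have "ftrace (\<lambda>x. L (M x)) = (\<Sum>b\<in>Basis. M (L b) \<bullet> b)"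
    using assms(2)
    by (intro ftrace_rank_one_sum[where \<phi> = "\<lambda>b x. M x \<bullet> b"]) (auto simp: linear_iff inner_add_left)
  then show ?thesis by (simp add: ftrace_def)
qed

lemma ftrace_add: "ftrace (\<lambda>x. L x + M x) = ftrace L + ftrace M"
  by (simp add: ftrace_def inner_add_left sum.distrib)

lemma ftrace_diff: "ftrace (\<lambda>x. L x - M x) = ftrace L - ftrace M"
  by (simp add: ftrace_def inner_diff_left sum_subtractf)

lemma ftrace_scale: "ftrace (\<lambda>x. c *\<^sub>R L x) = c * ftrace L"
  by (simp add: ftrace_def sum_distrib_left)

lemma ftrace_zero: "ftrace (\<lambda>x. 0) = 0"
  by (simp add: ftrace_def)

text \<open>Composed with a projection \<open>\<pi>\<close> onto \<open>V\<close>, the map becomes an endomorphism of the whole space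
  with the same trace. This avoids bases of subspaces and makes traces over \<open>E\<^sub>+\<close> and \<open>E\<^sub>-\<close> cyclic.\<close>

lemma subspace_trace_eq_ftrace:
  fixes f \<pi> :: "'a::euclidean_space \<Rightarrow> 'a"
  assumes "subspace V" "linear f" "linear \<pi>" "\<And>x. \<pi> x \<in> V" "\<And>x. x \<in> V \<Longrightarrow> \<pi> x = x"
    and "\<And>x. x \<in> V \<Longrightarrow> f x \<in> V"
  shows "subspace_trace V f = ftrace (\<lambda>x. f (\<pi> x))"
proof -
  define B where "B = (SOME B. B \<subseteq> V \<and> independent B \<and> span B = V)"
  have "\<exists>B. B \<subseteq> V \<and> independent B \<and> span B = V"
    by (metis basis_exists assms(1) span_minimal subset_antisym)
  then have B: "B \<subseteq> V" "independent B" "span B = V"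
    unfolding B_def by (metis (mono_tags, lifting) someI_ex)+
  have "finite B" using B(2) independent_imp_finite by blast
  have "linear (\<lambda>x. representation B (\<pi> x) b)" for b
    using B assms(3,4)
    by (auto simp: linear_iff representation_add representation_scale)
  moreover have "f (\<pi> x) = (\<Sum>b\<in>B. representation B (\<pi> x) b *\<^sub>R f b)" for x
  proof -
    have "\<pi> x = (\<Sum>b\<in>B. representation B (\<pi> x) b *\<^sub>R b)"
      using B assms(4) \<open>finite B\<close> by (simp add: sum_representation_eq)
    then have "f (\<pi> x) = f (\<Sum>b\<in>B. representation B (\<pi> x) b *\<^sub>R b)" by simp
    then show ?thesis using assms(2) by (simp add: linear_sum linear_scale)
  qed
  ultimately have "ftrace (\<lambda>x. f (\<pi> x)) = (\<Sum>b\<in>B. representation B (\<pi> (f b)) b)"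
    by (intro ftrace_rank_one_sum[OF \<open>finite B\<close>])
  also have "\<dots> = subspace_trace V f"
    using assms(5,6) B(1) by (auto simp: subspace_trace_def Let_def B_def[symmetric] intro!: sum.cong)
  finally show ?thesis by simp
qed

section \<open>Derivatives along left-invariant fields\<close>

text \<open>The derivative of a vector-valued function, taken componentwise.\<close>

definition dsec :: "('p, 'n::finite) frame \<Rightarrow> real^'n \<Rightarrow> ('p \<Rightarrow> 'b::euclidean_space) \<Rightarrow> 'p \<Rightarrow> 'b" where
  "dsec \<rho> x v p = (\<Sum>b\<in>Basis. \<rho> x (\<lambda>q. v q \<bullet> b) p *\<^sub>R b)"

locale lie_frame =
  fixes \<A> :: "('p::topological_space, real^'n) chart set"
    and br :: "real^'n \<Rightarrow> real^'n \<Rightarrow> real^'n"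
    and \<rho> :: "('p, 'n::finite) frame"
  assumes atlas: "smooth_atlas \<A>"
    and br_bilinear: "bilinear br"
    and br_alt: "br x x = 0"
    and rho_field: "vector_field \<A> (\<rho> x)"
    and rho_add_left: "\<rho> (x + y) f p = \<rho> x f p + \<rho> y f p"
    and rho_scale_left: "\<rho> (c *\<^sub>R x) f p = c * \<rho> x f p"
    and rho_br: "smooth_map \<A> f \<Longrightarrow> \<rho> (br x y) f p = \<rho> x (\<rho> y f) p - \<rho> y (\<rho> x f) p"
begin

lemmas smooth_const = smooth_map_const[of \<A>]
lemmas smooth_bounded_linear = smooth_map_bounded_linear[OF atlas]
lemmas smooth_bounded_bilinear = smooth_map_bounded_bilinear[OF atlas]
lemmas smooth_add = smooth_map_add[OF atlas]
lemmas smooth_sum = smooth_map_sum[OF atlas]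

lemma smooth_linear:
  fixes L :: "'a::euclidean_space \<Rightarrow> 'b::real_normed_vector"
  assumes "linear L" "smooth_map \<A> v"
  shows "smooth_map \<A> (\<lambda>p. L (v p))"
  using assms smooth_bounded_linear linear_conv_bounded_linear by blast

lemma smooth_bilinear:
  fixes h :: "'a::euclidean_space \<Rightarrow> 'b::euclidean_space \<Rightarrow> 'c::real_normed_vector"
  assumes "bilinear h" "smooth_map \<A> v" "smooth_map \<A> w"
  shows "smooth_map \<A> (\<lambda>p. h (v p) (w p))"
  using assms smooth_bounded_bilinear bilinear_conv_bounded_bilinear by blast

lemma smooth_inner: "smooth_map \<A> v \<Longrightarrow> smooth_map \<A> (\<lambda>p. v p \<bullet> b)"
  by (rule smooth_bounded_linear[OF bounded_linear_inner_left])

lemma smooth_scaleR: "smooth_map \<A> f \<Longrightarrow> smooth_map \<A> v \<Longrightarrow> smooth_map \<A> (\<lambda>p. f p *\<^sub>R v p)"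
  by (rule smooth_bounded_bilinear[OF bounded_bilinear_scaleR])

lemma smooth_mult:
  fixes f h :: "'p \<Rightarrow> real"
  shows "smooth_map \<A> f \<Longrightarrow> smooth_map \<A> h \<Longrightarrow> smooth_map \<A> (\<lambda>p. f p * h p)"
  by (rule smooth_bounded_bilinear[OF bounded_bilinear_mult])

lemma rho_smooth: "smooth_map \<A> f \<Longrightarrow> smooth_map \<A> (\<rho> x f)"
  using rho_field[of x] by (simp add: vector_field_def)

lemma rho_add:
  "smooth_map \<A> f \<Longrightarrow> smooth_map \<A> h \<Longrightarrow> \<rho> x (\<lambda>q. f q + h q) p = \<rho> x f p + \<rho> x h p"
  using rho_field[of x] unfolding vector_field_def by meson

lemma rho_mult:
  assumes "smooth_map \<A> f" "smooth_map \<A> h"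
  shows "\<rho> x (\<lambda>q. f q * h q) p = \<rho> x f p * h p + f p * \<rho> x h p"
proof -
  have "\<rho> x (\<lambda>q. f q * h q) = (\<lambda>p. \<rho> x f p * h p + f p * \<rho> x h p)"
    using rho_field[of x] assms unfolding vector_field_def by blast
  then show ?thesis by simp
qed

lemma rho_const: "\<rho> x (\<lambda>q. c) p = 0"
proof -
  have "\<rho> x (\<lambda>q. 1 * 1) p = \<rho> x (\<lambda>q. 1) p * 1 + 1 * \<rho> x (\<lambda>q. 1) p"
    by (rule rho_mult) (rule smooth_const)+
  then have *: "\<rho> x (\<lambda>q. 1) p = 0" by simp
  have "\<rho> x (\<lambda>q. c * 1) = (\<lambda>p. c * \<rho> x (\<lambda>q. 1) p)"
    using rho_field[of x] smooth_const unfolding vector_field_def by blast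
  then show ?thesis using * by (metis mult.right_neutral mult_zero_right)
qed

lemma rho_sum:
  assumes "finite I" "\<And>i. i \<in> I \<Longrightarrow> smooth_map \<A> (f i)"
  shows "\<rho> x (\<lambda>q. \<Sum>i\<in>I. f i q) p = (\<Sum>i\<in>I. \<rho> x (f i) p)"
  using assms
proof (induction I)
  case empty
  then show ?case by (simp add: rho_const)
next
  case (insert i I)
  then show ?case by (simp add: rho_add smooth_sum)
qed

lemma rho_linear_left: "linear (\<lambda>x. \<rho> x f p)"
  by (simp add: linear_iff rho_add_left rho_scale_left)

lemma dsec_inner: "b \<in> Basis \<Longrightarrow> dsec \<rho> x v p \<bullet> b = \<rho> x (\<lambda>q. v q \<bullet> b) p"
  by (simp add: dsec_def inner_sum_left inner_Basis if_distrib sum.delta cong: if_cong)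

lemma dsec_real: "dsec \<rho> x f p = \<rho> x f p" for f :: "'p \<Rightarrow> real"
  by (simp add: dsec_def)

lemma dsec_const: "dsec \<rho> x (\<lambda>q. c) p = 0"
  by (simp add: dsec_def rho_const)

lemma dsec_linear_left: "linear (\<lambda>x. dsec \<rho> x v p)"
  by (simp add: linear_iff dsec_def rho_add_left rho_scale_left scaleR_add_left sum.distrib
      scaleR_sum_right)

lemma dsec_bilinear:
  fixes h :: "'a::euclidean_space \<Rightarrow> 'b::euclidean_space \<Rightarrow> 'c::euclidean_space"
  assumes "bilinear h" "smooth_map \<A> v" "smooth_map \<A> w"
  shows "dsec \<rho> x (\<lambda>p. h (v p) (w p)) p = h (dsec \<rho> x v p) (w p) + h (v p) (dsec \<rho> x w p)"
proof (rule euclidean_eqI)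
  fix b :: 'c assume b: "b \<in> Basis"
  have exp: "h y z \<bullet> b = (\<Sum>i\<in>Basis. \<Sum>j\<in>Basis. ((y \<bullet> i) * (z \<bullet> j)) * (h i j \<bullet> b))" for y z
  proof -
    have "h y z = h (\<Sum>i\<in>Basis. (y \<bullet> i) *\<^sub>R i) (\<Sum>j\<in>Basis. (z \<bullet> j) *\<^sub>R j)"
      by (simp add: euclidean_representation)
    also have "\<dots> = (\<Sum>(i,j)\<in>Basis \<times> Basis. ((y \<bullet> i) * (z \<bullet> j)) *\<^sub>R h i j)"
      by (simp add: bilinear_sum[OF assms(1)] bilinear_lmul[OF assms(1)] bilinear_rmul[OF assms(1)]
          mult.commute)
    also have "\<dots> = (\<Sum>i\<in>Basis. \<Sum>j\<in>Basis. ((y \<bullet> i) * (z \<bullet> j)) *\<^sub>R h i j)"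
      by (simp add: sum.cartesian_product)
    finally show ?thesis by (simp add: inner_sum_left)
  qed
  note sm = smooth_inner[OF assms(2)] smooth_inner[OF assms(3)] smooth_mult smooth_const
  have "dsec \<rho> x (\<lambda>p. h (v p) (w p)) p \<bullet> b
      = \<rho> x (\<lambda>q. \<Sum>i\<in>Basis. \<Sum>j\<in>Basis. ((v q \<bullet> i) * (w q \<bullet> j)) * (h i j \<bullet> b)) p"
    unfolding dsec_inner[OF b] by (subst exp) (rule refl)
  also have "\<dots> = (\<Sum>i\<in>Basis. \<Sum>j\<in>Basis.
      (\<rho> x (\<lambda>q. v q \<bullet> i) p * (w p \<bullet> j) + (v p \<bullet> i) * \<rho> x (\<lambda>q. w q \<bullet> j) p) * (h i j \<bullet> b))"
    by (simp add: rho_sum rho_mult sm smooth_sum rho_const)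
  also have "\<dots> = (h (dsec \<rho> x v p) (w p) + h (v p) (dsec \<rho> x w p)) \<bullet> b"
    unfolding inner_add_left exp[of _ "w p"] exp[of "v p"]
    by (simp add: dsec_inner sum.distrib algebra_simps)
  finally show "dsec \<rho> x (\<lambda>p. h (v p) (w p)) p \<bullet> b =
      (h (dsec \<rho> x v p) (w p) + h (v p) (dsec \<rho> x w p)) \<bullet> b" .
qed

lemma dsec_linear:
  fixes L :: "'a::euclidean_space \<Rightarrow> 'b::euclidean_space"
  assumes "linear L" "smooth_map \<A> v"
  shows "dsec \<rho> x (\<lambda>p. L (v p)) p = L (dsec \<rho> x v p)"
proof -
  have "bilinear (\<lambda>(c::real) y. c *\<^sub>R L y)"
    using assms(1) by (auto simp: bilinear_def linear_iff algebra_simps)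
  from dsec_bilinear[OF this smooth_const assms(2), where x = x and p = p, of 1] show ?thesis
    by (simp add: dsec_const linear_0[OF assms(1)])
qed

lemma dsec_scaleR:
  assumes "smooth_map \<A> f" "smooth_map \<A> v"
  shows "dsec \<rho> x (\<lambda>p. f p *\<^sub>R v p) p = \<rho> x f p *\<^sub>R v p + f p *\<^sub>R dsec \<rho> x v p"
proof -
  have "bilinear (\<lambda>(c::real) (y::'a). c *\<^sub>R y)"
    by (auto simp: bilinear_def linear_iff algebra_simps)
  from dsec_bilinear[OF this assms] show ?thesis by (simp add: dsec_real)
qed

lemma dsec_add:
  assumes "smooth_map \<A> v" "smooth_map \<A> w"
  shows "dsec \<rho> x (\<lambda>p. v p + w p) p = dsec \<rho> x v p + dsec \<rho> x w p"
  by (rule euclidean_eqI) (simp add: dsec_inner inner_add_left rho_add smooth_inner assms)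

lemma dsec_sum:
  assumes "finite I" "\<And>i. i \<in> I \<Longrightarrow> smooth_map \<A> (f i)"
  shows "dsec \<rho> x (\<lambda>q. \<Sum>i\<in>I. f i q) p = (\<Sum>i\<in>I. dsec \<rho> x (f i) p)"
  using assms
proof (induction I)
  case empty
  then show ?case by (simp add: dsec_const)
next
  case (insert i I)
  then show ?case by (simp add: dsec_add smooth_sum)
qed

lemma dsec_smooth_const: "smooth_map \<A> v \<Longrightarrow> smooth_map \<A> (\<lambda>p. dsec \<rho> x v p)"
  unfolding dsec_def by (intro smooth_sum smooth_scaleR smooth_const rho_smooth smooth_inner) auto

lemma dsec_expand: "dsec \<rho> x v p = (\<Sum>i\<in>Basis. (x \<bullet> i) *\<^sub>R dsec \<rho> i v p)"
proof -
  have "dsec \<rho> x v p = dsec \<rho> (\<Sum>i\<in>Basis. (x \<bullet> i) *\<^sub>R i) v p"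
    by (simp add: euclidean_representation)
  also have "\<dots> = (\<Sum>i\<in>Basis. (x \<bullet> i) *\<^sub>R dsec \<rho> i v p)"
    unfolding linear_sum[OF dsec_linear_left] linear_scale[OF dsec_linear_left] by (rule refl)
  finally show ?thesis .
qed

lemma dsec_smooth:
  assumes "smooth_map \<A> X" "smooth_map \<A> v"
  shows "smooth_map \<A> (\<lambda>p. dsec \<rho> (X p) v p)"
proof -
  have "smooth_map \<A> (\<lambda>p. \<Sum>i\<in>Basis. (X p \<bullet> i) *\<^sub>R dsec \<rho> i v p)"
    using assms by (intro smooth_sum smooth_scaleR dsec_smooth_const smooth_inner) auto
  then show ?thesis by (simp add: dsec_expand[symmetric])
qed

lemma dsec_commutator:
  assumes "smooth_map \<A> v"
  shows "dsec \<rho> x (dsec \<rho> y v) p - dsec \<rho> y (dsec \<rho> x v) p = dsec \<rho> (br x y) v p"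
  by (rule euclidean_eqI) (simp add: inner_diff_left dsec_inner rho_br smooth_inner assms)

text \<open>The commutator of a left-invariant field with an arbitrary field \<open>X\<close> also differentiates the
  coefficients of \<open>X\<close>.\<close>

lemma dsec_commutator_field:
  assumes X: "smooth_map \<A> X" and v: "smooth_map \<A> v"
  shows "dsec \<rho> x (\<lambda>q. dsec \<rho> (X q) v q) p - dsec \<rho> (X p) (dsec \<rho> x v) p
    = dsec \<rho> (dsec \<rho> x X p + br x (X p)) v p"
proof -
  note lin = linear_add[OF dsec_linear_left] linear_sum[OF dsec_linear_left]
    linear_scale[OF dsec_linear_left]
  have Xp: "br x (X p) = (\<Sum>i\<in>Basis. (X p \<bullet> i) *\<^sub>R br x i)"
  proof -
    have l: "linear (br x)" using br_bilinear by (simp add: bilinear_def)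
    have "br x (\<Sum>i\<in>Basis. (X p \<bullet> i) *\<^sub>R i) = (\<Sum>i\<in>Basis. (X p \<bullet> i) *\<^sub>R br x i)"
      by (simp add: linear_sum[OF l] linear_scale[OF l])
    then show ?thesis by (simp add: euclidean_representation)
  qed
  have "dsec \<rho> x (\<lambda>q. dsec \<rho> (X q) v q) p
      = dsec \<rho> x (\<lambda>q. \<Sum>i\<in>Basis. (X q \<bullet> i) *\<^sub>R dsec \<rho> i v q) p"
    by (simp add: dsec_expand[symmetric])
  also have "\<dots> = (\<Sum>i\<in>Basis. (dsec \<rho> x X p \<bullet> i) *\<^sub>R dsec \<rho> i v p
      + (X p \<bullet> i) *\<^sub>R dsec \<rho> x (dsec \<rho> i v) p)"
    by (simp add: dsec_sum dsec_scaleR smooth_scaleR dsec_smooth_const smooth_inner X v dsec_inner)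
  finally have "dsec \<rho> x (\<lambda>q. dsec \<rho> (X q) v q) p - dsec \<rho> (X p) (dsec \<rho> x v) p
      = (\<Sum>i\<in>Basis. (dsec \<rho> x X p \<bullet> i) *\<^sub>R dsec \<rho> i v p)
        + (\<Sum>i\<in>Basis. (X p \<bullet> i) *\<^sub>R (dsec \<rho> x (dsec \<rho> i v) p - dsec \<rho> i (dsec \<rho> x v) p))"
    by (simp add: dsec_expand[of "X p"] sum.distrib sum_subtractf algebra_simps)
  also have "\<dots> = dsec \<rho> (dsec \<rho> x X p) v p + dsec \<rho> (br x (X p)) v p"
    by (simp add: dsec_commutator[OF v] Xp lin dsec_expand[of "dsec \<rho> x X p", symmetric])
  finally show ?thesis by (simp add: lin)
qed

end

section \<open>The bracket of left-invariant sections\<close>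

lemma bilinearI:
  assumes "\<And>x y z. h (x + y) z = h x z + h y z" "\<And>c x z. h (c *\<^sub>R x) z = c *\<^sub>R h x z"
    and "\<And>x y z. h x (y + z) = h x y + h x z" "\<And>c x z. h x (c *\<^sub>R z) = c *\<^sub>R h x z"
  shows "bilinear h"
  using assms by (auto simp: bilinear_def linear_iff)

lemma alternating_skew:
  assumes "bilinear h" "\<And>x. h x x = 0"
  shows "h x y = - h y x"
proof -
  have "h (x + y) (x + y) = 0" by (rule assms(2))
  then show ?thesis
    unfolding bilinear_ladd[OF assms(1)] bilinear_radd[OF assms(1)]
    by (simp add: assms(2) eq_neg_iff_add_eq_0 add.commute)
qed

lemma three_form_linear:
  assumes "three_form H"
  shows "linear (\<lambda>x. H x y z)" "linear (\<lambda>y. H x y z)" "linear (\<lambda>z. H x y z)"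
  using assms by (auto simp: three_form_def)

lemma three_form_skew:
  assumes "three_form H"
  shows "H x y z = - H y x z" "H x y z = - H x z y"
proof -
  have "bilinear (\<lambda>x y. H x y z)" "bilinear (\<lambda>y z. H x y z)" "\<And>x. H x x z = 0" "\<And>y. H x y y = 0"
    using assms by (auto simp: three_form_def bilinear_def)
  then show "H x y z = - H y x z" "H x y z = - H x z y"
    using alternating_skew[of "\<lambda>x y. H x y z" x y] alternating_skew[of "H x" y z] by simp_all
qed

lemma linear_parts: "linear vec_part" "linear form_part" "linear scal_part"
  by (auto simp: linear_iff vec_part_def form_part_def scal_part_def)

lemma parts_simps [simp]:
  "vec_part (x, \<xi>, l) = x" "form_part (x, \<xi>, l) = \<xi>" "scal_part (x, \<xi>, l) = l"
  "vec_part (e + e') = vec_part e + vec_part e'" "form_part (e + e') = form_part e + form_part e'"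
  "scal_part (e + e') = scal_part e + scal_part e'"
  "vec_part (e - e') = vec_part e - vec_part e'" "form_part (e - e') = form_part e - form_part e'"
  "scal_part (e - e') = scal_part e - scal_part e'"
  "vec_part (c *\<^sub>R e) = c *\<^sub>R vec_part e" "form_part (c *\<^sub>R e) = c *\<^sub>R form_part e"
  "scal_part (c *\<^sub>R e) = c * scal_part e"
  "vec_part 0 = 0" "form_part 0 = 0" "scal_part 0 = 0"
  by (auto simp: vec_part_def form_part_def scal_part_def)

lemma fibre_eqI:
  "vec_part e = vec_part e' \<Longrightarrow> form_part e = form_part e' \<Longrightarrow> scal_part e = scal_part e' \<Longrightarrow> e = e'"
  by (simp add: vec_part_def form_part_def scal_part_def prod_eq_iff)

lemma pairing_bilinear: "bilinear pairing"
  by (rule bilinearI) (simp_all add: pairing_def algebra_simps inner_add_left inner_add_right add_divide_distrib)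

lemmas pairing_simps =
  bilinear_ladd[OF pairing_bilinear] bilinear_radd[OF pairing_bilinear]
  bilinear_lmul[OF pairing_bilinear] bilinear_rmul[OF pairing_bilinear]
  bilinear_lsub[OF pairing_bilinear] bilinear_rsub[OF pairing_bilinear]
  bilinear_lneg[OF pairing_bilinear] bilinear_rneg[OF pairing_bilinear]
  bilinear_lzero[OF pairing_bilinear] bilinear_rzero[OF pairing_bilinear]

lemma pairing_commute: "pairing e e' = pairing e' e"
  by (simp add: pairing_def algebra_simps)

lemma pairing_nondegenerate:
  assumes "\<And>w. pairing e w = 0"
  shows "e = 0"
proof (rule fibre_eqI)
  have "form_part e \<bullet> form_part e = 0"
    using assms[of "(form_part e, 0, 0)"] by (simp add: pairing_def)
  then show "form_part e = form_part 0" by simp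
  have "vec_part e \<bullet> vec_part e = 0"
    using assms[of "(0, vec_part e, 0)"] by (simp add: pairing_def)
  then show "vec_part e = vec_part 0" by simp
  show "scal_part e = scal_part 0"
    using assms[of "(0, 0, 1)"] by (simp add: pairing_def)
qed

lemma linear_coordinates_inner:
  fixes L :: "real^'n \<Rightarrow> real"
  assumes "linear L"
  shows "(\<chi> i. L (evec i)) \<bullet> z = L z"
proof -
  have "L z = L (\<Sum>i\<in>UNIV. (z $ i) *\<^sub>R evec i)"
    by (simp add: basis_expansion scalar_mult_eq_scaleR[symmetric])
  also have "\<dots> = (\<Sum>i\<in>UNIV. (z $ i) * L (evec i))"
    using assms by (simp add: linear_sum linear_scale)
  finally show ?thesis by (simp add: inner_vec_def mult.commute)
qed

text \<open>The Dorfman bracket of two left-invariant sections; the terms with derivatives are absent.\<close>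

definition cbr ::
  "(real^'n \<Rightarrow> real^'n \<Rightarrow> real^'n) \<Rightarrow> (real^'n \<Rightarrow> real^'n \<Rightarrow> real^'n \<Rightarrow> real) \<Rightarrow>
   (real^'n \<Rightarrow> real^'n \<Rightarrow> real) \<Rightarrow> ('n::finite) fibre \<Rightarrow> 'n fibre \<Rightarrow> 'n fibre" where
  "cbr br H F e e' =
    (br (vec_part e) (vec_part e'),
     (\<chi> i. form_part e \<bullet> br (vec_part e') (evec i) - form_part e' \<bullet> br (vec_part e) (evec i)
        + H (vec_part e') (vec_part e) (evec i)
        - 2 * (scal_part e' * F (vec_part e) (evec i) - scal_part e * F (vec_part e') (evec i))),
     F (vec_part e) (vec_part e'))"

locale courant = lie_frame \<A> br \<rho>
  for \<A> :: "('p::topological_space, real^'n) chart set"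
    and br :: "real^'n \<Rightarrow> real^'n \<Rightarrow> real^'n"
    and \<rho> :: "('p, 'n::finite) frame" +
  fixes H :: "real^'n \<Rightarrow> real^'n \<Rightarrow> real^'n \<Rightarrow> real" and F :: "real^'n \<Rightarrow> real^'n \<Rightarrow> real"
  assumes H: "three_form H" and F: "two_form F"
begin

abbreviation "cb \<equiv> cbr br H F"

lemma F_bilinear: "bilinear F" and F_alt: "F x x = 0"
  using F by (auto simp: two_form_def)

lemmas F_skew = alternating_skew[OF F_bilinear F_alt]

lemmas br_skew = alternating_skew[OF br_bilinear br_alt]

lemmas H_linear = three_form_linear[OF H]

lemmas H_skew = three_form_skew[OF H]

text \<open>On left-invariant sections the bracket is encoded by a three-form. The two symmetries that
  follow are all that the computations of traces need to know about it.\<close>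

lemma pairing_cbr:
  "2 * pairing (cb u v) w = form_part w \<bullet> br (vec_part u) (vec_part v)
     + form_part u \<bullet> br (vec_part v) (vec_part w) + form_part v \<bullet> br (vec_part w) (vec_part u)
     - H (vec_part u) (vec_part v) (vec_part w)
     + 2 * (scal_part u * F (vec_part v) (vec_part w) + scal_part v * F (vec_part w) (vec_part u)
            + scal_part w * F (vec_part u) (vec_part v))"
proof -
  have lin: "linear (br x)" "linear (F x)" for x
    using br_bilinear F_bilinear by (auto simp: bilinear_def)
  have "linear (\<lambda>z. form_part u \<bullet> br (vec_part v) z - form_part v \<bullet> br (vec_part u) z
        + H (vec_part v) (vec_part u) z
        - 2 * (scal_part v * F (vec_part u) z - scal_part u * F (vec_part v) z))"
    using lin H_linear(3) by (auto simp: linear_iff algebra_simps inner_add_right)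
  from linear_coordinates_inner[OF this, of "vec_part w"] show ?thesis
    using H_skew(1)[of "vec_part v" "vec_part u" "vec_part w"] F_skew[of "vec_part w" "vec_part u"]
      br_skew[of "vec_part w" "vec_part u"]
    by (simp add: pairing_def cbr_def field_simps)
qed

lemma pairing_cbr_swap: "pairing (cb u v) w = - pairing (cb v u) w"
  using pairing_cbr[of u v w] pairing_cbr[of v u w]
    H_skew(1)[of "vec_part v" "vec_part u" "vec_part w"]
    F_skew[of "vec_part w" "vec_part u"] br_skew[of "vec_part w" "vec_part u"]
    F_skew[of "vec_part w" "vec_part v"] br_skew[of "vec_part w" "vec_part v"]
    F_skew[of "vec_part u" "vec_part v"] br_skew[of "vec_part u" "vec_part v"]
  by (simp add: algebra_simps)

lemma pairing_cbr_cycle: "pairing (cb u v) w = pairing (cb v w) u"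
  using pairing_cbr[of u v w] pairing_cbr[of v w u]
    H_skew(1)[of "vec_part u" "vec_part v" "vec_part w"] H_skew(2)[of "vec_part v" "vec_part w" "vec_part u"]
  by (simp add: algebra_simps)

lemma cbr_bilinear: "bilinear cb"
  by (rule bilinearI) (auto simp: cbr_def bilinear_ladd[OF br_bilinear] bilinear_radd[OF br_bilinear]
      bilinear_lmul[OF br_bilinear] bilinear_rmul[OF br_bilinear] bilinear_ladd[OF F_bilinear]
      bilinear_radd[OF F_bilinear] bilinear_lmul[OF F_bilinear] bilinear_rmul[OF F_bilinear]
      linear_add[OF H_linear(1)] linear_add[OF H_linear(2)] linear_scale[OF H_linear(1)]
      linear_scale[OF H_linear(2)] inner_add_left inner_add_right vec_eq_iff algebra_simps)

lemma dsec_parts: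
  assumes "smooth_map \<A> u"
  shows "\<rho> x (\<lambda>q. vec_part (u q) $ i) p = vec_part (dsec \<rho> x u p) $ i"
    and "\<rho> x (\<lambda>q. form_part (u q) \<bullet> y) p = form_part (dsec \<rho> x u p) \<bullet> y"
    and "\<rho> x (\<lambda>q. form_part (u q) $ i) p = form_part (dsec \<rho> x u p) $ i"
    and "\<rho> x (\<lambda>q. scal_part (u q)) p = scal_part (dsec \<rho> x u p)"
proof -
  have "linear (\<lambda>e. vec_part e $ i)" "linear (\<lambda>e. form_part e $ i)" "linear (\<lambda>e. form_part e \<bullet> y)" "linear scal_part"
    by (auto simp: linear_iff inner_add_left)
  from this[THEN dsec_linear, OF assms, of x p] show
    "\<rho> x (\<lambda>q. vec_part (u q) $ i) p = vec_part (dsec \<rho> x u p) $ i"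
    "\<rho> x (\<lambda>q. form_part (u q) \<bullet> y) p = form_part (dsec \<rho> x u p) \<bullet> y"
    "\<rho> x (\<lambda>q. form_part (u q) $ i) p = form_part (dsec \<rho> x u p) $ i"
    "\<rho> x (\<lambda>q. scal_part (u q)) p = scal_part (dsec \<rho> x u p)"
    by (simp_all add: dsec_real)
qed

text \<open>The last summand pairs with \<open>w\<close> to \<open>\<langle>v, \<partial>\<^bsub>\<pi>(w)\<^esub> u\<rangle>\<close>; it is what the torsion of a generalized
  connection corrects for.\<close>

lemma dorfman_eq:
  assumes u: "smooth_map \<A> u" and v: "smooth_map \<A> v"
  shows "dorfman \<rho> br H F u v p = dsec \<rho> (vec_part (u p)) v p - dsec \<rho> (vec_part (v p)) u p
    + cb (u p) (v p) + (0, \<chi> i. 2 * pairing (v p) (dsec \<rho> (evec i) u p), 0)"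
proof (rule fibre_eqI)
  have fb: "field_bracket \<rho> br (\<lambda>q. vec_part (u q)) (\<lambda>q. evec i) p
      = br (vec_part (u p)) (evec i) - vec_part (dsec \<rho> (evec i) u p)" for i
    by (simp add: field_bracket_def rho_const dsec_parts[OF u] vec_eq_iff)
  show "vec_part (dorfman \<rho> br H F u v p) = vec_part (dsec \<rho> (vec_part (u p)) v p
     - dsec \<rho> (vec_part (v p)) u p
    + cb (u p) (v p) + (0, \<chi> i. 2 * pairing (v p) (dsec \<rho> (evec i) u p), 0))"
    by (simp add: dorfman_def Let_def field_bracket_def comp_def dsec_parts[OF u] dsec_parts[OF v]
        cbr_def vec_eq_iff)
  show "scal_part (dorfman \<rho> br H F u v p) = scal_part (dsec \<rho> (vec_part (u p)) v p
     - dsec \<rho> (vec_part (v p)) u p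
    + cb (u p) (v p) + (0, \<chi> i. 2 * pairing (v p) (dsec \<rho> (evec i) u p), 0))"
    by (simp add: dorfman_def Let_def comp_def dsec_parts[OF u] dsec_parts[OF v] cbr_def)
  show "form_part (dorfman \<rho> br H F u v p) = form_part (dsec \<rho> (vec_part (u p)) v p
     - dsec \<rho> (vec_part (v p)) u p
    + cb (u p) (v p) + (0, \<chi> i. 2 * pairing (v p) (dsec \<rho> (evec i) u p), 0))"
    by (simp add: dorfman_def Let_def comp_def lie_deriv_form_def d_one_form_def d_fun_def fb
        dsec_parts[OF u] dsec_parts[OF v] cbr_def vec_eq_iff pairing_def inner_axis inner_diff_right
        field_simps)
qed

lemma dorfman_const_left:
  assumes "smooth_map \<A> v"
  shows "dorfman \<rho> br H F (\<lambda>q. e) v p = dsec \<rho> (vec_part e) v p + cb e (v p)"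
  by (rule fibre_eqI) (simp_all add: dorfman_eq[OF smooth_const assms] dsec_const pairing_simps vec_eq_iff)

lemma dorfman_const: "dorfman \<rho> br H F (\<lambda>q. e) (\<lambda>q. e') = (\<lambda>q. cb e e')"
  by (rule ext) (simp add: dorfman_const_left[OF smooth_const] dsec_const)

lemma dorfman_pairing:
  assumes u: "smooth_map \<A> u" and v: "smooth_map \<A> v"
  shows "pairing (dorfman \<rho> br H F u v p) w = pairing (dsec \<rho> (vec_part (u p)) v p
     - dsec \<rho> (vec_part (v p)) u p + cb (u p) (v p)) w + pairing (v p) (dsec \<rho> (vec_part w) u p)"
proof -
  have "linear (\<lambda>z. 2 * pairing (v p) (dsec \<rho> z u p))"
    by (auto simp: linear_iff linear_add[OF dsec_linear_left] linear_scale[OF dsec_linear_left]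
        pairing_simps)
  from linear_coordinates_inner[OF this, of "vec_part w"] show ?thesis
    unfolding dorfman_eq[OF u v] pairing_simps
    by (simp add: pairing_def[of "(0, _, 0)"])
qed

end

section \<open>Levi-Civita connections on the space of left-invariant sections\<close>

text \<open>\<open>P\<close> and \<open>Q\<close> are the projections onto \<open>E\<^sub>+\<close> and \<open>E\<^sub>-\<close>, in either order. As the notion is symmetric,
  each lemma below serves for both \<open>Ric\<^sup>+\<close> and \<open>Ric\<^sup>-\<close>.\<close>

locale orth_split =
  fixes P Q :: "('n::finite) fibre \<Rightarrow> 'n fibre"
  assumes P_linear: "linear P" and Q_linear: "linear Q"
    and PQ_add: "P x + Q x = x"
    and PQ: "P (Q x) = 0" and QP: "Q (P x) = 0"
    and PQ_orth: "pairing (P x) (Q y) = 0"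
begin

lemma swap: "orth_split Q P"
proof
  show "Q x + P x = x" for x using PQ_add[of x] by (simp only: add.commute)
  show "pairing (Q x) (P y) = 0" for x y using PQ_orth[of y x] by (simp only: pairing_commute)
qed (simp_all only: PQ QP linear_add[OF P_linear] linear_add[OF Q_linear]
    linear_scale[OF P_linear] linear_scale[OF Q_linear])

lemma PP: "P (P x) = P x"
  using PQ_add[of "P x"] by (simp add: QP)

lemmas P_simps = linear_add[OF P_linear] linear_diff[OF P_linear] linear_scale[OF P_linear]
  linear_0[OF P_linear] linear_neg[OF P_linear]

lemma pairing_P: "pairing (P x) y = pairing x (P y)"
proof -
  have "pairing (P x) y = pairing (P x) (P y + Q y)"
    by (simp add: PQ_add)
  also have "\<dots> = pairing (P x + Q x) (P y)"
    using PQ_orth[of y x] by (simp add: pairing_simps PQ_orth pairing_commute[of "Q x"])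
  finally show ?thesis by (simp add: PQ_add)
qed

lemma P_eqI:
  assumes "\<And>w. pairing (x - y) (P w) = 0"
  shows "P x = P y"
proof -
  have "pairing (P x - P y) w = 0" for w
    using assms[of w] by (simp add: pairing_P P_simps[symmetric])
  then show ?thesis using pairing_nondegenerate[of "P x - P y"] by simp
qed

end

text \<open>A left-invariant Levi-Civita generalized connection, seen on left-invariant sections; \<open>cb\<close> is
  their bracket and the ranges of \<open>P\<close> and \<open>Q\<close> are \<open>E\<^sub>\<plusminus>\<close> in either order.\<close>

locale alg_connection = orth_split P Q
  for P Q :: "('n::finite) fibre \<Rightarrow> 'n fibre" +
  fixes cb B :: "'n fibre \<Rightarrow> 'n fibre \<Rightarrow> 'n fibre"
  assumes cb_bilinear: "bilinear cb" and B_bilinear: "bilinear B"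
    and metric: "pairing (B u v) w + pairing v (B u w) = 0"
    and torsion: "pairing (B u v - B v u - cb u v) w + pairing v (B w u) = 0"
    and preserves_Q: "P (B u (Q v)) = 0"
begin

lemma preserves_P: "Q (B u (P v)) = 0"
proof -
  have "pairing (B u (P v)) (Q w) = 0" for w
  proof -
    have "Q (B u (Q w)) = B u (Q w)"
      using PQ_add[of "B u (Q w)"] unfolding preserves_Q add_0_left .
    then show ?thesis using metric[of u "P v" "Q w"] PQ_orth[of v "B u (Q w)"] by simp
  qed
  then have "Q (B u (P v)) = Q 0"
    by (intro orth_split.P_eqI[OF swap]) simp
  then show ?thesis by (simp add: linear_0[OF Q_linear])
qed

lemma swap_connection: "alg_connection Q P cb B"
  unfolding alg_connection_def alg_connection_axioms_def
  by (intro conjI allI swap cb_bilinear B_bilinear metric torsion preserves_P)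

lemma P_B: "P (B u (P v)) = B u (P v)" and Q_B: "Q (B u (Q v)) = B u (Q v)"
  using PQ_add[of "B u (P v)"] PQ_add[of "B u (Q v)"]
  unfolding preserves_P preserves_Q add_0_left add_0_right .

text \<open>Paired with an element of the range of \<open>P\<close>, the torsion retains only the term with \<open>B (Q u) (P v)\<close>,
  so this mixed part of the connection is determined by the bracket.\<close>

lemma mixed: "B (Q u) (P v) = P (cb (Q u) (P v))"
proof -
  have "P (B (Q u) (P v)) = P (cb (Q u) (P v))"
  proof (rule P_eqI)
    fix w
    have "pairing (P w) (B (P v) (Q u)) = 0" "pairing (P v) (B (P w) (Q u)) = 0"
      using PQ_orth[of w "B (P v) (Q u)"] PQ_orth[of v "B (P w) (Q u)"] unfolding Q_B .
    then show "pairing (B (Q u) (P v) - cb (Q u) (P v)) (P w) = 0"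
      using torsion[of "Q u" "P v" "P w"] pairing_commute[of "B (P v) (Q u)" "P w"]
      unfolding pairing_simps by linarith
  qed
  then show ?thesis unfolding P_B .
qed

lemma mixed_bracket: "cb (Q u) (P v) = B (Q u) (P v) - B (P v) (Q u)"
proof -
  have "pairing (B (Q u) (P v) - B (P v) (Q u) - cb (Q u) (P v)) w = 0" for w
    using torsion[of "Q u" "P v" w] PQ_orth[of v "B w (Q u)"] unfolding Q_B by linarith
  from pairing_nondegenerate[OF this] show ?thesis by simp
qed

lemma linear_B: "linear (B u)" "linear (\<lambda>u. B u v)" and linear_cb: "linear (cb u)" "linear (\<lambda>u. cb u v)"
  using B_bilinear cb_bilinear unfolding bilinear_def by blast+

lemma linear_comp: "linear f \<Longrightarrow> linear g \<Longrightarrow> linear (\<lambda>x. f (g x))"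
  by (auto simp: linear_iff)

text \<open>The trace of \<open>w \<mapsto> D\<^bsub>w\<^esub> v\<close> over \<open>E\<^sub>+\<close> is the divergence of \<open>v \<in> E\<^sub>+\<close>: the part over \<open>E\<^sub>-\<close> takes
  values in \<open>E\<^sub>+\<close> and so has no diagonal.\<close>

lemma trace_P_eq_divergence: "ftrace (\<lambda>e. B (P e) (P v)) = ftrace (\<lambda>e. B e (P v))"
proof -
  have "(\<lambda>e. B e (P v)) = (\<lambda>e. B (P e) (P v) + B (Q e) (P v))"
    unfolding linear_add[OF linear_B(2), symmetric] PQ_add ..
  then have "ftrace (\<lambda>e. B e (P v)) = ftrace (\<lambda>e. B (P e) (P v)) + ftrace (\<lambda>e. B (Q e) (P v))"
    by (simp only: ftrace_add)
  moreover have "ftrace (\<lambda>e. B (Q e) (P v)) = 0"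
  proof -
    have "ftrace (\<lambda>e. B (Q e) (P v)) = ftrace (\<lambda>e. P (cb (Q e) (P v)))"
      by (simp add: mixed)
    also have "\<dots> = ftrace (\<lambda>e. cb (Q (P e)) (P v))"
      by (rule ftrace_comp_commute[OF P_linear linear_comp[OF linear_cb(2) Q_linear]])
    finally show ?thesis by (simp add: QP linear_0[OF linear_cb(2)] ftrace_zero)
  qed
  ultimately show ?thesis by simp
qed

text \<open>The part \<open>w \<mapsto> D\<^bsub>w\<^esub> v\<close> of the connection that is not determined by the bracket occurs composed with
  \<open>D\<^bsub>u\<^esub>\<close>, in both orders and with opposite signs, and so cancels in the trace. What is left depends on the
  connection through its divergence only.\<close>

lemma ricci_formula:
  "ftrace (\<lambda>e. B (P e) (B (Q u) (P v)) - B (Q u) (B (P e) (P v)) - B (cb (P e) (Q u)) (P v))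
    = ftrace (\<lambda>e. B e (P (cb (Q u) (P v)))) - ftrace (\<lambda>e. P (cb (Q (cb (P e) (Q u))) (P v)))"
proof -
  let ?A = "\<lambda>e. B (P e) (P v)"
  have linA: "linear ?A"
    by (rule linear_comp[OF linear_B(2) P_linear])
  have 1: "cb (P e) (Q u) = Q (cb (P e) (Q u)) - B (Q u) (P e)" for e
  proof -
    interpret s: alg_connection Q P cb B by (rule swap_connection)
    show ?thesis unfolding s.mixed[symmetric] by (rule s.mixed_bracket)
  qed
  have 2: "B (cb (P e) (Q u)) (P v)
      = P (cb (Q (cb (P e) (Q u))) (P v)) - ?A (B (Q u) (P e))" for e
  proof -
    have "B (cb (P e) (Q u)) (P v)
        = B (Q (cb (P e) (Q u)) - B (Q u) (P e)) (P v)"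
      by (subst 1) (rule refl)
    then show ?thesis
      by (simp add: linear_diff[OF linear_B(2)] mixed P_B PP)
  qed
  have 3: "ftrace (\<lambda>e. ?A (B (Q u) (P e))) = ftrace (\<lambda>e. B (Q u) (?A e))"
  proof -
    have "P (B (Q u) e) = B (Q u) (P e)" for e
    proof -
      have "P (B (Q u) e) = P (B (Q u) (P e + Q e))" by (simp add: PQ_add)
      also have "\<dots> = B (Q u) (P e)"
        by (simp add: linear_add[OF linear_B(1)] P_simps P_B preserves_Q)
      finally show ?thesis .
    qed
    from this[symmetric] have "?A (B (Q u) (P e)) = ?A (B (Q u) e)" for e
      by (simp add: PP)
    then show ?thesis using ftrace_comp_commute[OF linA linear_B(1)] by simp
  qed
  have "(\<lambda>e. B (P e) (B (Q u) (P v)) - B (Q u) (?A e) - B (cb (P e) (Q u)) (P v))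
      = (\<lambda>e. (B (P e) (P (cb (Q u) (P v))) - P (cb (Q (cb (P e) (Q u))) (P v)))
        + (?A (B (Q u) (P e)) - B (Q u) (?A e)))"
    unfolding 2 mixed[of u v] by (simp add: algebra_simps)
  then show ?thesis
    by (simp only: ftrace_add ftrace_diff 3 trace_P_eq_divergence)
qed

end

section \<open>From connections on the group to algebra\<close>

lemma sections_iff [simp]: "u \<in> sections \<A> \<longleftrightarrow> smooth_map \<A> u"
  by (simp add: sections_in_def)

lemma divergence_of_eq_ftrace:
  assumes "linear (\<lambda>e. D (\<lambda>q. e) u p)"
  shows "divergence_of D u p = ftrace (\<lambda>e. D (\<lambda>q. e) u p)"
  unfolding divergence_of_def
  by (rule subspace_trace_eq_ftrace[OF _ assms linear_ident]) simp_all

context orth_split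
begin

lemma range_P_iff: "x \<in> range P \<longleftrightarrow> P x = x"
  using PP by (metis rangeE rangeI)

lemma orth_range: "orth (range Q) = range P"
proof -
  interpret s: orth_split Q P by (rule swap)
  have "(\<forall>w\<in>range Q. pairing e w = 0) \<longleftrightarrow> P e = e" for e
  proof
    assume "\<forall>w\<in>range Q. pairing e w = 0"
    then have "pairing (Q e) w = 0" for w unfolding s.pairing_P by blast
    then have "Q e = 0" by (rule pairing_nondegenerate)
    then show "P e = e" using PQ_add[of e] by simp
  next
    assume "P e = e"
    then show "\<forall>w\<in>range Q. pairing e w = 0" using PQ_orth[of e] by auto
  qed
  then show ?thesis unfolding orth_def range_P_iff[symmetric] by simp
qed

lemma subspace_range: "subspace (range P)"
  using P_linear linear_subspace_image[OF _ subspace_UNIV] by blast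

lemma subspace_trace_range:
  assumes "linear f" "\<And>x. P (f (P x)) = f (P x)"
  shows "subspace_trace (range P) f = ftrace (\<lambda>x. f (P x))"
proof (rule subspace_trace_eq_ftrace[OF subspace_range assms(1) P_linear])
  show "f x \<in> range P" if "x \<in> range P" for x
    using that assms(2)[of x] unfolding range_P_iff by simp
qed (simp_all add: range_P_iff PP)

end

lemma (in alg_connection) P_curvature:
  "P (B (P e) (B (Q u) (P v)) - B (Q u) (B (P e) (P v)) - B (cb (P e) (Q u)) (P v))
    = B (P e) (B (Q u) (P v)) - B (Q u) (B (P e) (P v)) - B (cb (P e) (Q u)) (P v)"
proof -
  have B: "P (B y x) = B y x" if "P x = x" for x y
    using P_B[of y x] unfolding that .
  show ?thesis
    unfolding P_simps B[OF B[OF PP]] B[OF PP] ..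
qed

locale gen_connection = courant \<A> br \<rho> H F
  for \<A> :: "('p::topological_space, real^'n) chart set"
    and br :: "real^'n \<Rightarrow> real^'n \<Rightarrow> real^'n"
    and \<rho> :: "('p, 'n::finite) frame" and H F +
  fixes D :: "('p, 'n) sect \<Rightarrow> ('p, 'n) sect \<Rightarrow> ('p, 'n) sect"
  assumes D: "generalized_connection \<A> \<rho> D"
begin

text \<open>The connection on left-invariant sections. Its coefficients may depend on \<open>p\<close>, as only \<open>\<delta>\<close> is
  left-invariant.\<close>

definition Bp :: "'p \<Rightarrow> 'n fibre \<Rightarrow> 'n fibre \<Rightarrow> 'n fibre" where
  "Bp p e e' = D (\<lambda>q. e) (\<lambda>q. e') p"

lemma D_smooth: "smooth_map \<A> u \<Longrightarrow> smooth_map \<A> v \<Longrightarrow> smooth_map \<A> (D u v)"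
  using D by (simp add: generalized_connection_def)

lemma D_add_left: "smooth_map \<A> u \<Longrightarrow> smooth_map \<A> u' \<Longrightarrow> smooth_map \<A> v \<Longrightarrow>
    D (\<lambda>q. u q + u' q) v p = D u v p + D u' v p"
  using D by (simp add: generalized_connection_def)

lemma D_add_right: "smooth_map \<A> u \<Longrightarrow> smooth_map \<A> v \<Longrightarrow> smooth_map \<A> v' \<Longrightarrow>
    D u (\<lambda>q. v q + v' q) p = D u v p + D u v' p"
  using D by (simp add: generalized_connection_def)

lemma D_scale_left: "smooth_map \<A> f \<Longrightarrow> smooth_map \<A> u \<Longrightarrow> smooth_map \<A> v \<Longrightarrow>
    D (\<lambda>q. f q *\<^sub>R u q) v p = f p *\<^sub>R D u v p"
  using D by (simp add: generalized_connection_def)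

lemma D_scale_right: "smooth_map \<A> f \<Longrightarrow> smooth_map \<A> u \<Longrightarrow> smooth_map \<A> v \<Longrightarrow>
    D u (\<lambda>q. f q *\<^sub>R v q) p = \<rho> (vec_part (u p)) f p *\<^sub>R v p + f p *\<^sub>R D u v p"
  using D by (simp add: generalized_connection_def)

lemma D_metric: "smooth_map \<A> u \<Longrightarrow> smooth_map \<A> v \<Longrightarrow> smooth_map \<A> w \<Longrightarrow>
    \<rho> (vec_part (u p)) (\<lambda>q. pairing (v q) (w q)) p = pairing (D u v p) (w p) + pairing (v p) (D u w p)"
  using D by (simp add: generalized_connection_def)

lemma D_sum_left:
  assumes "finite I" "\<And>i. i \<in> I \<Longrightarrow> smooth_map \<A> (s i)" "smooth_map \<A> v"
  shows "D (\<lambda>q. \<Sum>i\<in>I. s i q) v p = (\<Sum>i\<in>I. D (s i) v p)"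
  using assms(1,2)
proof (induction I)
  case empty
  have "D (\<lambda>q. 0 *\<^sub>R (0::'n fibre)) v p = 0"
    unfolding D_scale_left[OF smooth_const smooth_const assms(3)] by simp
  then show ?case by simp
next
  case (insert i I)
  then show ?case by (simp add: D_add_left smooth_sum assms(3))
qed

lemma D_sum_right:
  assumes "finite I" "\<And>i. i \<in> I \<Longrightarrow> smooth_map \<A> (s i)" "smooth_map \<A> u"
  shows "D u (\<lambda>q. \<Sum>i\<in>I. s i q) p = (\<Sum>i\<in>I. D u (s i) p)"
  using assms(1,2)
proof (induction I)
  case empty
  have "D u (\<lambda>q. 0 *\<^sub>R (0::'n fibre)) p = 0"
    unfolding D_scale_right[OF smooth_const assms(3) smooth_const] by (simp add: rho_const)
  then show ?case by simp
next
  case (insert i I)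
  then show ?case by (simp add: D_add_right smooth_sum assms(3))
qed

lemma D_tensor_left:
  assumes "smooth_map \<A> u" "smooth_map \<A> v"
  shows "D u v p = D (\<lambda>q. u p) v p"
proof -
  have e: "D u v p = (\<Sum>b\<in>Basis. (u p \<bullet> b) *\<^sub>R D (\<lambda>q. b) v p)" if "smooth_map \<A> u" for u
  proof -
    have "D u v p = D (\<lambda>q. \<Sum>b\<in>Basis. (u q \<bullet> b) *\<^sub>R b) v p"
      by (simp only: euclidean_representation)
    also have "\<dots> = (\<Sum>b\<in>Basis. (u p \<bullet> b) *\<^sub>R D (\<lambda>q. b) v p)"
      by (simp only: D_sum_left[OF finite_Basis smooth_scaleR[OF smooth_inner[OF that] smooth_const]
            assms(2)] D_scale_left[OF smooth_inner[OF that] smooth_const assms(2)])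
    finally show ?thesis .
  qed
  show ?thesis
    by (rule trans[OF e[OF assms(1)] e[OF smooth_const, symmetric]])
qed

text \<open>Expand both sections in a basis of left-invariant ones: the connection is tensorial in the first
  and a derivation in the second.\<close>

lemma D_expand:
  assumes u: "smooth_map \<A> u" and v: "smooth_map \<A> v"
  shows "D u v p = dsec \<rho> (vec_part (u p)) v p + Bp p (u p) (v p)"
proof -
  have e: "D u v p = dsec \<rho> (vec_part (u p)) v p + (\<Sum>b\<in>Basis. (v p \<bullet> b) *\<^sub>R D u (\<lambda>q. b) p)"
    if "smooth_map \<A> v" for v
  proof -
    have "D u v p = D u (\<lambda>q. \<Sum>b\<in>Basis. (v q \<bullet> b) *\<^sub>R b) p"
      by (simp only: euclidean_representation)
    also have "\<dots> = (\<Sum>b\<in>Basis. \<rho> (vec_part (u p)) (\<lambda>q. v q \<bullet> b) p *\<^sub>R b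
        + (v p \<bullet> b) *\<^sub>R D u (\<lambda>q. b) p)"
      by (simp only: D_sum_right[OF finite_Basis smooth_scaleR[OF smooth_inner[OF that] smooth_const] u]
          D_scale_right[OF smooth_inner[OF that] u smooth_const])
    finally show ?thesis by (simp only: sum.distrib dsec_def)
  qed
  have "D u (\<lambda>q. v p) p = (\<Sum>b\<in>Basis. (v p \<bullet> b) *\<^sub>R D u (\<lambda>q. b) p)"
    using e[OF smooth_const, of "v p"] unfolding dsec_const add_0_left .
  moreover have "D u (\<lambda>q. v p) p = Bp p (u p) (v p)"
    unfolding Bp_def by (rule D_tensor_left[OF u smooth_const])
  ultimately show ?thesis using e[OF v] by simp
qed

lemma Bp_smooth: "smooth_map \<A> (\<lambda>p. Bp p e e')"
  unfolding Bp_def by (rule D_smooth[OF smooth_const smooth_const])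

lemma Bp_bilinear: "bilinear (Bp p)"
proof (rule bilinearI)
  show "Bp p (x + y) z = Bp p x z + Bp p y z" for x y z
    unfolding Bp_def by (rule D_add_left) (rule smooth_const)+
  show "Bp p x (y + z) = Bp p x y + Bp p x z" for x y z
    unfolding Bp_def by (rule D_add_right) (rule smooth_const)+
  show "Bp p (c *\<^sub>R x) z = c *\<^sub>R Bp p x z" for c x z
    unfolding Bp_def
    using D_scale_left[OF smooth_const smooth_const smooth_const] .
  show "Bp p x (c *\<^sub>R z) = c *\<^sub>R Bp p x z" for c x z
    unfolding Bp_def
    using D_scale_right[OF smooth_const smooth_const smooth_const]
    unfolding rho_const scaleR_zero_left add_0_left .
qed

lemma Bp_linear: "linear (Bp p e)" "linear (\<lambda>e. Bp p e e')"
  using Bp_bilinear unfolding bilinear_def by blast+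

lemma divergence_of_const: "divergence_of D (\<lambda>q. e) p = ftrace (\<lambda>e'. Bp p e' e)"
  unfolding Bp_def
  by (rule divergence_of_eq_ftrace) (use Bp_linear(2) in \<open>simp add: Bp_def\<close>)

end

locale levi_civita_connection = gen_connection \<A> br \<rho> H F D + orth_split P Q
  for \<A> :: "('p::topological_space, real^'n) chart set"
    and br :: "real^'n \<Rightarrow> real^'n \<Rightarrow> real^'n"
    and \<rho> :: "('p, 'n::finite) frame" and H F D and P Q +
  assumes torsion_free: "smooth_map \<A> u \<Longrightarrow> smooth_map \<A> v \<Longrightarrow> smooth_map \<A> w \<Longrightarrow>
      gen_torsion \<rho> br H F D u v w p = 0"
    and D_preserves_Q: "P (Bp p e (Q e')) = 0"
begin

lemma Bp_alg_connection: "alg_connection P Q cb (Bp p)"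
proof (unfold_locales)
  show "bilinear cb" by (rule cbr_bilinear)
  show "bilinear (Bp p)" by (rule Bp_bilinear)
  show "pairing (Bp p u v) w + pairing v (Bp p u w) = 0" for u v w
    using D_metric[OF smooth_const smooth_const smooth_const, of u v w p, symmetric]
    unfolding rho_const Bp_def .
  show "pairing (Bp p u v - Bp p v u - cb u v) w + pairing v (Bp p w u) = 0" for u v w
    using torsion_free[OF smooth_const smooth_const smooth_const, where p = p]
    unfolding gen_torsion_def dorfman_const Bp_def .
qed (rule D_preserves_Q)

lemma swap_levi_civita: "levi_civita_connection \<A> br \<rho> H F D Q P"
proof -
  interpret s: orth_split Q P by (rule swap)
  show ?thesis
    by unfold_locales (rule torsion_free, assumption+, rule alg_connection.preserves_P[OF Bp_alg_connection])
qed

text \<open>The connection is not assumed left-invariant. The additional term in its curvature is the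
  derivative of a divergence, which is constant.\<close>

lemma ricci_const:
  assumes const: "\<And>p. divergence_of D (\<lambda>q. P v) p = c"
  shows "ricci_on (range P) \<rho> br H F D (\<lambda>q. Q u) (\<lambda>q. P v) p
    = ftrace (\<lambda>e. Bp p e (P (cb (Q u) (P v)))) - ftrace (\<lambda>e. P (cb (Q (cb (P e) (Q u))) (P v)))"
proof -
  interpret a: alg_connection P Q cb "Bp r" for r by (rule Bp_alg_connection)
  have uv: "D (\<lambda>q. Q u) (\<lambda>q. P v) = (\<lambda>q. P (cb (Q u) (P v)))"
    using a.mixed[of _ u v] unfolding Bp_def by (rule ext)
  have curv: "curvature \<rho> br H F D (\<lambda>q. e) (\<lambda>q. Q u) (\<lambda>q. P v) p
    = Bp p e (Bp p (Q u) (P v)) - Bp p (Q u) (Bp p e (P v)) - Bp p (cb e (Q u)) (P v)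
      - dsec \<rho> (vec_part (Q u)) (\<lambda>q. Bp q e (P v)) p" for e
  proof -
    have "D (\<lambda>q. Q u) (D (\<lambda>q. e) (\<lambda>q. P v)) p
        = dsec \<rho> (vec_part (Q u)) (\<lambda>q. Bp q e (P v)) p + Bp p (Q u) (Bp p e (P v))"
      using D_expand[OF smooth_const Bp_smooth, of "Q u" e "P v" p] by (simp add: Bp_def)
    then show ?thesis
      unfolding curvature_def dorfman_const uv a.mixed
      by (simp add: Bp_def)
  qed
  let ?R = "\<lambda>e. Bp p e (Bp p (Q u) (P v)) - Bp p (Q u) (Bp p e (P v)) - Bp p (cb e (Q u)) (P v)"
  let ?d = "\<lambda>e. dsec \<rho> (vec_part (Q u)) (\<lambda>q. Bp q e (P v)) p"
  have linR: "linear ?R"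
    by (intro linear_compose_sub a.linear_comp[OF a.linear_B(1) a.linear_B(2)]
        a.linear_comp[OF a.linear_B(2) a.linear_cb(2)] a.linear_B(2))
  have lind: "linear ?d"
  proof (rule linearI)
    show "?d (e + e') = ?d e + ?d e'" for e e'
      by (simp only: linear_add[OF a.linear_B(2)] dsec_add[OF Bp_smooth Bp_smooth])
    show "?d (k *\<^sub>R e) = k *\<^sub>R ?d e" for k e
      by (simp only: linear_scale[OF a.linear_B(2)] dsec_scaleR[OF smooth_const Bp_smooth] rho_const
          scaleR_zero_left add_0_left)
  qed
  have inP: "P (?R (P e) - ?d (P e)) = ?R (P e) - ?d (P e)" for e
  proof -
    have "P (?d (P e)) = ?d (P e)"
      by (simp only: dsec_linear[OF P_linear Bp_smooth, symmetric] a.P_B)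
    moreover have "P (?R (P e)) = ?R (P e)"
      by (rule a.P_curvature)
    ultimately show ?thesis by (simp only: P_simps)
  qed
  have "ricci_on (range P) \<rho> br H F D (\<lambda>q. Q u) (\<lambda>q. P v) p = ftrace (\<lambda>e. ?R (P e) - ?d (P e))"
    unfolding ricci_on_def curv
    by (rule subspace_trace_range[OF linear_compose_sub[OF linR lind] inP])
  also have "\<dots> = ftrace (\<lambda>e. ?R (P e)) - ftrace (\<lambda>e. ?d (P e))"
    by (rule ftrace_diff)
  also have "ftrace (\<lambda>e. ?d (P e)) = \<rho> (vec_part (Q u)) (\<lambda>q. ftrace (\<lambda>e. Bp q (P e) (P v))) p"
    unfolding ftrace_def
    by (subst rho_sum) (auto simp only: finite_Basis smooth_inner[OF Bp_smooth] dsec_inner intro!: sum.cong)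
  also have "\<dots> = 0"
    unfolding a.trace_P_eq_divergence divergence_of_const[symmetric] const by (rule rho_const)
  finally show ?thesis
    unfolding a.ricci_formula diff_zero .
qed

end

text \<open>Conversely an algebraic Levi-Civita connection extends to all sections by the Leibniz rule.\<close>

locale invariant_connection = courant \<A> br \<rho> H F + alg_connection P Q "cbr br H F" B
  for \<A> :: "('p::topological_space, real^'n) chart set"
    and br :: "real^'n \<Rightarrow> real^'n \<Rightarrow> real^'n"
    and \<rho> :: "('p, 'n::finite) frame" and H F and P Q B
begin

definition Dext :: "('p, 'n) sect \<Rightarrow> ('p, 'n) sect \<Rightarrow> ('p, 'n) sect" where
  "Dext u v = (\<lambda>p. dsec \<rho> (vec_part (u p)) v p + B (u p) (v p))"

lemma vec_smooth: "smooth_map \<A> u \<Longrightarrow> smooth_map \<A> (\<lambda>p. vec_part (u p))"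
  by (rule smooth_linear[OF linear_parts(1)])

lemma Dext_smooth: "smooth_map \<A> u \<Longrightarrow> smooth_map \<A> v \<Longrightarrow> smooth_map \<A> (Dext u v)"
  unfolding Dext_def
  by (intro smooth_add dsec_smooth vec_smooth smooth_bilinear[OF B_bilinear])

lemmas B_simps = linear_add[OF linear_B(1)] linear_add[OF linear_B(2)] linear_scale[OF linear_B(1)]
  linear_scale[OF linear_B(2)]

lemmas dsec_simps = linear_add[OF dsec_linear_left] linear_scale[OF dsec_linear_left]

lemma Dext_connection: "generalized_connection \<A> \<rho> Dext"
  unfolding generalized_connection_def sections_iff
proof (intro conjI ballI allI impI)
  fix u v w :: "('p, 'n) sect" and p
  assume "u \<in> sections \<A>" "v \<in> sections \<A>" "w \<in> sections \<A>"
  then have v: "smooth_map \<A> v" and w: "smooth_map \<A> w" by simp_all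
  have "\<rho> (vec_part (u p)) (\<lambda>q. pairing (v q) (w q)) p
      = pairing (dsec \<rho> (vec_part (u p)) v p) (w p) + pairing (v p) (dsec \<rho> (vec_part (u p)) w p)"
    using dsec_bilinear[OF pairing_bilinear v w] by (simp only: dsec_real)
  then show "\<rho> (vec_part (u p)) (\<lambda>q. pairing (v q) (w q)) p
      = pairing (Dext u v p) (w p) + pairing (v p) (Dext u w p)"
    using metric[of "u p" "v p" "w p"] by (simp add: Dext_def pairing_simps)
qed (simp_all add: Dext_smooth, simp_all add: Dext_def B_simps dsec_simps dsec_add dsec_scaleR algebra_simps)

lemma Dext_levi_civita: "levi_civita \<A> \<rho> br H F (range Q) Dext"
  unfolding levi_civita_def
proof (intro conjI ballI allI Dext_connection)
  fix u v w :: "('p, 'n) sect" and p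
  assume "u \<in> sections \<A>" "v \<in> sections \<A>" "w \<in> sections \<A>"
  then have s: "smooth_map \<A> u" "smooth_map \<A> v" by simp_all
  show "gen_torsion \<rho> br H F Dext u v w p = 0"
    unfolding gen_torsion_def pairing_simps dorfman_pairing[OF s] Dext_def
    using torsion[of "u p" "v p" "w p"] by (simp add: pairing_simps)
next
  fix u v :: "('p, 'n) sect"
  assume "u \<in> sections \<A>" and v: "v \<in> sections_in \<A> (range Q)"
  then have s: "smooth_map \<A> u" "smooth_map \<A> v" by (simp_all add: sections_in_def)
  interpret s: orth_split Q P by (rule swap)
  have "v p \<in> range Q" for p
    using v unfolding sections_in_def by blast
  then have vQ: "Q (v p) = v p" for p
    unfolding s.range_P_iff .
  have "Q (Dext u v p) = Dext u v p" for p
  proof -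
    have "Q (dsec \<rho> (vec_part (u p)) v p) = dsec \<rho> (vec_part (u p)) v p"
      using dsec_linear[OF Q_linear s(2), of "vec_part (u p)" p, symmetric] unfolding vQ .
    moreover have "Q (B (u p) (v p)) = B (u p) (v p)"
      using Q_B[of "u p" "v p"] unfolding vQ .
    ultimately show ?thesis by (simp only: Dext_def s.P_simps)
  qed
  then have "range (Dext u v) \<subseteq> range Q"
    unfolding s.range_P_iff[symmetric] by blast
  then show "Dext u v \<in> sections_in \<A> (range Q)"
    using Dext_smooth[OF s] unfolding sections_in_def by blast
qed

lemma Dext_divergence:
  assumes "smooth_map \<A> u"
  shows "divergence_of Dext u p = ftrace (\<lambda>e. dsec \<rho> (vec_part e) u p) + ftrace (\<lambda>e. B e (u p))"
proof -
  have "linear (\<lambda>e. Dext (\<lambda>q. e) u p)"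
    unfolding Dext_def
    by (intro linear_compose_add linear_comp[OF dsec_linear_left linear_parts(1)] linear_B(2))
  then show ?thesis
    unfolding divergence_of_eq_ftrace[of Dext, OF \<open>linear _\<close>] by (simp only: Dext_def ftrace_add)
qed

lemma Dext_divergence_const: "divergence_of Dext (\<lambda>q. e) = (\<lambda>p. ftrace (\<lambda>e'. B e' e))"
  by (rule ext) (simp only: Dext_divergence[OF smooth_const] dsec_const ftrace_zero add_0_left)

lemma Dext_divergence_operator: "divergence_operator \<A> \<rho> (divergence_of Dext)"
  unfolding divergence_operator_def
proof (intro conjI ballI allI impI)
  fix u :: "('p, 'n) sect" assume "u \<in> sections \<A>"
  then have u: "smooth_map \<A> u" by simp
  have "smooth_map \<A> (\<lambda>p. (\<Sum>b\<in>Basis. dsec \<rho> (vec_part b) u p \<bullet> b) + (\<Sum>b\<in>Basis. B b (u p) \<bullet> b))"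
    by (intro smooth_add smooth_sum smooth_inner dsec_smooth_const u smooth_linear[OF linear_B(1)] finite_Basis)
  then show "smooth_map \<A> (divergence_of Dext u)"
    unfolding Dext_divergence[OF u, abs_def, folded ftrace_def] ftrace_def[symmetric]
    by (simp add: Dext_divergence[OF u, symmetric])
next
  fix u v :: "('p, 'n) sect" assume "u \<in> sections \<A>" "v \<in> sections \<A>"
  then have s: "smooth_map \<A> u" "smooth_map \<A> v" by simp_all
  show "divergence_of Dext (\<lambda>p. u p + v p) = (\<lambda>p. divergence_of Dext u p + divergence_of Dext v p)"
    by (rule ext) (simp only: Dext_divergence s smooth_add dsec_add B_simps ftrace_add ac_simps)
next
  fix f :: "'p \<Rightarrow> real" and u :: "('p, 'n) sect" assume "u \<in> sections \<A>" and f: "smooth_map \<A> f"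
  then have u: "smooth_map \<A> u" by simp
  have tr: "ftrace (\<lambda>e. \<rho> (vec_part e) f p *\<^sub>R u p) = \<rho> (vec_part (u p)) f p" for p
    using ftrace_rank_one_sum[of "{()}" "\<lambda>i e. \<rho> (vec_part e) f p" "\<lambda>e. \<rho> (vec_part e) f p *\<^sub>R u p"
        "\<lambda>i. u p"] linear_comp[OF rho_linear_left linear_parts(1)] by simp
  show "divergence_of Dext (\<lambda>p. f p *\<^sub>R u p)
      = (\<lambda>p. \<rho> (vec_part (u p)) f p + f p * divergence_of Dext u p)"
    by (rule ext) (simp only: Dext_divergence u f smooth_scaleR dsec_scaleR B_simps ftrace_add
        ftrace_scale tr distrib_left ac_simps)
qed

text \<open>Second derivatives cancel because the anchor is a homomorphism; hence the curvature is
  tensorial in the remaining two arguments.\<close>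

lemma Dext_curvature:
  assumes u: "smooth_map \<A> u" and v: "smooth_map \<A> v"
  shows "curvature \<rho> br H F Dext (\<lambda>q. e) u v p
    = B e (B (u p) (v p)) - B (u p) (B e (v p)) - B (cb e (u p)) (v p)"
proof -
  let ?x = "vec_part e" and ?y = "vec_part (u p)"
  have "dsec \<rho> ?x (Dext u v) p
      = dsec \<rho> ?x (\<lambda>q. dsec \<rho> (vec_part (u q)) v q) p + B (dsec \<rho> ?x u p) (v p) + B (u p) (dsec \<rho> ?x v p)"
    unfolding Dext_def
    by (simp only: dsec_add dsec_smooth[OF vec_smooth[OF u] v] smooth_bilinear[OF B_bilinear u v]
        dsec_bilinear[OF B_bilinear u v] ac_simps)
  moreover have "dsec \<rho> ?y (Dext (\<lambda>q. e) v) p = dsec \<rho> ?y (dsec \<rho> ?x v) p + B e (dsec \<rho> ?y v p)"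
    unfolding Dext_def
    by (simp only: dsec_add[OF dsec_smooth_const[OF v] smooth_linear[OF linear_B(1) v]]
        dsec_linear[OF linear_B(1) v])
  moreover have "vec_part (dorfman \<rho> br H F (\<lambda>q. e) u p) = dsec \<rho> ?x (\<lambda>q. vec_part (u q)) p + br ?x ?y"
    by (simp add: dorfman_const_left[OF u] dsec_linear[OF linear_parts(1) u] cbr_def)
  moreover note dsec_commutator_field[OF vec_smooth[OF u] v, of ?x p]
  moreover have "B (dorfman \<rho> br H F (\<lambda>q. e) u p) (v p) = B (dsec \<rho> ?x u p) (v p) + B (cb e (u p)) (v p)"
    by (simp only: dorfman_const_left[OF u] B_simps)
  ultimately show ?thesis
    unfolding curvature_def Dext_def[of _ "Dext _ _"] Dext_def[of "dorfman _ _ _ _ _ _"]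
    by (simp add: Dext_def B_simps algebra_simps)
qed

lemma Dext_ricci:
  assumes "u \<in> sections_in \<A> (range Q)" "v \<in> sections_in \<A> (range P)"
    and eq: "\<And>u v. ftrace (\<lambda>e. B e (P (cb (Q u) (P v)))) = ftrace (\<lambda>e. P (cb (Q (cb (P e) (Q u))) (P v)))"
  shows "ricci_on (range P) \<rho> br H F Dext u v p = 0"
proof -
  have s: "smooth_map \<A> u" "smooth_map \<A> v" using assms by (simp_all add: sections_in_def)
  obtain u0 v0 where uv: "u p = Q u0" "v p = P v0"
    using assms(1,2) unfolding sections_in_def by blast
  let ?R = "\<lambda>e. B e (B (Q u0) (P v0)) - B (Q u0) (B e (P v0)) - B (cb e (Q u0)) (P v0)"
  have lin: "linear ?R"
    by (intro linear_compose_sub linear_comp[OF linear_B(1) linear_B(2)]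
        linear_comp[OF linear_B(2) linear_cb(2)] linear_B(2))
  have inP: "P (?R (P e)) = ?R (P e)" for e
    by (rule P_curvature)
  have "ricci_on (range P) \<rho> br H F Dext u v p = ftrace (\<lambda>e. ?R (P e))"
    unfolding ricci_on_def Dext_curvature[OF s] uv by (rule subspace_trace_range[OF lin inP])
  then show ?thesis unfolding ricci_formula eq by simp
qed

end

section \<open>Existence of connections with prescribed divergence\<close>

text \<open>With \<open>J\<close> the matrix of the pairing, \<open>L\<close> is conjugate under \<open>J\<close> to minus its transpose.\<close>

lemma ftrace_skew:
  fixes L :: "('n::finite) fibre \<Rightarrow> 'n fibre"
  assumes "linear L" "\<And>x y. pairing (L x) y = - pairing (L y) x"
  shows "ftrace L = 0"
proof -
  define J where "J = (\<lambda>e::'n fibre. ((1/2) *\<^sub>R form_part e, (1/2) *\<^sub>R vec_part e, scal_part e))"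
  define J' where "J' = (\<lambda>e::'n fibre. (2 *\<^sub>R form_part e, 2 *\<^sub>R vec_part e, scal_part e))"
  have lin: "linear J" "linear J'"
    by (auto simp: J_def J'_def linear_iff algebra_simps)
  have inv: "J' (J e) = e" for e
    by (rule fibre_eqI) (simp_all add: J_def J'_def)
  have p1: "x \<bullet> y = pairing x (J' y)" and p2: "pairing x y = J x \<bullet> y" for x y
    by (simp_all add: J_def J'_def pairing_def inner_prod_def vec_part_def form_part_def scal_part_def
        inner_commute field_simps)
  have "L b \<bullet> b = - (J (L (J' b)) \<bullet> b)" for b
    unfolding p1[of "L b"] p2[symmetric] by (rule assms(2))
  then have "ftrace L = (\<Sum>b\<in>Basis. - (J (L (J' b)) \<bullet> b))"
    by (simp add: ftrace_def)
  also have "\<dots> = - ftrace (\<lambda>x. J (L (J' x)))"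
    by (simp add: ftrace_def sum_negf)
  also have "ftrace (\<lambda>x. J (L (J' x))) = ftrace (\<lambda>x. L (J' (J x)))"
    by (rule ftrace_comp_commute[OF lin(1) linear_compose[OF lin(2) assms(1), unfolded comp_def]])
  finally show ?thesis by (simp add: inv)
qed

lemma ftrace_rank_one: "linear \<phi> \<Longrightarrow> ftrace (\<lambda>e. \<phi> e *\<^sub>R u) = \<phi> u"
  using ftrace_rank_one_sum[of "{()}" "\<lambda>i. \<phi>" "\<lambda>e. \<phi> e *\<^sub>R u" "\<lambda>i. u"] by simp

lemma linear_pairing: "linear (pairing x)" "linear (\<lambda>x. pairing x y)"
  using pairing_bilinear unfolding bilinear_def by blast+

locale split_courant = courant \<A> br \<rho> H F + orth_split P Q
  for \<A> :: "('p::topological_space, real^'n) chart set"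
    and br :: "real^'n \<Rightarrow> real^'n \<Rightarrow> real^'n"
    and \<rho> :: "('p, 'n::finite) frame" and H F and P Q :: "'n fibre \<Rightarrow> 'n fibre"
begin

text \<open>On each of \<open>E\<^sub>+\<close> and \<open>E\<^sub>-\<close> a third of the projected bracket is torsion-free, because the bracket is
  a three-form, and it has divergence zero, because it is skew. The trilinear forms \<open>\<langle>weyl \<epsilon> u v, w\<rangle>\<close> are
  skew in \<open>v\<close> and \<open>w\<close> and their cyclic sums vanish, so they change neither compatibility with the metric nor
  torsion, while the trace of \<open>weyl\<close> over \<open>u\<close> is a multiple of \<open>\<langle>\<epsilon>, v\<rangle>\<close>. Thus every linear form is the divergence of a Levi-Civita connection, provided that
  neither summand has rank one.\<close>

definition weyl :: "'n fibre \<Rightarrow> 'n fibre \<Rightarrow> 'n fibre \<Rightarrow> 'n fibre" where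
  "weyl \<epsilon> u v = pairing u v *\<^sub>R \<epsilon> - pairing \<epsilon> v *\<^sub>R u"

definition conn :: "'n fibre \<Rightarrow> 'n fibre \<Rightarrow> 'n fibre \<Rightarrow> 'n fibre" where
  "conn \<epsilon> u v = P (cb (Q u) (P v)) + Q (cb (P u) (Q v))
     + (1/3) *\<^sub>R P (cb (P u) (P v)) + (1/3) *\<^sub>R Q (cb (Q u) (Q v))
     + (1 / (1 - ftrace P)) *\<^sub>R weyl (P \<epsilon>) (P u) (P v) + (1 / (1 - ftrace Q)) *\<^sub>R weyl (Q \<epsilon>) (Q u) (Q v)"

lemmas cb_simps = bilinear_ladd[OF cbr_bilinear] bilinear_radd[OF cbr_bilinear]
  bilinear_lmul[OF cbr_bilinear] bilinear_rmul[OF cbr_bilinear]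

lemma conn_bilinear: "bilinear (conn \<epsilon>)"
proof -
  interpret s: orth_split Q P by (rule swap)
  show ?thesis
    unfolding conn_def weyl_def
    by (rule bilinearI) (simp_all add: P_simps s.P_simps cb_simps pairing_simps algebra_simps)
qed

lemma pairing_conn:
  "pairing (conn \<epsilon> u v) w = pairing (cb (Q u) (P v)) (P w) + pairing (cb (P u) (Q v)) (Q w)
    + pairing (cb (P u) (P v)) (P w) / 3 + pairing (cb (Q u) (Q v)) (Q w) / 3
    + (pairing (P u) (P v) * pairing (P \<epsilon>) (P w) - pairing (P \<epsilon>) (P v) * pairing (P u) (P w))
      / (1 - ftrace P)
    + (pairing (Q u) (Q v) * pairing (Q \<epsilon>) (Q w) - pairing (Q \<epsilon>) (Q v) * pairing (Q u) (Q w))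
      / (1 - ftrace Q)"
proof -
  interpret s: orth_split Q P by (rule swap)
  have "pairing (P x) w = pairing (P x) (P w)" "pairing (Q x) w = pairing (Q x) (Q w)" for x
    using pairing_P[of "P x" w] s.pairing_P[of "Q x" w] unfolding PP s.PP by simp_all
  note eqs = this
  show ?thesis
    unfolding conn_def weyl_def pairing_simps pairing_P[of "cb _ _"] s.pairing_P[of "cb _ _"]
      eqs(1)[of \<epsilon>] eqs(1)[of u] eqs(2)[of \<epsilon>] eqs(2)[of u]
    by simp
qed

lemma conn_alg_connection: "alg_connection P Q cb (conn \<epsilon>)"
proof (unfold_locales)
  interpret s: orth_split Q P by (rule swap)
  show "bilinear cb" by (rule cbr_bilinear)
  show "bilinear (conn \<epsilon>)" by (rule conn_bilinear)
  have sw: "pairing (cb x y) z = - pairing (cb x z) y" for x y z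
    using pairing_cbr_cycle[of x y z] pairing_cbr_swap[of y z x] pairing_cbr_cycle[of z y x]
      pairing_cbr_cycle[of y x z] pairing_cbr_cycle[of x z y] by linarith
  show "pairing (conn \<epsilon> u v) w + pairing v (conn \<epsilon> u w) = 0" for u v w
    unfolding pairing_commute[of v] pairing_conn
    using sw[of "Q u" "P v" "P w"] sw[of "P u" "Q v" "Q w"] sw[of "P u" "P v" "P w"]
      sw[of "Q u" "Q v" "Q w"] by (simp add: diff_divide_distrib algebra_simps)
  show "pairing (conn \<epsilon> u v - conn \<epsilon> v u - cb u v) w + pairing v (conn \<epsilon> w u) = 0" for u v w
  proof -
    have "pairing (cb u v) w = pairing (cb (P u + Q u) (P v + Q v)) (P w + Q w)"
      by (simp only: PQ_add)
    also have "\<dots> = pairing (cb (P u) (P v)) (P w) + pairing (cb (Q u) (Q v)) (Q w)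
        + pairing (cb (Q u) (P v)) (P w) + pairing (cb (P u) (Q v)) (P w) + pairing (cb (P u) (P v)) (Q w)
        + pairing (cb (P u) (Q v)) (Q w) + pairing (cb (Q u) (P v)) (Q w) + pairing (cb (Q u) (Q v)) (P w)"
      by (simp add: cb_simps pairing_simps)
    finally have e: "pairing (cb u v) w = pairing (cb (P u) (P v)) (P w) + pairing (cb (Q u) (Q v)) (Q w)
        + pairing (cb (Q u) (P v)) (P w) - pairing (cb (Q v) (P u)) (P w) + pairing (cb (Q w) (P u)) (P v)
        + pairing (cb (P u) (Q v)) (Q w) - pairing (cb (P v) (Q u)) (Q w) + pairing (cb (P w) (Q u)) (Q v)"
      using pairing_cbr_swap[of "P u" "Q v" "P w"] pairing_cbr_cycle[of "Q w" "P u" "P v"]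
        pairing_cbr_swap[of "Q u" "P v" "Q w"] pairing_cbr_cycle[of "P w" "Q u" "Q v"]
      by linarith
    show ?thesis
      unfolding pairing_simps pairing_commute[of v] pairing_conn e
      using pairing_cbr_swap[of "P v" "P u" "P w"] pairing_cbr_swap[of "Q v" "Q u" "Q w"]
        pairing_cbr_cycle[of "P w" "P u" "P v"] pairing_cbr_cycle[of "Q w" "Q u" "Q v"]
      by (simp add: pairing_commute[of "P w"] pairing_commute[of "Q w"] pairing_commute[of "P v" "P u"]
          pairing_commute[of "Q v" "Q u"] diff_divide_distrib)
  qed
  show "P (conn \<epsilon> u (Q v)) = 0" for u v
    unfolding conn_def weyl_def
    by (simp add: PQ P_simps s.PP pairing_simps bilinear_rzero[OF cbr_bilinear])
qed

lemma conn_divergence: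
  assumes "ftrace P \<noteq> 1" "ftrace Q \<noteq> 1"
  shows "ftrace (\<lambda>e'. conn \<epsilon> e' e) = pairing \<epsilon> e"
proof -
  interpret s: orth_split Q P by (rule swap)
  have lin: "linear (\<lambda>x. cb (P x) y)" "linear (\<lambda>x. cb (Q x) y)" for y
    by (auto simp only: linear_iff P_simps s.P_simps cb_simps)
  \<comment> \<open>The mixed parts map \<open>E\<^sub>\<mp>\<close> to \<open>E\<^sub>\<plusminus>\<close> and have no diagonal.\<close>
  have mix: "ftrace (\<lambda>x. P (cb (Q x) y)) = 0" "ftrace (\<lambda>x. Q (cb (P x) y)) = 0" for y
    unfolding ftrace_comp_commute[OF P_linear lin(2)] ftrace_comp_commute[OF Q_linear lin(1)] PQ QP
    by (simp_all add: bilinear_lzero[OF cbr_bilinear] ftrace_zero)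
  have sw: "pairing (cb x y) z = - pairing (cb z y) x" for x y z
    using pairing_cbr_cycle[of x y z] pairing_cbr_swap[of y z x] by linarith
  have skew: "ftrace (\<lambda>x. P (cb (P x) y)) = 0" "ftrace (\<lambda>x. Q (cb (Q x) y)) = 0" for y
  proof -
    show "ftrace (\<lambda>x. P (cb (P x) y)) = 0"
      by (rule ftrace_skew[OF linear_compose[OF lin(1) P_linear, unfolded comp_def]])
        (unfold pairing_P, rule sw)
    show "ftrace (\<lambda>x. Q (cb (Q x) y)) = 0"
      by (rule ftrace_skew[OF linear_compose[OF lin(2) Q_linear, unfolded comp_def]])
        (unfold s.pairing_P, rule sw)
  qed
  have w: "ftrace (\<lambda>x. weyl (P \<epsilon>) (P x) (P e)) = (1 - ftrace P) * pairing (P \<epsilon>) (P e)"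
    "ftrace (\<lambda>x. weyl (Q \<epsilon>) (Q x) (Q e)) = (1 - ftrace Q) * pairing (Q \<epsilon>) (Q e)"
    unfolding weyl_def ftrace_diff ftrace_scale
      ftrace_rank_one[OF linear_compose[OF P_linear linear_pairing(2), unfolded comp_def]]
      ftrace_rank_one[OF linear_compose[OF Q_linear linear_pairing(2), unfolded comp_def]] PP s.PP
    by (simp_all add: left_diff_distrib)
  have "pairing \<epsilon> e = pairing (P \<epsilon> + Q \<epsilon>) (P e + Q e)"
    by (simp only: PQ_add)
  also have "\<dots> = pairing (P \<epsilon>) (P e) + pairing (Q \<epsilon>) (Q e)"
    by (simp add: pairing_simps PQ_orth s.PQ_orth)
  finally show ?thesis
    unfolding conn_def ftrace_add ftrace_scale mix skew w using assms by simp
qed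

text \<open>Both generalized Ricci tensors vanish on left-invariant sections, by \<open>ricci_formula\<close>.\<close>

definition ricci_equations :: "('n fibre \<Rightarrow> real) \<Rightarrow> bool" where
  "ricci_equations dl \<longleftrightarrow>
     (\<forall>u v. dl (P (cb (Q u) (P v))) = ftrace (\<lambda>e. P (cb (Q (cb (P e) (Q u))) (P v)))) \<and>
     (\<forall>u v. dl (Q (cb (P u) (Q v))) = ftrace (\<lambda>e. Q (cb (P (cb (Q e) (P u))) (Q v))))"

lemma ricci_flat_imp_equations:
  assumes rf: "ricci_flat \<A> \<rho> br H F (range Q) \<delta>" and li: "left_invariant_divergence \<delta>"
  obtains dl where "linear dl" "\<And>e. \<delta> (\<lambda>p. e) = (\<lambda>p. dl e)" "ricci_equations dl"
proof -
  interpret s: orth_split Q P by (rule swap)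
  obtain D where lc: "levi_civita \<A> \<rho> br H F (range Q) D"
    and dv: "\<And>u. smooth_map \<A> u \<Longrightarrow> divergence_of D u = \<delta> u"
    and r1: "\<And>u v p. u \<in> sections_in \<A> (range Q) \<Longrightarrow> v \<in> sections_in \<A> (range P) \<Longrightarrow>
           ricci_on (range P) \<rho> br H F D u v p = 0"
    and r2: "\<And>u v p. u \<in> sections_in \<A> (range P) \<Longrightarrow> v \<in> sections_in \<A> (range Q) \<Longrightarrow>
           ricci_on (range Q) \<rho> br H F D u v p = 0"
    using rf unfolding ricci_flat_def orth_range by (auto simp only: sections_iff)
  obtain dl where dl: "\<And>e. \<delta> (\<lambda>p. e) = (\<lambda>p. dl e)"
    using li unfolding left_invariant_divergence_def by metis
  interpret D: levi_civita_connection \<A> br \<rho> H F D P Q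
  proof
    show "generalized_connection \<A> \<rho> D" using lc by (simp add: levi_civita_def)
    then interpret gen_connection \<A> br \<rho> H F D by unfold_locales
    show "gen_torsion \<rho> br H F D u v w p = 0" if "smooth_map \<A> u" "smooth_map \<A> v" "smooth_map \<A> w"
      for u v w p
      using lc that unfolding levi_civita_def sections_iff by simp
    show "P (Bp p e (Q e')) = 0" for p e e'
    proof -
      have "(\<lambda>q. Q e') \<in> sections_in \<A> (range Q)"
        by (auto simp only: sections_in_def smooth_const)
      then have "D (\<lambda>q. e) (\<lambda>q. Q e') \<in> sections_in \<A> (range Q)"
        by (rule conjunct2[OF conjunct2[OF lc[unfolded levi_civita_def]], rule_format, rotated])
          (simp add: smooth_const)
      then have "Bp p e (Q e') \<in> range Q"
        unfolding sections_in_def Bp_def by blast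
      then obtain x where "Bp p e (Q e') = Q x" by blast
      then show ?thesis by (simp only: PQ)
    qed
  qed
  interpret Ds: levi_civita_connection \<A> br \<rho> H F D Q P
    by (rule D.swap_levi_civita)
  have tr: "dl e = ftrace (\<lambda>e'. D.Bp p e' e)" for e p
    using dv[OF smooth_const, of e] D.divergence_of_const[of e p] by (simp add: dl)
  have dvc: "divergence_of D (\<lambda>q. e) p = dl e" for e p
    using dv[OF smooth_const, of e] by (simp add: dl)
  obtain p :: 'p where True by simp
  have lin: "linear dl"
    unfolding tr[of _ p] using D.Bp_linear(1)[of p]
    by (intro linearI) (simp_all add: linear_add linear_scale ftrace_add ftrace_scale)
  have sm: "(\<lambda>q. Q u) \<in> sections_in \<A> (range Q)" "(\<lambda>q. P u) \<in> sections_in \<A> (range P)" for u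
    by (auto simp only: sections_in_def smooth_const)
  have "ricci_equations dl"
    unfolding ricci_equations_def
    using D.ricci_const[OF dvc, of _ _ p] Ds.ricci_const[OF dvc, of _ _ p]
    unfolding r1[OF sm] r2[OF sm(2) sm(1)] tr[symmetric] by simp
  then show ?thesis using that lin dl by blast
qed

lemma equations_imp_ricci_flat:
  assumes "ftrace P \<noteq> 1" "ftrace Q \<noteq> 1" "ricci_equations (pairing \<epsilon>)"
  obtains \<delta> where "ricci_flat \<A> \<rho> br H F (range Q) \<delta>" "left_invariant_divergence \<delta>"
    "divergence_operator \<A> \<rho> \<delta>" "\<And>e. \<delta> (\<lambda>p. e) = (\<lambda>p. pairing \<epsilon> e)"
proof -
  interpret a: alg_connection P Q cb "conn \<epsilon>" by (rule conn_alg_connection)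
  interpret a: invariant_connection \<A> br \<rho> H F P Q "conn \<epsilon>" by unfold_locales
  interpret b: alg_connection Q P cb "conn \<epsilon>" by (rule a.swap_connection)
  interpret b: invariant_connection \<A> br \<rho> H F Q P "conn \<epsilon>" by unfold_locales
  note tr = conn_divergence[OF assms(1,2)]
  note eqs = assms(3)[unfolded ricci_equations_def tr[symmetric]]
  have "ricci_flat \<A> \<rho> br H F (range Q) (divergence_of a.Dext)"
    unfolding ricci_flat_def orth_range
  proof (intro exI[of _ a.Dext] conjI ballI allI a.Dext_levi_civita refl)
    show "ricci_on (range P) \<rho> br H F a.Dext u v p = 0"
      if "u \<in> sections_in \<A> (range Q)" "v \<in> sections_in \<A> (range P)" for u v p
      by (rule a.Dext_ricci[OF that conjunct1[OF eqs, rule_format]])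
    show "ricci_on (range Q) \<rho> br H F a.Dext u v p = 0"
      if "u \<in> sections_in \<A> (range P)" "v \<in> sections_in \<A> (range Q)" for u v p
      by (rule b.Dext_ricci[OF that conjunct2[OF eqs, rule_format]])
  qed
  moreover have "divergence_of a.Dext (\<lambda>p. e) = (\<lambda>p. pairing \<epsilon> e)" for e
    unfolding a.Dext_divergence_const tr ..
  moreover from this have "left_invariant_divergence (divergence_of a.Dext)"
    unfolding left_invariant_divergence_def by blast
  ultimately show ?thesis using that a.Dext_divergence_operator by blast
qed

end

section \<open>The Einstein equations of a left-invariant metric\<close>

text \<open>For the Levi-Civita connection \<open>\<nabla>\<close> of \<open>g\<close> this is \<open>g(\<nabla>\<^bsub>x\<^esub> y, z)\<close>.\<close>

definition koszul ::
  "(real^'n \<Rightarrow> real^'n \<Rightarrow> real^'n) \<Rightarrow> (real^'n \<Rightarrow> real^'n \<Rightarrow> real) \<Rightarrow>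
   real^'n \<Rightarrow> real^'n \<Rightarrow> real^'n \<Rightarrow> real" where
  "koszul br g x y z = (g (br x y) z - g (br y z) x + g (br z x) y) / 2"

text \<open>The same for the connections \<open>\<nabla> \<mp> H/2\<close> with torsion. They describe the bracket of \<open>E\<^sub>-\<close> with \<open>E\<^sub>+\<close>.\<close>

definition koszul_plus where
  "koszul_plus br g H x y z = koszul br g x y z - H x y z / 2"

definition koszul_minus where
  "koszul_minus br g H x y z = koszul br g x y z + H x y z / 2"

definition dual_bases :: "(real^'n \<Rightarrow> real^'n \<Rightarrow> real) \<Rightarrow> ('n::finite \<Rightarrow> real^'n) \<Rightarrow> ('n \<Rightarrow> real^'n) \<Rightarrow> bool" where
  "dual_bases g b b' \<longleftrightarrow> (\<forall>x. (\<Sum>i\<in>UNIV. g x (b' i) *\<^sub>R b i) = x)"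

text \<open>The right-hand sides of the Einstein equations, evaluated on \<open>E\<^sub>- \<times> TG\<close> and on \<open>E\<^sub>- \<times> \<real>\<close>.\<close>

definition ein_source ::
  "(real^'n \<Rightarrow> real^'n \<Rightarrow> real^'n) \<Rightarrow> (real^'n \<Rightarrow> real^'n \<Rightarrow> real) \<Rightarrow>
   (real^'n \<Rightarrow> real^'n \<Rightarrow> real^'n \<Rightarrow> real) \<Rightarrow> (real^'n \<Rightarrow> real^'n \<Rightarrow> real) \<Rightarrow>
   ('n::finite \<Rightarrow> real^'n) \<Rightarrow> ('n \<Rightarrow> real^'n) \<Rightarrow> real^'n \<Rightarrow> real^'n \<Rightarrow> real" where
  "ein_source br g H F b b' x y =
     (\<Sum>i\<in>UNIV. \<Sum>j\<in>UNIV. koszul_minus br g H (b i) x (b' j) * koszul_plus br g H (b j) y (b' i))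
     + (\<Sum>j\<in>UNIV. F x (b' j) * F y (b j))"

definition ein_source0 ::
  "(real^'n \<Rightarrow> real^'n \<Rightarrow> real^'n) \<Rightarrow> (real^'n \<Rightarrow> real^'n \<Rightarrow> real) \<Rightarrow>
   (real^'n \<Rightarrow> real^'n \<Rightarrow> real^'n \<Rightarrow> real) \<Rightarrow> (real^'n \<Rightarrow> real^'n \<Rightarrow> real) \<Rightarrow>
   ('n::finite \<Rightarrow> real^'n) \<Rightarrow> ('n \<Rightarrow> real^'n) \<Rightarrow> real^'n \<Rightarrow> real" where
  "ein_source0 br g H F b b' x =
     (\<Sum>i\<in>UNIV. \<Sum>j\<in>UNIV. koszul_minus br g H (b i) x (b' j) * F (b' i) (b j))"

text \<open>The linear forms \<open>dp\<close>, \<open>dm\<close> and the number \<open>d0\<close> are the restrictions of the divergence to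
  \<open>{X + g(X)}\<close>, to \<open>E\<^sub>- = {X - g(X)}\<close> and to \<open>\<real>\<close>. The first and third equation express \<open>Ric\<^sup>+ = 0\<close>, the other
  two \<open>Ric\<^sup>- = 0\<close>.\<close>

definition einstein_equations where
  "einstein_equations br g H F b b' dp dm d0 \<longleftrightarrow>
     (\<forall>x y. (\<Sum>k\<in>UNIV. koszul_plus br g H x y (b' k) * dp (b k)) + F x y * d0 = ein_source br g H F b b' x y) \<and>
     (\<forall>x y. (\<Sum>k\<in>UNIV. koszul_minus br g H y x (b' k) * dm (b k)) = ein_source br g H F b b' x y) \<and>
     (\<forall>x. (\<Sum>k\<in>UNIV. F x (b' k) * dp (b k)) = - ein_source0 br g H F b b' x) \<and>
     (\<forall>x. (\<Sum>k\<in>UNIV. F x (b' k) * dm (b k)) = - ein_source0 br g H F b b' x)"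

definition flat :: "(real^'n \<Rightarrow> real^'n \<Rightarrow> real) \<Rightarrow> real^'n \<Rightarrow> real^'n" where
  "flat g x = (\<chi> i. g x (evec i))"

lemma flat_inner:
  assumes "bilinear g"
  shows "flat g x \<bullet> y = g x y"
  unfolding flat_def using assms by (intro linear_coordinates_inner) (simp add: bilinear_def)

lemma flat_linear:
  assumes "bilinear g"
  shows "linear (flat g)"
  by (rule linearI) (simp_all add: flat_def vec_eq_iff bilinear_ladd[OF assms] bilinear_lmul[OF assms])

lemma flat_bij:
  fixes g :: "real^'n \<Rightarrow> real^'n \<Rightarrow> real"
  assumes "pseudo_metric g"
  shows "bij (flat g)"
proof -
  have bil: "bilinear g" and nd: "\<And>x. (\<And>y. g x y = 0) \<Longrightarrow> x = 0"
    using assms by (auto simp: pseudo_metric_def)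
  have "inj (flat g)"
  proof (rule linear_injective_0[OF flat_linear[OF bil], THEN iffD2], intro allI impI)
    fix x assume "flat g x = 0"
    then show "x = 0" by (intro nd) (simp add: flat_inner[OF bil, symmetric])
  qed
  then show ?thesis
    using linear_inj_imp_surj[OF flat_linear[OF bil]] by (simp add: bij_def)
qed

lemma pseudo_metric_riesz:
  fixes g :: "real^'n \<Rightarrow> real^'n \<Rightarrow> real" and L :: "real^'n \<Rightarrow> real"
  assumes "pseudo_metric g" "linear L"
  obtains x where "\<And>y. g x y = L y"
proof -
  have bil: "bilinear g" using assms(1) by (simp add: pseudo_metric_def)
  obtain x where x: "flat g x = (\<chi> i. L (evec i))"
    using bij_is_surj[OF flat_bij[OF assms(1)]] by (metis surjD)
  have "g x y = L y" for y
    unfolding flat_inner[OF bil, symmetric] x by (rule linear_coordinates_inner[OF assms(2)])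
  then show ?thesis by (rule that)
qed

locale metric_courant = courant \<A> br \<rho> H F
  for \<A> :: "('p::topological_space, real^'n) chart set"
    and br :: "real^'n \<Rightarrow> real^'n \<Rightarrow> real^'n"
    and \<rho> :: "('p, 'n::finite) frame" and H F +
  fixes g :: "real^'n \<Rightarrow> real^'n \<Rightarrow> real"
  assumes g_pseudo: "pseudo_metric g"
begin

lemma g_bilinear: "bilinear g" and g_sym: "g x y = g y x" and g_nondeg: "(\<And>y. g x y = 0) \<Longrightarrow> x = 0"
  using g_pseudo by (auto simp: pseudo_metric_def)

lemmas g_simps = bilinear_ladd[OF g_bilinear] bilinear_radd[OF g_bilinear]
  bilinear_lmul[OF g_bilinear] bilinear_rmul[OF g_bilinear]
  bilinear_lsub[OF g_bilinear] bilinear_rsub[OF g_bilinear]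
  bilinear_lneg[OF g_bilinear] bilinear_rneg[OF g_bilinear]

lemmas flat_inner = flat_inner[OF g_bilinear]

lemmas flat_linear = flat_linear[OF g_bilinear]

definition sharp :: "real^'n \<Rightarrow> real^'n" where "sharp = inv (flat g)"

lemma flat_sharp [simp]: "flat g (sharp x) = x" and sharp_flat [simp]: "sharp (flat g x) = x"
  using flat_bij[OF g_pseudo] by (simp_all add: sharp_def bij_is_inj bij_is_surj surj_f_inv_f)

lemma sharp_linear: "linear sharp"
  by (rule linearI; rule injD[OF bij_is_inj[OF flat_bij[OF g_pseudo]]])
    (simp_all add: linear_add[OF flat_linear] linear_scale[OF flat_linear])

text \<open>The embeddings of the Lie algebra as \<open>E\<^sub>- = {X - g(X)}\<close> and as the part \<open>{X + g(X)}\<close> of \<open>E\<^sub>+\<close>, whose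
  orthogonal complement in \<open>E\<^sub>+\<close> is spanned by \<open>e0\<close>.\<close>

definition em :: "real^'n \<Rightarrow> 'n fibre" where "em x = (x, - flat g x, 0)"
definition ep :: "real^'n \<Rightarrow> 'n fibre" where "ep x = (x, flat g x, 0)"
definition e0 :: "'n fibre" where "e0 = (0, 0, 1)"

definition Q :: "'n fibre \<Rightarrow> 'n fibre" where
  "Q e = em ((1/2) *\<^sub>R (vec_part e - sharp (form_part e)))"

definition P :: "'n fibre \<Rightarrow> 'n fibre" where
  "P e = ep ((1/2) *\<^sub>R (vec_part e + sharp (form_part e))) + scal_part e *\<^sub>R e0"

lemma e_parts [simp]:
  "vec_part (em x) = x" "form_part (em x) = - flat g x" "scal_part (em x) = 0"
  "vec_part (ep x) = x" "form_part (ep x) = flat g x" "scal_part (ep x) = 0"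
  "vec_part e0 = 0" "form_part e0 = 0" "scal_part e0 = 1"
  by (simp_all add: em_def ep_def e0_def)

lemma pairing_e:
  "pairing (em x) (em y) = - g x y" "pairing (ep x) (ep y) = g x y" "pairing (em x) (ep y) = 0"
  "pairing (ep x) (em y) = 0" "pairing e0 e0 = 1" "pairing e0 (em x) = 0" "pairing e0 (ep x) = 0"
  "pairing (em x) e0 = 0" "pairing (ep x) e0 = 0"
  using g_sym[of x y] by (simp_all add: pairing_def flat_inner)

lemma linear_e: "linear em" "linear ep"
  by (auto simp: linear_iff em_def ep_def linear_add[OF flat_linear] linear_scale[OF flat_linear])

lemma sharp_neg: "sharp (- x) = - sharp x"
  by (rule linear_neg[OF sharp_linear])

lemma Q_e [simp]: "Q (em x) = em x" "Q (ep x) = 0" "Q e0 = 0"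
  and P_e [simp]: "P (em x) = 0" "P (ep x) = ep x" "P e0 = e0"
  by (auto simp: P_def Q_def sharp_neg linear_0[OF sharp_linear] linear_0[OF linear_e(1)]
      linear_0[OF linear_e(2)] scaleR_2[symmetric])

lemma Q_form: "\<exists>x. Q e = em x" and P_form: "\<exists>y l. P e = ep y + l *\<^sub>R e0"
  unfolding P_def Q_def by blast+

lemma PQ_linear: "linear P" "linear Q"
  unfolding P_def Q_def
  by (rule linearI;
      simp add: linear_add[OF linear_e(1)] linear_add[OF linear_e(2)] linear_add[OF sharp_linear]
        linear_scale[OF linear_e(1)] linear_scale[OF linear_e(2)] linear_scale[OF sharp_linear]
        linear_diff[OF linear_e(1)] linear_diff[OF linear_e(2)] algebra_simps)+

lemma split: "orth_split P Q"
proof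
  show "P (x + y) = P x + P y" "Q (x + y) = Q x + Q y" "P (c *\<^sub>R x) = c *\<^sub>R P x" "Q (c *\<^sub>R x) = c *\<^sub>R Q x"
    for x y c using PQ_linear by (simp_all only: linear_add linear_scale)
  show "P e + Q e = e" for e
    unfolding P_def Q_def
    by (rule fibre_eqI) (simp_all add: linear_add[OF flat_linear] linear_diff[OF flat_linear]
        linear_scale[OF flat_linear] algebra_simps flip: scaleR_add_left)
  show "P (Q e) = 0" "Q (P e) = 0" for e
    using Q_form[of e] P_form[of e]
    by (auto simp del: split_paired_Ex simp: linear_add[OF PQ_linear(2)] linear_scale[OF PQ_linear(2)])
  show "pairing (P e) (Q e') = 0" for e e'
    using Q_form[of e'] P_form[of e]
    by (auto simp del: split_paired_Ex simp: pairing_simps pairing_e)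
qed

sublocale split_courant \<A> br \<rho> H F P Q
  by (simp add: split_courant_def split courant_axioms)

lemma range_Q: "range Q = E_minus g"
proof -
  have "range Q = range em"
  proof (intro subset_antisym subsetI)
    show "e \<in> range em" if "e \<in> range Q" for e using that Q_form by blast
    show "e \<in> range Q" if "e \<in> range em" for e
    proof -
      obtain x where "e = em x" using \<open>e \<in> range em\<close> by blast
      then have "e = Q (em x)" by simp
      then show ?thesis by blast
    qed
  qed
  then show ?thesis by (auto simp: E_minus_def em_def flat_def)
qed

lemma generalized_metric_E_minus: "generalized_metric (E_minus g)"
proof -
  have E: "E_minus g = range em" by (auto simp: E_minus_def em_def flat_def)
  have "subspace (range em)"
    using linear_subspace_image[OF linear_e(1) subspace_UNIV] .
  moreover have "w = 0" if "w \<in> range em" "\<And>w'. w' \<in> range em \<Longrightarrow> pairing w w' = 0" for w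
  proof -
    obtain x where w: "w = em x" using \<open>w \<in> range em\<close> by blast
    have "g x y = 0" for y using that(2)[of "em y"] by (simp add: w pairing_e)
    then have "x = 0" by (rule g_nondeg)
    then show ?thesis by (simp add: w linear_0[OF linear_e(1)])
  qed
  moreover have "bij_betw vec_part (range em) UNIV"
    by (rule bij_betw_byWitness[where f' = em]) auto
  ultimately show ?thesis
    unfolding generalized_metric_def E by blast
qed

abbreviation "Kp \<equiv> koszul_plus br g H"
abbreviation "Km \<equiv> koszul_minus br g H"

text \<open>With the signs of \<open>g\<close> on \<open>E\<^sub>\<plusminus>\<close> the three-form of the bracket becomes Koszul's formula.\<close>

lemma cb_components:
  "pairing (cb (em x) (ep y)) (ep z) = Kp x y z"
  "pairing (cb (ep y) (em x)) (em z) = - Km y x z"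
  "pairing (cb (em x) (ep y)) e0 = F x y"
  "pairing (cb (em x) e0) (ep z) = - F x z"
  "pairing (cb e0 (em x)) (em z) = F x z"
  "pairing (cb (em x) e0) e0 = 0"
proof -
  note n = bilinear_lzero[OF br_bilinear] bilinear_rzero[OF br_bilinear] linear_0[OF H_linear(1)]
    linear_0[OF H_linear(2)] linear_0[OF H_linear(3)] bilinear_lzero[OF F_bilinear]
    bilinear_rzero[OF F_bilinear]
  show "pairing (cb (em x) (ep y)) (ep z) = Kp x y z"
    using pairing_cbr[of "em x" "ep y" "ep z"] g_sym
    by (simp add: koszul_plus_def koszul_def flat_inner n field_simps)
  show "pairing (cb (ep y) (em x)) (em z) = - Km y x z"
    using pairing_cbr[of "ep y" "em x" "em z"] g_sym
    by (simp add: koszul_minus_def koszul_def flat_inner n field_simps)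
  show "pairing (cb (em x) (ep y)) e0 = F x y"
    using pairing_cbr[of "em x" "ep y" e0] by (simp add: n)
  show "pairing (cb (em x) e0) (ep z) = - F x z"
    using pairing_cbr[of "em x" e0 "ep z"] F_skew[of z x] by (simp add: n)
  show "pairing (cb e0 (em x)) (em z) = F x z"
    using pairing_cbr[of e0 "em x" "em z"] by (simp add: n)
  show "pairing (cb (em x) e0) e0 = 0"
    using pairing_cbr[of "em x" e0 e0] by (simp add: n)
qed

context
  fixes b b' :: "'n \<Rightarrow> real^'n"
  assumes dual: "dual_bases g b b'"
begin

lemma dual_expand: "(\<Sum>i\<in>UNIV. g x (b' i) *\<^sub>R b i) = x"
  using dual by (simp add: dual_bases_def)

lemma Q_expand: "Q e = (\<Sum>j\<in>UNIV. - pairing e (em (b' j)) *\<^sub>R em (b j))"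
proof -
  interpret s: orth_split Q P by (rule swap)
  obtain x where x: "Q e = em x" using Q_form by blast
  have "pairing e (em z) = - g x z" for z
    using s.pairing_P[of e "em z"] by (simp add: x pairing_e)
  then show ?thesis
    unfolding x using dual_expand[of x] linear_sum[OF linear_e(1)] linear_scale[OF linear_e(1)]
    by (metis (no_types, lifting) minus_minus sum.cong)
qed

lemma P_expand: "P e = (\<Sum>i\<in>UNIV. pairing e (ep (b' i)) *\<^sub>R ep (b i)) + pairing e e0 *\<^sub>R e0"
proof -
  obtain y l where y: "P e = ep y + l *\<^sub>R e0" using P_form by blast
  have "pairing e (ep z) = g y z" for z
    using pairing_P[of e "ep z"] by (simp add: y pairing_simps pairing_e)
  moreover have "pairing e e0 = l"
    using pairing_P[of e e0] by (simp add: y pairing_simps pairing_e)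
  moreover have "ep y = (\<Sum>i\<in>UNIV. g y (b' i) *\<^sub>R ep (b i))"
    using arg_cong[OF dual_expand[of y], of ep]
    by (simp add: linear_sum[OF linear_e(2)] linear_scale[OF linear_e(2)])
  ultimately show ?thesis using y by simp
qed

lemma ftrace_Q:
  assumes "linear L"
  shows "ftrace (\<lambda>e. L (Q e)) = - (\<Sum>j\<in>UNIV. pairing (L (em (b j))) (em (b' j)))"
proof -
  have "ftrace (\<lambda>e. L (Q e)) = (\<Sum>j\<in>UNIV. - pairing (L (em (b j))) (em (b' j)))"
    unfolding Q_expand linear_sum[OF assms] linear_scale[OF assms]
    by (rule ftrace_rank_one_sum[where \<phi> = "\<lambda>j e. - pairing e (em (b' j))"])
      (simp_all add: linear_iff pairing_simps)
  then show ?thesis by (simp add: sum_negf)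
qed

lemma ftrace_P:
  assumes "linear L"
  shows "ftrace (\<lambda>e. L (P e)) = (\<Sum>i\<in>UNIV. pairing (L (ep (b i))) (ep (b' i))) + pairing (L e0) e0"
proof -
  have "ftrace (\<lambda>e. \<Sum>i\<in>UNIV. pairing e (ep (b' i)) *\<^sub>R L (ep (b i)))
      = (\<Sum>i\<in>UNIV. pairing (L (ep (b i))) (ep (b' i)))"
    by (rule ftrace_rank_one_sum[where \<phi> = "\<lambda>i e. pairing e (ep (b' i))"])
      (simp_all add: linear_pairing)
  then show ?thesis
    unfolding P_expand linear_add[OF assms] linear_sum[OF assms] linear_scale[OF assms] ftrace_add
    by (simp only: ftrace_rank_one[OF linear_pairing(2)])
qed

text \<open>Both traces involve the same number \<open>\<Sum> g(b\<^sub>i, b'\<^sub>i)\<close>, which their sum, the rank of the bundle, determines.\<close>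

lemma ranks: "ftrace P = real (CARD('n)) + 1" "ftrace Q = real (CARD('n))"
proof -
  let ?t = "\<Sum>i\<in>UNIV. g (b i) (b' i)"
  have P: "ftrace P = ?t + 1"
    using ftrace_P[OF linear_ident] by (simp add: pairing_e)
  have Q: "ftrace Q = ?t"
    using ftrace_Q[OF linear_ident] by (simp add: pairing_e sum_negf)
  have "ftrace P + ftrace Q = ftrace (\<lambda>e::'n fibre. e)"
    unfolding ftrace_add[symmetric] PQ_add ..
  also have "\<dots> = 2 * real (CARD('n)) + 1"
  proof -
    have "ftrace (\<lambda>e::'n fibre. e) = real (DIM((real^'n) \<times> (real^'n) \<times> real))"
      by (simp add: ftrace_def inner_Basis)
    then show ?thesis by simp
  qed
  finally show "ftrace P = real (CARD('n)) + 1" "ftrace Q = real (CARD('n))"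
    using P Q by simp_all
qed

text \<open>The three-form of the bracket with \<open>em x\<close> and with \<open>v\<close> inserted, contracted over \<open>E\<^sub>+ \<otimes> E\<^sub>-\<close>. The
  trace terms of both Ricci tensors are this same contraction.\<close>

definition source :: "real^'n \<Rightarrow> 'n fibre \<Rightarrow> real" where
  "source x v = - (\<Sum>i\<in>UNIV. \<Sum>j\<in>UNIV. pairing (cb (ep (b i)) (em x)) (em (b' j)) * pairing (cb (em (b j)) v) (ep (b' i)))
     - (\<Sum>j\<in>UNIV. pairing (cb e0 (em x)) (em (b' j)) * pairing (cb (em (b j)) v) e0)"

lemma lin_cb: "linear (\<lambda>e. cb e v)" "linear (cb v)"
  using cbr_bilinear unfolding bilinear_def by blast+

lemma source_plus: "ftrace (\<lambda>e. P (cb (Q (cb (P e) (em x))) v)) = source x v"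
proof -
  interpret s: orth_split Q P by (rule swap)
  have Qp: "pairing (P (cb (Q z) v)) (P w)
      = - (\<Sum>j\<in>UNIV. pairing z (em (b' j)) * pairing (cb (em (b j)) v) (P w))" for z w
    unfolding pairing_P PP Q_expand linear_sum[OF lin_cb(1)] linear_scale[OF lin_cb(1)]
      linear_sum[OF linear_pairing(2)] pairing_simps
    by (simp add: sum_negf)
  have lin: "linear (\<lambda>e. P (cb (Q (cb e (em x))) v))"
    by (auto simp only: linear_iff P_simps s.P_simps cb_simps)
  show ?thesis
    unfolding ftrace_P[OF lin] source_def
    using Qp[of _ "ep _"] Qp[of _ e0] by (simp add: sum_negf)
qed

lemma source_minus: "ftrace (\<lambda>e. Q (cb (P (cb (Q e) (P v))) (em x))) = source x (P v)"
proof -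
  interpret s: orth_split Q P by (rule swap)
  have Pp: "pairing (Q (cb (P z) (em x))) (Q w)
      = (\<Sum>i\<in>UNIV. pairing z (ep (b' i)) * pairing (cb (ep (b i)) (em x)) (Q w))
        + pairing z e0 * pairing (cb e0 (em x)) (Q w)" for z w
    unfolding s.pairing_P s.PP P_expand linear_sum[OF lin_cb(1)] linear_scale[OF lin_cb(1)]
      linear_add[OF lin_cb(1)] linear_sum[OF linear_pairing(2)] pairing_simps
    by simp
  have lin: "linear (\<lambda>e. Q (cb (P (cb e (P v))) (em x)))"
    by (auto simp only: linear_iff P_simps s.P_simps cb_simps)
  have "ftrace (\<lambda>e. Q (cb (P (cb (Q e) (P v))) (em x)))
      = - (\<Sum>j\<in>UNIV. (\<Sum>i\<in>UNIV. pairing (cb (em (b j)) (P v)) (ep (b' i)) * pairing (cb (ep (b i)) (em x)) (em (b' j)))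
        + pairing (cb (em (b j)) (P v)) e0 * pairing (cb e0 (em x)) (em (b' j)))"
    unfolding ftrace_Q[OF lin] using Pp[of _ "em _"] by simp
  also have "\<dots> = source x (P v)"
    unfolding source_def sum.distrib by (subst sum.swap) (simp add: mult.commute)
  finally show ?thesis .
qed

lemma source_ep: "source x (ep y) = ein_source br g H F b b' x y"
proof -
  have "F (b j) y = - F y (b j)" for j by (rule F_skew)
  then show ?thesis
    by (simp add: source_def ein_source_def cb_components sum_negf)
qed

lemma source_e0: "source x e0 = ein_source0 br g H F b b' x"
proof -
  have "F (b j) (b' i) = - F (b' i) (b j)" for i j by (rule F_skew)
  then show ?thesis
    by (simp add: source_def ein_source0_def cb_components sum_negf)
qed

lemma source_linear: "source x (v + l *\<^sub>R w) = source x v + l * source x w"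
  unfolding source_def cb_simps pairing_simps
  by (simp add: algebra_simps sum.distrib sum_distrib_left)

text \<open>Both sides are affine in the \<open>\<real>\<close>-component \<open>l\<close> of an element \<open>ep y + l *\<^sub>R e0\<close> of \<open>E\<^sub>+\<close>, which separates
  the equations on \<open>E\<^sub>- \<times> TG\<close> from those on \<open>E\<^sub>- \<times> \<real>\<close>.\<close>

lemma ricci_equations_iff:
  assumes dl: "linear dl"
  shows "ricci_equations dl \<longleftrightarrow>
    einstein_equations br g H F b b' (\<lambda>x. dl (ep x)) (\<lambda>x. dl (em x)) (dl e0)"
proof -
  have vP: "(\<forall>u v. R (Q u) (P v)) \<longleftrightarrow> (\<forall>x y l. R (em x) (ep y + l *\<^sub>R e0))" for R
  proof
    assume R: "\<forall>u v. R (Q u) (P v)"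
    show "\<forall>x y l. R (em x) (ep y + l *\<^sub>R e0)"
    proof (intro allI)
      fix x y l
      show "R (em x) (ep y + l *\<^sub>R e0)"
        using R[rule_format, of "em x" "ep y + l *\<^sub>R e0"] by (simp add: P_simps)
    qed
  next
    assume R: "\<forall>x y l. R (em x) (ep y + l *\<^sub>R e0)"
    show "\<forall>u v. R (Q u) (P v)"
    proof (intro allI)
      fix u v
      obtain x y l where "Q u = em x" "P v = ep y + l *\<^sub>R e0" using Q_form P_form by blast
      then show "R (Q u) (P v)" using R by simp
    qed
  qed
  have 1: "(\<forall>u v. dl (P (cb (Q u) (P v))) = ftrace (\<lambda>e. P (cb (Q (cb (P e) (Q u))) (P v)))) \<longleftrightarrow>
    (\<forall>x y l. dl (P (cb (em x) (ep y + l *\<^sub>R e0))) = source x (ep y + l *\<^sub>R e0))"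
    unfolding vP[of "\<lambda>u v. dl (P (cb u v)) = ftrace (\<lambda>e. P (cb (Q (cb (P e) u)) v))"] source_plus ..
  have 2: "(\<forall>u v. dl (Q (cb (P u) (Q v))) = ftrace (\<lambda>e. Q (cb (P (cb (Q e) (P u))) (Q v)))) \<longleftrightarrow>
    (\<forall>x y l. dl (Q (cb (ep y + l *\<^sub>R e0) (em x))) = source x (ep y + l *\<^sub>R e0))"
  proof -
    have "ftrace (\<lambda>e. Q (cb (P (cb (Q e) (ep y + l *\<^sub>R e0))) (em x))) = source x (ep y + l *\<^sub>R e0)" for x y l
      using source_minus[of "ep y + l *\<^sub>R e0" x] by (simp add: P_simps)
    then show ?thesis
      using vP[of "\<lambda>v u. dl (Q (cb u v)) = ftrace (\<lambda>e. Q (cb (P (cb (Q e) u)) v))"] by auto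
  qed
  interpret s: orth_split Q P by (rule swap)
  have lp: "dl (P (cb (em x) (ep y + l *\<^sub>R e0)))
      = (\<Sum>k\<in>UNIV. Kp x y (b' k) * dl (ep (b k))) + F x y * dl e0
        - l * (\<Sum>k\<in>UNIV. F x (b' k) * dl (ep (b k)))" for x y l
    unfolding P_expand linear_add[OF dl] linear_sum[OF dl] linear_scale[OF dl] cb_simps pairing_simps
    by (simp add: cb_components sum_distrib_left algebra_simps sum_subtractf)
  have lm: "dl (Q (cb (ep y + l *\<^sub>R e0) (em x)))
      = (\<Sum>k\<in>UNIV. Km y x (b' k) * dl (em (b k))) - l * (\<Sum>k\<in>UNIV. F x (b' k) * dl (em (b k)))" for x y l
    unfolding Q_expand linear_sum[OF dl] linear_scale[OF dl] cb_simps pairing_simps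
    by (simp add: cb_components sum_distrib_left algebra_simps sum_subtractf)
  have aff: "(\<forall>l. A - l * B = C + l * D) \<longleftrightarrow> A = C \<and> B = - D" for A B C D :: real
  proof
    assume a: "\<forall>l. A - l * B = C + l * D"
    from a[rule_format, of 0] a[rule_format, of 1] show "A = C \<and> B = - D" by simp
  qed simp
  show ?thesis
    unfolding ricci_equations_def 1 2 lp lm source_linear source_ep source_e0 aff einstein_equations_def
    by blast
qed

end

end

section \<open>Odd Einstein metrics in terms of the equations on the Lie algebra\<close>

lemma odd_einstein_metric_imp_equations:
  fixes \<A> :: "('p::topological_space, real^3) chart set"
  assumes fr: "lie_frame \<A> br \<rho>" and E: "odd_einstein_metric \<A> \<rho> br g \<delta>"
  obtains H F dp dm d0 where "pseudo_metric g" "three_form H" "two_form F" "closed_two_form br F"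
    "F \<noteq> (\<lambda>x y. 0)" "linear dp" "linear dm"
    "\<And>b b'. dual_bases g b b' \<Longrightarrow> einstein_equations br g H F b b' dp dm d0"
    "divergence_free \<delta> \<longleftrightarrow> (\<forall>x. dp x = 0) \<and> (\<forall>x. dm x = 0) \<and> d0 = 0"
proof -
  obtain H F where F: "F \<noteq> (\<lambda>x y. 0)" and pg: "pseudo_metric g"
    and HF: "three_form H" "two_form F" "closed_two_form br F"
    and d: "divergence_operator \<A> \<rho> \<delta>" "left_invariant_divergence \<delta>"
    and rf: "ricci_flat \<A> \<rho> br H F (E_minus g) \<delta>"
    using E unfolding odd_einstein_metric_def odd_einstein_def by blast
  interpret m: metric_courant \<A> br \<rho> H F g
    using fr HF pg by (simp add: metric_courant_def courant_def courant_axioms_def metric_courant_axioms_def)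
  obtain dl where dl: "linear dl" "\<And>e. \<delta> (\<lambda>p. e) = (\<lambda>p. dl e)" "m.ricci_equations dl"
    using m.ricci_flat_imp_equations[OF rf[folded m.range_Q] d(2)] by blast
  have lin: "linear (\<lambda>x. dl (m.ep x))" "linear (\<lambda>x. dl (m.em x))"
    using linear_compose[OF m.linear_e(2) dl(1)] linear_compose[OF m.linear_e(1) dl(1)]
    by (simp_all add: comp_def)
  have "divergence_free \<delta> \<longleftrightarrow> (\<forall>e. dl e = 0)"
    unfolding divergence_free_def dl(2) by (metis (mono_tags))
  also have "\<dots> \<longleftrightarrow> (\<forall>x. dl (m.ep x) = 0) \<and> (\<forall>x. dl (m.em x) = 0) \<and> dl m.e0 = 0"
  proof (intro iffI conjI allI)
    fix e assume z: "(\<forall>x. dl (m.ep x) = 0) \<and> (\<forall>x. dl (m.em x) = 0) \<and> dl m.e0 = 0"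
    have "dl e = dl (m.P e) + dl (m.Q e)"
      unfolding linear_add[OF dl(1), symmetric] m.PQ_add ..
    then show "dl e = 0"
      using z by (simp add: m.P_def m.Q_def linear_add[OF dl(1)] linear_scale[OF dl(1)])
  qed blast+
  finally show ?thesis
    using that[OF pg HF F lin m.ricci_equations_iff[OF _ dl(1), THEN iffD1, OF _ dl(3)]] by blast
qed

lemma equations_imp_odd_einstein_metric:
  fixes \<A> :: "('p::topological_space, real^3) chart set"
  assumes fr: "lie_frame \<A> br \<rho>" and pg: "pseudo_metric g"
    and HF: "three_form H" "two_form F" "closed_two_form br F" and F: "F \<noteq> (\<lambda>x y. 0)"
    and dual: "dual_bases g b b'" and lin: "linear dp" "linear dm"
    and eq: "einstein_equations br g H F b b' dp dm d0"
  obtains \<delta> where "odd_einstein_metric \<A> \<rho> br g \<delta>"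
    "divergence_free \<delta> \<longleftrightarrow> (\<forall>x. dp x = 0) \<and> (\<forall>x. dm x = 0) \<and> d0 = 0"
proof -
  interpret m: metric_courant \<A> br \<rho> H F g
    using fr HF pg by (simp add: metric_courant_def courant_def courant_axioms_def metric_courant_axioms_def)
  define \<epsilon> where "\<epsilon> = (\<Sum>k\<in>UNIV. dp (b k) *\<^sub>R m.ep (b' k)) - (\<Sum>k\<in>UNIV. dm (b k) *\<^sub>R m.em (b' k)) + d0 *\<^sub>R m.e0"
  have coord: "(\<Sum>k\<in>UNIV. d (b k) * g (b' k) x) = d x" if "linear d" for d :: "real^3 \<Rightarrow> real" and x
  proof -
    have "d x = d (\<Sum>k\<in>UNIV. g x (b' k) *\<^sub>R b k)"
      by (simp only: m.dual_expand[OF dual])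
    then show ?thesis
      using m.g_sym by (simp add: linear_sum[OF that] linear_scale[OF that] mult.commute)
  qed
  have eps: "pairing \<epsilon> (m.ep x) = dp x" "pairing \<epsilon> (m.em x) = dm x" "pairing \<epsilon> m.e0 = d0" for x
    unfolding \<epsilon>_def pairing_simps linear_sum[OF linear_pairing(2)] m.pairing_e
    by (simp_all add: coord[OF lin(1)] coord[OF lin(2)] sum_negf)
  have ranks: "ftrace m.P \<noteq> 1" "ftrace m.Q \<noteq> 1"
    using m.ranks[OF dual] by simp_all
  have "m.ricci_equations (pairing \<epsilon>)"
    unfolding m.ricci_equations_iff[OF dual linear_pairing(1)] eps by (rule eq)
  then obtain \<delta> where d: "ricci_flat \<A> \<rho> br H F (range m.Q) \<delta>" "left_invariant_divergence \<delta>"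
    "divergence_operator \<A> \<rho> \<delta>" "\<And>e. \<delta> (\<lambda>p. e) = (\<lambda>p. pairing \<epsilon> e)"
    using m.equations_imp_ricci_flat[OF ranks] by blast
  have E: "odd_einstein_metric \<A> \<rho> br g \<delta>"
    unfolding odd_einstein_metric_def odd_einstein_def
    using d(1-3) HF F pg m.generalized_metric_E_minus unfolding m.range_Q by blast
  have "divergence_free \<delta> \<longleftrightarrow> (\<forall>e. pairing \<epsilon> e = 0)"
    unfolding divergence_free_def d(4) by (metis (mono_tags))
  also have "\<dots> \<longleftrightarrow> (\<forall>x. dp x = 0) \<and> (\<forall>x. dm x = 0) \<and> d0 = 0"
  proof (intro iffI conjI allI)
    fix e assume z: "(\<forall>x. dp x = 0) \<and> (\<forall>x. dm x = 0) \<and> d0 = 0"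
    have "pairing \<epsilon> e = pairing \<epsilon> (m.P e) + pairing \<epsilon> (m.Q e)"
      unfolding pairing_simps(2)[symmetric] m.PQ_add ..
    then show "pairing \<epsilon> e = 0"
      using z by (simp add: m.P_def m.Q_def pairing_simps eps)
  qed (metis eps)+
  finally show ?thesis using that E by blast
qed

section \<open>Three-dimensional non-unimodular Lie algebras\<close>

definition indep3 :: "'a::real_vector \<Rightarrow> 'a \<Rightarrow> 'a \<Rightarrow> bool" where
  "indep3 e u v \<longleftrightarrow> (\<forall>r s t. r *\<^sub>R e + s *\<^sub>R u + t *\<^sub>R v = 0 \<longrightarrow> r = 0 \<and> s = 0 \<and> t = 0)"

lemma coordinates3:
  fixes e u v :: "real^3"
  assumes "indep3 e u v"
  obtains \<phi>0 \<phi>1 \<phi>2 :: "real^3 \<Rightarrow> real" where "linear \<phi>0" "linear \<phi>1" "linear \<phi>2"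
    "\<And>x. x = \<phi>0 x *\<^sub>R e + \<phi>1 x *\<^sub>R u + \<phi>2 x *\<^sub>R v"
    "\<And>r s t. \<phi>0 (r *\<^sub>R e + s *\<^sub>R u + t *\<^sub>R v) = r"
    "\<And>r s t. \<phi>1 (r *\<^sub>R e + s *\<^sub>R u + t *\<^sub>R v) = s"
    "\<And>r s t. \<phi>2 (r *\<^sub>R e + s *\<^sub>R u + t *\<^sub>R v) = t"
proof -
  define f where "f = (\<lambda>w::real^3. (w $ 1) *\<^sub>R e + (w $ 2) *\<^sub>R u + (w $ 3) *\<^sub>R v)"
  have lin: "linear f"
    by (rule linearI) (simp_all add: f_def algebra_simps)
  have inj: "inj f"
  proof (rule linear_injective_0[OF lin, THEN iffD2], intro allI impI)
    fix w assume "f w = 0"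
    then have "w $ 1 = 0 \<and> w $ 2 = 0 \<and> w $ 3 = 0"
      using assms unfolding f_def indep3_def by blast
    then show "w = 0" by (simp add: vec_eq_iff forall_3)
  qed
  have surj: "surj f" by (rule linear_inj_imp_surj[OF lin inj])
  define k where "k = inv f"
  have kf: "k (f w) = w" and fk: "f (k x) = x" for w x
    using inj surj by (simp_all add: k_def surj_f_inv_f)
  have link: "linear k"
    by (rule linearI; rule injD[OF inj]) (simp_all add: fk linear_add[OF lin] linear_scale[OF lin])
  have f_vec: "r *\<^sub>R e + s *\<^sub>R u + t *\<^sub>R v = f (vector [r, s, t])" for r s t
    by (simp add: f_def)
  show thesis
  proof (rule that[of "\<lambda>x. k x $ 1" "\<lambda>x. k x $ 2" "\<lambda>x. k x $ 3"])
    show "x = k x $ 1 *\<^sub>R e + k x $ 2 *\<^sub>R u + k x $ 3 *\<^sub>R v" for x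
      using fk[of x] by (simp add: f_def)
  qed (auto simp: linear_iff linear_add[OF link] linear_scale[OF link] f_vec kf)
qed

lemma indep3_span:
  fixes e u v :: "real^3"
  assumes "indep3 e u v"
  obtains r s t where "x = r *\<^sub>R e + s *\<^sub>R u + t *\<^sub>R v"
  by (rule coordinates3[OF assms]) (rule that)

lemma sum_Basis_vec: "(\<Sum>b\<in>(Basis :: (real^'n) set). h b) = (\<Sum>i\<in>UNIV. h (evec i))"
proof -
  have B: "(Basis :: (real^'n) set) = range (\<lambda>i. axis i 1)"
    by (auto simp: Basis_vec_def)
  have "inj (\<lambda>i::'n. axis i (1::real))"
    by (rule injI) (simp add: axis_eq_axis)
  then show ?thesis unfolding B by (simp only: sum.reindex comp_def)
qed

lemma trace_matrix: "trace (matrix f) = ftrace f" for f :: "real^'n \<Rightarrow> real^'n"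
  by (simp add: trace_def matrix_def ftrace_def sum_Basis_vec inner_axis)

text \<open>A basis whose last two members span an abelian ideal, on which \<open>ad\<^bsub>e\<^esub>\<close> has the matrix with rows
  \<open>(a, b)\<close> and \<open>(c, d)\<close>.\<close>

definition frame ::
  "(real^3 \<Rightarrow> real^3 \<Rightarrow> real^3) \<Rightarrow> real^3 \<Rightarrow> real^3 \<Rightarrow> real^3 \<Rightarrow> real \<Rightarrow> real \<Rightarrow> real \<Rightarrow> real \<Rightarrow> bool" where
  "frame br e u v a b c d \<longleftrightarrow> indep3 e u v \<and> br e u = a *\<^sub>R u + c *\<^sub>R v \<and> br e v = b *\<^sub>R u + d *\<^sub>R v \<and> br u v = 0"

locale lie_algebra3 =
  fixes br :: "real^3 \<Rightarrow> real^3 \<Rightarrow> real^3"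
  assumes lie: "lie_bracket br"
begin

lemma bil: "bilinear br" and alt [simp]: "br x x = 0"
  and jacobi: "br x (br y z) + br y (br z x) + br z (br x y) = 0"
  using lie by (auto simp: lie_bracket_def)

lemmas bsimps = bilinear_ladd[OF bil] bilinear_radd[OF bil] bilinear_lmul[OF bil] bilinear_rmul[OF bil]
  bilinear_lsub[OF bil] bilinear_rsub[OF bil] bilinear_lneg[OF bil] bilinear_rneg[OF bil]
  bilinear_lzero[OF bil] bilinear_rzero[OF bil]

lemmas skew = alternating_skew[OF bil alt]

lemma lin: "linear (br x)" "linear (\<lambda>x. br x y)"
  using bil by (auto simp: bilinear_def)

definition tr :: "real^3 \<Rightarrow> real" where "tr x = ftrace (br x)"

lemma kernel_eq: "unimodular_kernel br = {x. tr x = 0}"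
  by (simp add: unimodular_kernel_def tr_def trace_matrix)

lemma tr_linear: "linear tr"
  unfolding tr_def by (rule linearI) (simp_all add: ftrace_def bsimps inner_add_left sum.distrib sum_distrib_left)

text \<open>\<open>ad\<close> of a bracket is a commutator.\<close>

lemma tr_br: "tr (br x y) = 0"
proof -
  have "br (br x y) z = br x (br y z) - br y (br x z)" for z
    using jacobi[of x y z] skew[of z x] skew[of z "br x y"] by (simp add: bsimps algebra_simps)
  then have "br (br x y) = (\<lambda>z. br x (br y z) - br y (br x z))" by (rule ext)
  then show ?thesis
    unfolding tr_def using ftrace_comp_commute[OF lin(1)[of x] lin(1)[of y]] by (simp add: ftrace_diff)
qed

lemma ftrace_coordinates:
  fixes \<phi>0 \<phi>1 \<phi>2 :: "real^3 \<Rightarrow> real"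
  assumes "linear L" "linear \<phi>0" "linear \<phi>1" "linear \<phi>2"
    "\<And>x. x = \<phi>0 x *\<^sub>R e + \<phi>1 x *\<^sub>R u + \<phi>2 x *\<^sub>R v"
  shows "ftrace L = \<phi>0 (L e) + \<phi>1 (L u) + \<phi>2 (L v)"
proof -
  have "L x = \<phi>0 x *\<^sub>R L e + \<phi>1 x *\<^sub>R L u + \<phi>2 x *\<^sub>R L v" for x
    using arg_cong[OF assms(5)[of x], of L]
    by (simp only: linear_add[OF assms(1)] linear_scale[OF assms(1)])
  then have "L = (\<lambda>x. \<phi>0 x *\<^sub>R L e + \<phi>1 x *\<^sub>R L u + \<phi>2 x *\<^sub>R L v)" by (rule ext)
  then have "ftrace L = ftrace (\<lambda>x. \<phi>0 x *\<^sub>R L e + \<phi>1 x *\<^sub>R L u + \<phi>2 x *\<^sub>R L v)" by simp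
  also have "\<dots> = \<phi>0 (L e) + \<phi>1 (L u) + \<phi>2 (L v)"
    by (simp add: ftrace_add ftrace_rank_one assms(2-4))
  finally show ?thesis .
qed

text \<open>Two elements of the kernel commute: their bracket is in the kernel, and its coefficients are traces
  of \<open>ad\<^sub>u\<close> and \<open>ad\<^sub>v\<close>.\<close>

lemma frame_exists:
  assumes e: "tr e \<noteq> 0" and uv: "tr u = 0" "tr v = 0" and ind: "\<And>s t. s *\<^sub>R u + t *\<^sub>R v = 0 \<Longrightarrow> s = 0 \<and> t = 0"
  obtains a b c d where "frame br e u v a b c d" "a + d \<noteq> 0"
proof -
  have i3: "indep3 e u v"
    unfolding indep3_def
  proof (intro allI impI)
    fix r s t assume z: "r *\<^sub>R e + s *\<^sub>R u + t *\<^sub>R v = 0"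
    have "tr (r *\<^sub>R e + s *\<^sub>R u + t *\<^sub>R v) = r * tr e"
      by (simp add: uv linear_add[OF tr_linear] linear_scale[OF tr_linear])
    then have "r = 0" using e by (simp add: z linear_0[OF tr_linear])
    then show "r = 0 \<and> s = 0 \<and> t = 0" using ind[of s t] z by simp
  qed
  obtain \<phi>0 \<phi>1 \<phi>2 :: "real^3 \<Rightarrow> real" where l: "linear \<phi>0" "linear \<phi>1" "linear \<phi>2"
    and ex: "\<And>x. x = \<phi>0 x *\<^sub>R e + \<phi>1 x *\<^sub>R u + \<phi>2 x *\<^sub>R v"
    and "\<And>r s t. \<phi>0 (r *\<^sub>R e + s *\<^sub>R u + t *\<^sub>R v) = r" "\<And>r s t. \<phi>1 (r *\<^sub>R e + s *\<^sub>R u + t *\<^sub>R v) = s"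
      "\<And>r s t. \<phi>2 (r *\<^sub>R e + s *\<^sub>R u + t *\<^sub>R v) = t"
    using coordinates3[OF i3] by blast
  have tr0: "tr x = \<phi>0 x * tr e" for x
  proof -
    have "tr x = tr (\<phi>0 x *\<^sub>R e + \<phi>1 x *\<^sub>R u + \<phi>2 x *\<^sub>R v)" by (rule arg_cong[OF ex])
    then show ?thesis using uv by (simp add: linear_add[OF tr_linear] linear_scale[OF tr_linear])
  qed
  have br0: "\<phi>0 (br x y) = 0" for x y
  proof -
    have "\<phi>0 (br x y) * tr e = 0" using tr0[of "br x y", symmetric] unfolding tr_br .
    then show ?thesis using e by simp
  qed
  have brex: "br x y = \<phi>1 (br x y) *\<^sub>R u + \<phi>2 (br x y) *\<^sub>R v" for x y
    using ex[of "br x y"] unfolding br0 scaleR_zero_left add_0_left .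
  have trx: "tr x = \<phi>1 (br x u) + \<phi>2 (br x v)" for x
    unfolding tr_def using ftrace_coordinates[OF lin(1) l ex, of x] br0 by simp
  have "\<phi>2 (br u v) = 0" using trx[of u] uv by (simp add: linear_0[OF l(2)])
  moreover have "\<phi>1 (br u v) = 0"
    using trx[of v] uv skew[of v u] by (simp add: linear_0[OF l(3)] linear_neg[OF l(2)])
  ultimately have "br u v = 0" using brex[of u v] by (metis add_0_left scaleR_zero_left)
  then have "frame br e u v (\<phi>1 (br e u)) (\<phi>1 (br e v)) (\<phi>2 (br e u)) (\<phi>2 (br e v))"
    unfolding frame_def using i3 brex by blast
  moreover have "\<phi>1 (br e u) + \<phi>2 (br e v) \<noteq> 0" using e unfolding trx[of e] .
  ultimately show ?thesis using that by blast
qed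

lemma kernel_extend:
  assumes e: "tr e \<noteq> 0" and u: "tr u = 0"
  obtains v where "tr v = 0" "\<And>s t. s *\<^sub>R u + t *\<^sub>R v = 0 \<Longrightarrow> t = 0"
proof -
  have "span {e, u} \<noteq> UNIV"
  proof
    assume "span {e, u} = UNIV"
    then have "dim (span {e, u}) = DIM(real^3)" by simp
    then have "dim {e, u} = 3" by simp
    moreover have "dim {e, u} \<le> card {e, u}" by (rule dim_le_card') simp
    moreover have "card {e, u} \<le> 2" by (simp add: card_insert_if)
    ultimately show False by simp
  qed
  then obtain x where x: "x \<notin> span {e, u}" by blast
  define v where "v = x - (tr x / tr e) *\<^sub>R e"
  have "tr v = 0" using e by (simp add: v_def linear_diff[OF tr_linear] linear_scale[OF tr_linear])
  moreover have "t = 0" if z: "s *\<^sub>R u + t *\<^sub>R v = 0" for s t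
  proof (rule ccontr)
    assume t: "t \<noteq> 0"
    have "t *\<^sub>R v = - (s *\<^sub>R u)" using z by (simp add: eq_neg_iff_add_eq_0 add.commute)
    then have "v = (- s / t) *\<^sub>R u"
      using t by (metis divideR_right scaleR_minus_left scaleR_scaleR divide_inverse_commute)
    then have "x = (- s / t) *\<^sub>R u + (tr x / tr e) *\<^sub>R e" by (simp add: v_def algebra_simps)
    moreover have "\<dots> \<in> span {e, u}"
      by (intro span_add span_scale span_base) auto
    ultimately show False using x by simp
  qed
  ultimately show ?thesis using that by blast
qed

lemma frame_tr:
  assumes "frame br e u v a b c d"
  shows "tr (r *\<^sub>R e + s *\<^sub>R u + t *\<^sub>R v) = r * (a + d)"
proof -
  have i3: "indep3 e u v" and eu: "br e u = a *\<^sub>R u + c *\<^sub>R v" and ev: "br e v = b *\<^sub>R u + d *\<^sub>R v"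
    and uv: "br u v = 0" using assms by (auto simp: frame_def)
  obtain \<phi>0 \<phi>1 \<phi>2 :: "real^3 \<Rightarrow> real" where l: "linear \<phi>0" "linear \<phi>1" "linear \<phi>2"
    and ex: "\<And>x. x = \<phi>0 x *\<^sub>R e + \<phi>1 x *\<^sub>R u + \<phi>2 x *\<^sub>R v"
    and v: "\<And>r s t. \<phi>0 (r *\<^sub>R e + s *\<^sub>R u + t *\<^sub>R v) = r" "\<And>r s t. \<phi>1 (r *\<^sub>R e + s *\<^sub>R u + t *\<^sub>R v) = s"
      "\<And>r s t. \<phi>2 (r *\<^sub>R e + s *\<^sub>R u + t *\<^sub>R v) = t"
    using coordinates3[OF i3] by blast
  have vals: "\<phi>0 (s *\<^sub>R u + t *\<^sub>R v) = 0" "\<phi>1 (s *\<^sub>R u + t *\<^sub>R v) = s" "\<phi>2 (s *\<^sub>R u + t *\<^sub>R v) = t" for s t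
    using v(1)[of 0 s t] v(2)[of 0 s t] v(3)[of 0 s t] by simp_all
  have tr: "tr x = \<phi>0 (br x e) + \<phi>1 (br x u) + \<phi>2 (br x v)" for x
    unfolding tr_def by (rule ftrace_coordinates[OF lin(1) l ex])
  have ue: "br u e = (- a) *\<^sub>R u + (- c) *\<^sub>R v" and ve: "br v e = (- b) *\<^sub>R u + (- d) *\<^sub>R v"
    and vu: "br v u = 0"
    using skew[of u e] skew[of v e] skew[of v u] eu ev uv by simp_all
  have "tr e = a + d" unfolding tr[of e] eu ev vals alt linear_0[OF l(1)] by simp
  moreover have "tr u = 0"
    unfolding tr[of u] ue uv alt vals linear_0[OF l(2)] linear_0[OF l(3)] by simp
  moreover have "tr v = 0"
    unfolding tr[of v] ve vu alt vals linear_0[OF l(2)] linear_0[OF l(3)] by simp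
  ultimately show ?thesis
    by (simp add: linear_add[OF tr_linear] linear_scale[OF tr_linear])
qed

subsection \<open>Changes of frame\<close>

lemma frame_scale:
  assumes "frame br e u v a b c d" "k \<noteq> 0"
  shows "frame br (k *\<^sub>R e) u v (k * a) (k * b) (k * c) (k * d)"
proof -
  have "indep3 (k *\<^sub>R e) u v"
    using assms unfolding frame_def indep3_def by (metis mult_eq_0_iff scaleR_scaleR)
  then show ?thesis using assms(1) by (simp add: frame_def bsimps algebra_simps)
qed

lemma frame_flip:
  assumes "frame br e u v a b c d"
  shows "frame br e v u d c b a"
proof -
  have "indep3 e v u"
    unfolding indep3_def
  proof (intro allI impI)
    fix r s t assume "r *\<^sub>R e + s *\<^sub>R v + t *\<^sub>R u = 0"
    then have "r *\<^sub>R e + t *\<^sub>R u + s *\<^sub>R v = 0" by (simp only: add.assoc add.commute[of "s *\<^sub>R v"])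
    then have "r = 0 \<and> t = 0 \<and> s = 0" using assms unfolding frame_def indep3_def by blast
    then show "r = 0 \<and> s = 0 \<and> t = 0" by simp
  qed
  moreover have "br v u = 0" using assms skew[of v u] by (simp add: frame_def)
  ultimately show ?thesis using assms by (simp add: frame_def add.commute)
qed

lemma frame_shear:
  assumes "frame br e u v a b c d"
  shows "frame br e u (v + t *\<^sub>R u) (a - t * c) (b + t * a - t * d - t * t * c) c (d + t * c)"
proof -
  have "indep3 e u (v + t *\<^sub>R u)"
    unfolding indep3_def
  proof (intro allI impI)
    fix r s q assume "r *\<^sub>R e + s *\<^sub>R u + q *\<^sub>R (v + t *\<^sub>R u) = 0"
    then have "r *\<^sub>R e + (s + q * t) *\<^sub>R u + q *\<^sub>R v = 0" by (simp add: algebra_simps)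
    then have "r = 0 \<and> s + q * t = 0 \<and> q = 0" using assms unfolding frame_def indep3_def by blast
    then show "r = 0 \<and> s = 0 \<and> q = 0" by auto
  qed
  then show ?thesis using assms by (simp add: frame_def bsimps algebra_simps)
qed

lemma frame_diagonal:
  assumes "frame br e u v a b 0 d" "a \<noteq> d"
  obtains v' where "frame br e u v' a 0 0 d"
proof -
  have "b + (b / (d - a)) * a - (b / (d - a)) * d = 0" using assms(2) by (simp add: field_simps)
  then show ?thesis using that frame_shear[OF assms(1), of "b / (d - a)"] by simp
qed

lemma frame_isomorphic:
  assumes fr: "frame br e u v a b c d"
  shows "lie_isomorphic br (semidirect (vector [vector [a, b], vector [c, d]]))"
proof -
  have i3: "indep3 e u v" and eu: "br e u = a *\<^sub>R u + c *\<^sub>R v" and ev: "br e v = b *\<^sub>R u + d *\<^sub>R v"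
    and uv: "br u v = 0" using fr by (auto simp: frame_def)
  obtain \<phi>0 \<phi>1 \<phi>2 :: "real^3 \<Rightarrow> real" where l: "linear \<phi>0" "linear \<phi>1" "linear \<phi>2"
    and ex: "\<And>x. x = \<phi>0 x *\<^sub>R e + \<phi>1 x *\<^sub>R u + \<phi>2 x *\<^sub>R v"
    and v: "\<And>r s t. \<phi>0 (r *\<^sub>R e + s *\<^sub>R u + t *\<^sub>R v) = r" "\<And>r s t. \<phi>1 (r *\<^sub>R e + s *\<^sub>R u + t *\<^sub>R v) = s"
      "\<And>r s t. \<phi>2 (r *\<^sub>R e + s *\<^sub>R u + t *\<^sub>R v) = t"
    using coordinates3[OF i3] by blast
  define \<Phi> :: "real^3 \<Rightarrow> real \<times> (real^2)" where "\<Phi> = (\<lambda>x. (\<phi>0 x, vector [\<phi>1 x, \<phi>2 x]))"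
  have "linear \<Phi>"
    by (rule linearI) (simp_all add: \<Phi>_def linear_add[OF l(1)] linear_add[OF l(2)] linear_add[OF l(3)]
        linear_scale[OF l(1)] linear_scale[OF l(2)] linear_scale[OF l(3)] vec_eq_iff forall_2)
  moreover have "bij \<Phi>"
  proof (rule bij_betw_byWitness[where f' = "\<lambda>(r, w). r *\<^sub>R e + (w $ 1) *\<^sub>R u + (w $ 2) *\<^sub>R v"])
    show "\<forall>x\<in>UNIV. (case \<Phi> x of (r, w) \<Rightarrow> r *\<^sub>R e + w $ 1 *\<^sub>R u + w $ 2 *\<^sub>R v) = x"
      by (simp add: \<Phi>_def ex[symmetric])
  qed (auto simp: \<Phi>_def v vec_eq_iff forall_2)
  moreover have "\<Phi> (br x y) = semidirect (vector [vector [a, b], vector [c, d]]) (\<Phi> x) (\<Phi> y)" for x y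
  proof -
    have "br x y = br (\<phi>0 x *\<^sub>R e + \<phi>1 x *\<^sub>R u + \<phi>2 x *\<^sub>R v) (\<phi>0 y *\<^sub>R e + \<phi>1 y *\<^sub>R u + \<phi>2 y *\<^sub>R v)"
      by (rule arg_cong2[OF ex ex])
    also have "\<dots> = 0 *\<^sub>R e + (\<phi>0 x * (a * \<phi>1 y + b * \<phi>2 y) - \<phi>0 y * (a * \<phi>1 x + b * \<phi>2 x)) *\<^sub>R u
        + (\<phi>0 x * (c * \<phi>1 y + d * \<phi>2 y) - \<phi>0 y * (c * \<phi>1 x + d * \<phi>2 x)) *\<^sub>R v"
    proof -
      have r: "br u e = - (a *\<^sub>R u + c *\<^sub>R v)" "br v e = - (b *\<^sub>R u + d *\<^sub>R v)" "br v u = 0"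
        using skew[of u e] skew[of v e] skew[of v u] eu ev uv by simp_all
      show ?thesis by (simp add: bsimps eu ev uv r algebra_simps)
    qed
    finally have "\<Phi> (br x y) = (0, vector [\<phi>0 x * (a * \<phi>1 y + b * \<phi>2 y) - \<phi>0 y * (a * \<phi>1 x + b * \<phi>2 x),
        \<phi>0 x * (c * \<phi>1 y + d * \<phi>2 y) - \<phi>0 y * (c * \<phi>1 x + d * \<phi>2 x)])"
      by (simp only: \<Phi>_def v)
    then show ?thesis
      by (simp add: \<Phi>_def semidirect_def matrix_vector_mult_def sum_2 vec_eq_iff forall_2)
  qed
  ultimately show ?thesis unfolding lie_isomorphic_def by blast
qed

lemma isomorphic_frame:
  assumes "lie_isomorphic br (semidirect (vector [vector [a, b], vector [c, d]]))"
  obtains e u v where "frame br e u v a b c d"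
proof -
  let ?M = "vector [vector [a, b], vector [c, d]] :: real^2^2"
  obtain \<Phi> where lin: "linear \<Phi>" and bij: "bij \<Phi>" and hom: "\<And>x y. \<Phi> (br x y) = semidirect ?M (\<Phi> x) (\<Phi> y)"
    using assms unfolding lie_isomorphic_def by blast
  obtain e u v where \<Phi>: "\<Phi> e = (1, 0)" "\<Phi> u = (0, vector [1, 0])" "\<Phi> v = (0, vector [0, 1])"
    using bij by (metis bij_pointE)
  have inj: "\<Phi> x = \<Phi> y \<Longrightarrow> x = y" for x y using bij by (auto simp: bij_def inj_def)
  have lc: "\<Phi> (r *\<^sub>R e + s *\<^sub>R u + t *\<^sub>R v) = (r, vector [s, t])" for r s t
    by (simp add: linear_add[OF lin] linear_scale[OF lin] \<Phi> vec_eq_iff forall_2)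
  have "indep3 e u v"
    unfolding indep3_def
  proof (intro allI impI)
    fix r s t assume "r *\<^sub>R e + s *\<^sub>R u + t *\<^sub>R v = 0"
    then have "(r, vector [s, t] :: real^2) = 0" using lc[of r s t] linear_0[OF lin] by simp
    then show "r = 0 \<and> s = 0 \<and> t = 0" by (simp add: prod_eq_iff vec_eq_iff forall_2)
  qed
  moreover have "br e u = a *\<^sub>R u + c *\<^sub>R v"
    using lc[of 0 a c]
    by (intro inj) (simp add: hom \<Phi> semidirect_def matrix_vector_mult_def sum_2 vec_eq_iff forall_2)
  moreover have "br e v = b *\<^sub>R u + d *\<^sub>R v"
    using lc[of 0 b d]
    by (intro inj) (simp add: hom \<Phi> semidirect_def matrix_vector_mult_def sum_2 vec_eq_iff forall_2)
  moreover have "br u v = 0"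
    by (intro inj) (simp add: hom \<Phi> semidirect_def linear_0[OF lin] prod_eq_iff vec_eq_iff)
  ultimately show ?thesis using that by (simp add: frame_def)
qed

end

section \<open>The equations in a frame\<close>

definition tri :: "'a \<Rightarrow> 'a \<Rightarrow> 'a \<Rightarrow> 3 \<Rightarrow> 'a" where
  "tri x y z i = (if i = 1 then x else if i = 2 then y else z)"

lemma tri_simps [simp]: "tri x y z 1 = x" "tri x y z 2 = y" "tri x y z 3 = z"
  by (simp_all add: tri_def)

lemma linear_eq_on_basis:
  fixes f k :: "real^3 \<Rightarrow> 'b::real_vector"
  assumes "indep3 e u v" "linear f" "linear k" "\<And>x. x \<in> {e, u, v} \<Longrightarrow> f x = k x"
  shows "f x = k x"
proof -
  obtain r s t where "x = r *\<^sub>R e + s *\<^sub>R u + t *\<^sub>R v" by (rule indep3_span[OF assms(1)])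
  then show ?thesis
    by (simp add: linear_add[OF assms(2)] linear_scale[OF assms(2)] linear_add[OF assms(3)]
        linear_scale[OF assms(3)] assms(4))
qed

lemma bilinear_eq_on_basis:
  fixes f k :: "real^3 \<Rightarrow> real^3 \<Rightarrow> real"
  assumes "indep3 e u v" "bilinear f" "bilinear k" "\<And>x y. x \<in> {e, u, v} \<Longrightarrow> y \<in> {e, u, v} \<Longrightarrow> f x y = k x y"
  shows "f x y = k x y"
proof (rule linear_eq_on_basis[OF assms(1)])
  show "linear (f x)" "linear (k x)" using assms(2,3) by (simp_all add: bilinear_def)
  fix z assume z: "z \<in> {e, u, v}"
  show "f x z = k x z"
    by (rule linear_eq_on_basis[OF assms(1), of "\<lambda>x. f x z" "\<lambda>x. k x z"])
      (use assms(2-4) z in \<open>simp_all add: bilinear_def\<close>)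
qed

text \<open>The two-form vanishes on the ideal, as closed forms do (\<open>closed_frame\<close>). The three-form is
  normalised so that \<open>koszul_plus\<close> and \<open>koszul_minus\<close> contain \<open>h\<close> with coefficient one.\<close>

locale framed = lie_algebra3 br
  for br :: "real^3 \<Rightarrow> real^3 \<Rightarrow> real^3" +
  fixes e u v :: "real^3" and a b c d :: real
    and g F :: "real^3 \<Rightarrow> real^3 \<Rightarrow> real" and H :: "real^3 \<Rightarrow> real^3 \<Rightarrow> real^3 \<Rightarrow> real"
    and h p q :: real
  assumes fr: "frame br e u v a b c d"
    and g_bil: "bilinear g" and g_sym: "g x y = g y x"
    and H3: "three_form H" and F2: "two_form F"
    and Heuv: "H e u v = 2 * h" and Feu: "F e u = p" and Fev: "F e v = q" and Fuv: "F u v = 0"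
begin

lemma indep: "indep3 e u v" and eu: "br e u = a *\<^sub>R u + c *\<^sub>R v" and ev: "br e v = b *\<^sub>R u + d *\<^sub>R v"
  and uv: "br u v = 0"
  using fr by (auto simp: frame_def)

lemma br_table: "br e u = a *\<^sub>R u + c *\<^sub>R v" "br e v = b *\<^sub>R u + d *\<^sub>R v" "br u v = 0" "br v u = 0"
  "br u e = - (a *\<^sub>R u + c *\<^sub>R v)" "br v e = - (b *\<^sub>R u + d *\<^sub>R v)" "br e e = 0" "br u u = 0" "br v v = 0"
  using skew[of u e] skew[of v e] skew[of v u] eu ev uv by simp_all

lemma F_bil: "bilinear F" and F_alt: "F x x = 0"
  using F2 by (auto simp: two_form_def)

lemmas F_skew = alternating_skew[OF F_bil F_alt]

lemma F_table: "F e u = p" "F e v = q" "F u v = 0" "F v u = 0" "F u e = - p" "F v e = - q"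
  "F e e = 0" "F u u = 0" "F v v = 0"
  using F_skew[of u e] F_skew[of v e] F_skew[of v u] Feu Fev Fuv F_alt by simp_all

lemmas H_lin = three_form_linear[OF H3]

lemma H_zero: "H x x z = 0" "H x y y = 0" "H x y x = 0"
  using H3 by (auto simp: three_form_def)

lemmas H_swap = three_form_skew[OF H3]

lemma H_table: "H e u v = 2 * h" "H u e v = - 2 * h" "H e v u = - 2 * h" "H u v e = 2 * h" "H v e u = 2 * h"
  "H v u e = - 2 * h"
  using Heuv H_swap(1)[of u e v] H_swap(2)[of e v u] H_swap(2)[of u v e] H_swap(1)[of v e u] H_swap(1)[of v u e]
  by simp_all

lemmas G_simps = bilinear_ladd[OF g_bil] bilinear_radd[OF g_bil]
  bilinear_lmul[OF g_bil] bilinear_rmul[OF g_bil] bilinear_lneg[OF g_bil] bilinear_rneg[OF g_bil]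
  bilinear_lsub[OF g_bil] bilinear_rsub[OF g_bil] bilinear_lsub[OF F_bil] bilinear_rsub[OF F_bil]
  bilinear_lzero[OF g_bil] bilinear_rzero[OF g_bil] bilinear_ladd[OF F_bil] bilinear_radd[OF F_bil]
  bilinear_lmul[OF F_bil] bilinear_rmul[OF F_bil] bilinear_lneg[OF F_bil] bilinear_rneg[OF F_bil]
  linear_neg[OF H_lin(1)] linear_neg[OF H_lin(2)] linear_neg[OF H_lin(3)]
  linear_scale[OF H_lin(1)] linear_scale[OF H_lin(2)] linear_scale[OF H_lin(3)]
  linear_add[OF H_lin(1)] linear_add[OF H_lin(2)] linear_add[OF H_lin(3)]

lemmas components = koszul_plus_def koszul_minus_def koszul_def
  sum_3 br_table F_table H_table H_zero G_simps bsimps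

lemmas expand = ein_source_def ein_source0_def components

lemma koszul_linear: "linear (\<lambda>x. koszul br g x y z)" "linear (\<lambda>y. koszul br g x y z)" "linear (\<lambda>z. koszul br g x y z)"
  by (rule linearI; simp add: koszul_def bsimps G_simps field_simps)+

lemma equations_from_frame:
  assumes "\<And>x y. x \<in> {e, u, v} \<Longrightarrow> y \<in> {e, u, v} \<Longrightarrow>
      (\<Sum>k\<in>UNIV. koszul_plus br g H x y (b' k) * dp (b0 k)) + F x y * d0 = ein_source br g H F b0 b' x y"
    and "\<And>x y. x \<in> {e, u, v} \<Longrightarrow> y \<in> {e, u, v} \<Longrightarrow>
      (\<Sum>k\<in>UNIV. koszul_minus br g H y x (b' k) * dm (b0 k)) = ein_source br g H F b0 b' x y"
    and "\<And>x. x \<in> {e, u, v} \<Longrightarrow> (\<Sum>k\<in>UNIV. F x (b' k) * dp (b0 k)) = - ein_source0 br g H F b0 b' x"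
    and "\<And>x. x \<in> {e, u, v} \<Longrightarrow> (\<Sum>k\<in>UNIV. F x (b' k) * dm (b0 k)) = - ein_source0 br g H F b0 b' x"
  shows "einstein_equations br g H F b0 b' dp dm d0"
proof -
  note lin = linear_add[OF koszul_linear(1)] linear_add[OF koszul_linear(2)]
    linear_scale[OF koszul_linear(1)] linear_scale[OF koszul_linear(2)] G_simps
  have kp: "bilinear (\<lambda>x y. (\<Sum>k\<in>UNIV. koszul_plus br g H x y (b' k) * dp (b0 k)) + F x y * d0)"
    by (rule bilinearI) (simp_all add: koszul_plus_def lin sum_3 field_simps)
  have km: "bilinear (\<lambda>x y. \<Sum>k\<in>UNIV. koszul_minus br g H y x (b' k) * dm (b0 k))"
    by (rule bilinearI) (simp_all add: koszul_minus_def lin sum_3 field_simps)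
  have s: "bilinear (ein_source br g H F b0 b')"
    by (rule bilinearI) (simp_all add: ein_source_def koszul_minus_def koszul_plus_def lin sum_3 field_simps)
  have f: "linear (\<lambda>x. \<Sum>k\<in>UNIV. F x (b' k) * dd (b0 k))" for dd
    by (rule linearI) (simp_all add: lin sum_3 field_simps)
  have s0: "linear (\<lambda>x. - ein_source0 br g H F b0 b' x)"
    by (rule linearI) (simp_all add: ein_source0_def koszul_minus_def lin sum_3 field_simps)
  show ?thesis
    unfolding einstein_equations_def
    using bilinear_eq_on_basis[OF indep kp s assms(1)] bilinear_eq_on_basis[OF indep km s assms(2)]
      linear_eq_on_basis[OF indep f s0 assms(3)] linear_eq_on_basis[OF indep f s0 assms(4)] by blast
qed

lemma dual_from_frame:
  assumes "\<And>x. x \<in> {e, u, v} \<Longrightarrow> (\<Sum>i\<in>UNIV. g x (b' i) *\<^sub>R b0 i) = x"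
  shows "dual_bases g b0 b'"
proof -
  have "linear (\<lambda>x. \<Sum>i\<in>UNIV. g x (b' i) *\<^sub>R b0 i)"
    by (rule linearI) (simp_all add: G_simps sum_3 algebra_simps)
  from linear_eq_on_basis[OF indep this linear_ident assms] show ?thesis
    unfolding dual_bases_def by blast
qed

lemma pseudo_from_dual:
  assumes "dual_bases g b0 b'"
  shows "pseudo_metric g"
proof -
  have "x = 0" if "\<And>y. g x y = 0" for x
    using assms[unfolded dual_bases_def, rule_format, of x] that by simp
  then show ?thesis unfolding pseudo_metric_def using g_bil g_sym by blast
qed

end

text \<open>Normal forms of the metric: in the first kind of frame \<open>u\<close> spans the radical of \<open>g\<close> on the ideal; in
  the other two \<open>e\<close> is orthogonal to the ideal, where \<open>g\<close> is non-degenerate and \<open>u\<close> is not null or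
  null, respectively.\<close>

locale null_frame = framed +
  fixes \<epsilon> :: real
  assumes gram: "g e e = 0" "g e u = 1" "g e v = 0" "g u u = 0" "g u v = 0" "g v v = \<epsilon>"
    and eps: "\<epsilon> \<noteq> 0"
begin

lemma gram': "g u e = 1" "g v e = 0" "g v u = 0"
  using gram g_sym[of u e] g_sym[of v e] g_sym[of v u] by simp_all

abbreviation "b0 \<equiv> tri e u v"
abbreviation "b' \<equiv> tri u e ((1 / \<epsilon>) *\<^sub>R v)"

lemma dual: "dual_bases g b0 b'"
  using eps by (intro dual_from_frame) (auto simp: sum_3 G_simps gram gram')

text \<open>\<open>P\<close> and \<open>Q\<close> are the coefficients in \<open>\<nabla>\<^sup>+\<^bsub>u\<^esub> v = P u\<close> and \<open>\<nabla>\<^sup>-\<^bsub>u\<^esub> v = Q u\<close> for \<open>\<nabla>\<^sup>\<plusminus> = \<nabla> \<mp> H/2\<close>.\<close>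

lemma sources:
  defines "P \<equiv> c * \<epsilon> / 2 - h" and "Q \<equiv> c * \<epsilon> / 2 + h"
  shows "ein_source br g H F b0 b' u u = 0" "ein_source br g H F b0 b' u v = 0"
    "ein_source br g H F b0 b' v u = 0" "ein_source br g H F b0 b' v v = 2 * P * Q"
    "ein_source br g H F b0 b' u e = - (P\<^sup>2 + Q\<^sup>2) / \<epsilon> - p\<^sup>2"
    "ein_source br g H F b0 b' e u = - (P\<^sup>2 + Q\<^sup>2) / \<epsilon> - p\<^sup>2"
    "ein_source br g H F b0 b' v e = a * Q - d * P - p * q"
    "ein_source br g H F b0 b' e v = a * P - d * Q - p * q"
    "ein_source br g H F b0 b' e e = a\<^sup>2 + d\<^sup>2 + b * c + q\<^sup>2 / \<epsilon>"
    "ein_source0 br g H F b0 b' u = 0" "ein_source0 br g H F b0 b' v = 2 * Q * p"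
    "ein_source0 br g H F b0 b' e = a * p + (P - Q) * q / \<epsilon>"
  unfolding P_def Q_def using eps
  by (simp_all add: expand gram gram' field_simps power2_eq_square)

end

locale orth_frame = framed +
  fixes \<epsilon> \<phi> \<kappa> :: real
  assumes gram: "g e e = \<epsilon>" "g e u = 0" "g e v = 0" "g u u = \<phi>" "g u v = 0" "g v v = \<kappa>"
    and nz: "\<epsilon> \<noteq> 0" "\<phi> \<noteq> 0" "\<kappa> \<noteq> 0"
begin

lemma gram': "g u e = 0" "g v e = 0" "g v u = 0"
  using gram g_sym[of u e] g_sym[of v e] g_sym[of v u] by simp_all

abbreviation "b0 \<equiv> tri e u v"
abbreviation "b' \<equiv> tri ((1 / \<epsilon>) *\<^sub>R e) ((1 / \<phi>) *\<^sub>R u) ((1 / \<kappa>) *\<^sub>R v)"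

lemma dual: "dual_bases g b0 b'"
  using nz by (intro dual_from_frame) (auto simp: sum_3 G_simps gram gram')

lemma sources:
  "ein_source br g H F b0 b' e e
    = a\<^sup>2 + d\<^sup>2 + (c * \<kappa> + b * \<phi>)\<^sup>2 / (2 * \<phi> * \<kappa>) + 2 * h\<^sup>2 / (\<phi> * \<kappa>) + p\<^sup>2 / \<phi> + q\<^sup>2 / \<kappa>"
  "ein_source br g H F b0 b' u u
    = ((c * \<kappa> + b * \<phi>) * (c * \<kappa> - b * \<phi>) / (2 * \<kappa>) + 2 * h\<^sup>2 / \<kappa> + p\<^sup>2) / \<epsilon>"
  "ein_source br g H F b0 b' v v
    = (- (c * \<kappa> + b * \<phi>) * (c * \<kappa> - b * \<phi>) / (2 * \<phi>) + 2 * h\<^sup>2 / \<phi> + q\<^sup>2) / \<epsilon>"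
  "ein_source br g H F b0 b' u v = ((c * \<kappa> - b * \<phi>) * (d - a) / 2 + (a + d) * h + p * q) / \<epsilon>"
  "ein_source br g H F b0 b' v u = ((c * \<kappa> - b * \<phi>) * (d - a) / 2 - (a + d) * h + p * q) / \<epsilon>"
  "ein_source br g H F b0 b' e u = 0" "ein_source br g H F b0 b' u e = 0"
  "ein_source br g H F b0 b' e v = 0" "ein_source br g H F b0 b' v e = 0"
  "ein_source0 br g H F b0 b' e = 0"
  "ein_source0 br g H F b0 b' u = - (p * a + q / \<kappa> * (b * \<phi> - 2 * h)) / \<epsilon>"
  "ein_source0 br g H F b0 b' v = - (p / \<phi> * (c * \<kappa> + 2 * h) + q * d) / \<epsilon>"
  using nz by (simp_all add: expand gram gram' field_simps power2_eq_square)

text \<open>Here \<open>F(e, \<sqdot>) = g(u, \<sqdot>)\<close>. If \<open>A\<close> is \<open>ad\<^sub>e\<close> on the ideal and \<open>T\<close> the skew endomorphism with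
  \<open>g(T u, v) = h\<close>, then the equation on \<open>E\<^sub>- \<times> \<real>\<close> reads \<open>s u = - (A + 2 T) u\<close>; these are the first two
  conclusions. The last one is the skew part of the equations on the ideal.\<close>

lemma equations:
  assumes eq: "einstein_equations br g H F b0 b' dp dm d0" and pq: "p = \<phi>" "q = 0"
  defines "s \<equiv> dp e"
  shows "s = - a" "c * \<kappa> = - 2 * h"
    "2 * (a\<^sup>2 + d\<^sup>2) * \<phi> * \<kappa> + (c * \<kappa> + b * \<phi>)\<^sup>2 + 4 * h\<^sup>2 + 2 * \<phi>\<^sup>2 * \<kappa> = 0"
    "2 * s * a * \<phi> * \<kappa> = (c * \<kappa> + b * \<phi>) * (c * \<kappa> - b * \<phi>) + 4 * h\<^sup>2 + 2 * \<phi>\<^sup>2 * \<kappa>"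
    "2 * s * d * \<kappa> * \<phi> = - (c * \<kappa> + b * \<phi>) * (c * \<kappa> - b * \<phi>) + 4 * h\<^sup>2"
    "h * (s + a + d) = 0"
proof -
  have 1: "(\<Sum>k\<in>UNIV. koszul_plus br g H x y (b' k) * dp (b0 k)) + F x y * d0 = ein_source br g H F b0 b' x y" for x y
    using eq unfolding einstein_equations_def by blast
  have 3: "(\<Sum>k\<in>UNIV. F x (b' k) * dp (b0 k)) = - ein_source0 br g H F b0 b' x" for x
    using eq unfolding einstein_equations_def by blast
  have l: "(\<Sum>k\<in>UNIV. koszul_plus br g H e e (b' k) * dp (b0 k)) = 0"
    "(\<Sum>k\<in>UNIV. koszul_plus br g H u u (b' k) * dp (b0 k)) = s * a * \<phi> / \<epsilon>"
    "(\<Sum>k\<in>UNIV. koszul_plus br g H v v (b' k) * dp (b0 k)) = s * d * \<kappa> / \<epsilon>"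
    "(\<Sum>k\<in>UNIV. koszul_plus br g H u v (b' k) * dp (b0 k)) = s * ((c * \<kappa> + b * \<phi>) / 2 - h) / \<epsilon>"
    "(\<Sum>k\<in>UNIV. koszul_plus br g H v u (b' k) * dp (b0 k)) = s * ((c * \<kappa> + b * \<phi>) / 2 + h) / \<epsilon>"
    "(\<Sum>k\<in>UNIV. F u (b' k) * dp (b0 k)) = - p * s / \<epsilon>"
    "(\<Sum>k\<in>UNIV. F v (b' k) * dp (b0 k)) = - q * s / \<epsilon>"
    using nz by (simp_all add: expand gram gram' s_def[symmetric] field_simps)
  have "\<phi> * (s + a) = 0" using 3[of u] nz unfolding l sources by (simp add: pq field_simps)
  then show "s = - a" using nz by simp
  show "c * \<kappa> = - 2 * h" using 3[of v] nz unfolding l sources by (simp add: pq field_simps)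
  show "2 * (a\<^sup>2 + d\<^sup>2) * \<phi> * \<kappa> + (c * \<kappa> + b * \<phi>)\<^sup>2 + 4 * h\<^sup>2 + 2 * \<phi>\<^sup>2 * \<kappa> = 0"
    using 1[of e e] nz unfolding l sources by (simp add: pq F_table field_simps power2_eq_square)
  show "2 * s * a * \<phi> * \<kappa> = (c * \<kappa> + b * \<phi>) * (c * \<kappa> - b * \<phi>) + 4 * h\<^sup>2 + 2 * \<phi>\<^sup>2 * \<kappa>"
    using 1[of u u] nz unfolding l sources by (simp add: pq F_table field_simps power2_eq_square)
  show "2 * s * d * \<kappa> * \<phi> = - (c * \<kappa> + b * \<phi>) * (c * \<kappa> - b * \<phi>) + 4 * h\<^sup>2"
    using 1[of v v] nz unfolding l sources by (simp add: pq F_table field_simps power2_eq_square)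
  have "s * ((c * \<kappa> + b * \<phi>) / 2 - h) = (c * \<kappa> - b * \<phi>) * (d - a) / 2 + (a + d) * h"
    "s * ((c * \<kappa> + b * \<phi>) / 2 + h) = (c * \<kappa> - b * \<phi>) * (d - a) / 2 - (a + d) * h"
    using 1[of u v] 1[of v u] nz unfolding l sources by (simp_all add: pq F_table)
  then show "h * (s + a + d) = 0" by argo
qed

end

locale isotropic_frame = framed +
  fixes \<epsilon> :: real
  assumes gram: "g e e = \<epsilon>" "g e u = 0" "g e v = 0" "g u u = 0" "g u v = 1" "g v v = 0"
    and nz: "\<epsilon> \<noteq> 0"
begin

lemma gram': "g u e = 0" "g v e = 0" "g v u = 1"
  using gram g_sym[of u e] g_sym[of v e] g_sym[of v u] by simp_all

abbreviation "b0 \<equiv> tri e u v"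
abbreviation "b' \<equiv> tri ((1 / \<epsilon>) *\<^sub>R e) v u"

lemma dual: "dual_bases g b0 b'"
  using nz by (intro dual_from_frame) (auto simp: sum_3 G_simps gram gram')

lemma sources:
  assumes "p = 0" "q = 1"
  shows "ein_source br g H F b0 b' e e = (a + d)\<^sup>2 / 2 + 2 * b * c - 2 * h\<^sup>2"
    "ein_source br g H F b0 b' u u = c * (a - d) / \<epsilon>"
    "ein_source br g H F b0 b' v v = (1 - b * (a - d)) / \<epsilon>"
    "ein_source br g H F b0 b' u v = ((a + d) * h - 2 * h\<^sup>2) / \<epsilon>"
    "ein_source br g H F b0 b' v u = (- (a + d) * h - 2 * h\<^sup>2) / \<epsilon>"
    "ein_source br g H F b0 b' e u = 0" "ein_source br g H F b0 b' u e = 0"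
    "ein_source br g H F b0 b' e v = 0" "ein_source br g H F b0 b' v e = 0"
    "ein_source0 br g H F b0 b' e = 0" "ein_source0 br g H F b0 b' u = - c / \<epsilon>"
    "ein_source0 br g H F b0 b' v = - (a + 2 * h) / \<epsilon>"
  using nz assms by (simp_all add: expand gram gram' field_simps power2_eq_square)

text \<open>Again \<open>F(e, \<sqdot>) = g(u, \<sqdot>)\<close>, with \<open>u\<close> null, and \<open>s u = - (A + 2 T) u\<close> gives the first two
  conclusions.\<close>

lemma equations:
  assumes eq: "einstein_equations br g H F b0 b' dp dm d0" and pq: "p = 0" "q = 1"
  defines "s \<equiv> dp e"
  shows "c = 0" "s = - a - 2 * h" "(a + d)\<^sup>2 = 4 * h\<^sup>2" "h * (s + a + d) = 0"
proof -
  have 1: "(\<Sum>k\<in>UNIV. koszul_plus br g H x y (b' k) * dp (b0 k)) + F x y * d0 = ein_source br g H F b0 b' x y" for x y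
    using eq unfolding einstein_equations_def by blast
  have 3: "(\<Sum>k\<in>UNIV. F x (b' k) * dp (b0 k)) = - ein_source0 br g H F b0 b' x" for x
    using eq unfolding einstein_equations_def by blast
  have l: "(\<Sum>k\<in>UNIV. koszul_plus br g H e e (b' k) * dp (b0 k)) = 0"
    "(\<Sum>k\<in>UNIV. koszul_plus br g H u v (b' k) * dp (b0 k)) = s * ((a + d) / 2 - h) / \<epsilon>"
    "(\<Sum>k\<in>UNIV. koszul_plus br g H v u (b' k) * dp (b0 k)) = s * ((a + d) / 2 + h) / \<epsilon>"
    "(\<Sum>k\<in>UNIV. F u (b' k) * dp (b0 k)) = 0"
    "(\<Sum>k\<in>UNIV. F v (b' k) * dp (b0 k)) = - s / \<epsilon>"
    using nz by (simp_all add: expand gram gram' s_def[symmetric] pq field_simps)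
  show c: "c = 0" using 3[of u] nz unfolding l sources[OF pq] by (simp add: pq)
  show "s = - a - 2 * h" using 3[of v] nz unfolding l sources[OF pq] by (simp add: pq field_simps)
  show "(a + d)\<^sup>2 = 4 * h\<^sup>2" using 1[of e e] unfolding l sources[OF pq] by (simp add: pq F_table c)
  have "s * ((a + d) / 2 - h) = (a + d) * h - 2 * h\<^sup>2" "s * ((a + d) / 2 + h) = - (a + d) * h - 2 * h\<^sup>2"
    using 1[of u v] 1[of v u] nz unfolding l sources[OF pq] by (simp_all add: F_table)
  then show "h * (s + a + d) = 0" by argo
qed

end

section \<open>Adapted frames\<close>

text \<open>\<open>dF(e, u, v) = - (a + d) F(u, v)\<close>.\<close>

lemma closed_frame:
  assumes "frame br e u v a b c d" "two_form F" "closed_two_form br F" "a + d \<noteq> 0"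
  shows "F u v = 0"
proof -
  have bil: "bilinear F" and alt: "\<And>x. F x x = 0" using assms(2) by (auto simp: two_form_def)
  have skew: "F v u = - F u v" by (rule alternating_skew[OF bil alt])
  have br: "br e u = a *\<^sub>R u + c *\<^sub>R v" "br e v = b *\<^sub>R u + d *\<^sub>R v" "br u v = 0"
    using assms(1) by (auto simp: frame_def)
  have "- F (br e u) v + F (br e v) u - F (br u v) e = 0"
    using assms(3) unfolding closed_two_form_def by blast
  then have "- (a + d) * F u v = 0"
    unfolding br bilinear_ladd[OF bil] bilinear_lmul[OF bil] bilinear_lzero[OF bil]
    by (simp add: alt skew algebra_simps)
  then show ?thesis using assms(4) by simp
qed

lemma (in lie_algebra3) kernel_frame:
  assumes "frame br e u v a b c d" "a + d \<noteq> 0"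
  shows "unimodular_kernel br = {s *\<^sub>R u + t *\<^sub>R v | s t. True}"
  unfolding kernel_eq
proof (intro subset_antisym subsetI; clarify)
  have i3: "indep3 e u v" using assms(1) by (simp add: frame_def)
  fix x assume x: "tr x = 0"
  obtain r s t where e: "x = r *\<^sub>R e + s *\<^sub>R u + t *\<^sub>R v" by (rule indep3_span[OF i3])
  then have "r = 0" using x frame_tr[OF assms(1), of r s t] assms(2) by simp
  then show "\<exists>s t. x = s *\<^sub>R u + t *\<^sub>R v \<and> True" using e by auto
next
  fix s t show "tr (s *\<^sub>R u + t *\<^sub>R v) = 0"
    using frame_tr[OF assms(1), of 0 s t] by simp
qed

context lie_algebra3
begin

text \<open>A vector spanning the radical of \<open>g\<close> on the kernel is null, so it completes to a frame in which \<open>g\<close>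
  is a hyperbolic plane plus a line.\<close>

lemma null_frame_exists:
  assumes pg: "pseudo_metric g" and deg: "degenerate_on g (unimodular_kernel br)"
    and H: "three_form H" and F: "two_form F" "closed_two_form br F"
  obtains e u v a b c d h p q \<epsilon> where "null_frame br e u v a b c d g F H h p q \<epsilon>" "a + d \<noteq> 0"
proof -
  have bil: "bilinear g" and sym: "\<And>x y. g x y = g y x" and nd: "\<And>x. (\<And>y. g x y = 0) \<Longrightarrow> x = 0"
    using pg by (auto simp: pseudo_metric_def)
  note gs = bilinear_ladd[OF bil] bilinear_radd[OF bil] bilinear_lmul[OF bil] bilinear_rmul[OF bil]
    bilinear_lsub[OF bil] bilinear_rsub[OF bil] bilinear_lzero[OF bil] bilinear_rzero[OF bil]
  obtain u where u: "tr u = 0" "u \<noteq> 0" and rad: "\<And>y. tr y = 0 \<Longrightarrow> g u y = 0"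
    using deg unfolding degenerate_on_def kernel_eq by blast
  obtain e1 where "g u e1 \<noteq> 0" using nd[of u] u(2) by blast
  define e2 where "e2 = (1 / g u e1) *\<^sub>R e1"
  have ue2: "g u e2 = 1" using \<open>g u e1 \<noteq> 0\<close> by (simp add: e2_def gs)
  then have tre2: "tr e2 \<noteq> 0" using rad[of e2] by auto
  obtain v where v: "tr v = 0" and uv0: "\<And>s t. s *\<^sub>R u + t *\<^sub>R v = 0 \<Longrightarrow> t = 0"
    using kernel_extend[OF tre2 u(1)] by blast
  have guv: "g u v = 0" "g u u = 0" using rad u(1) v by simp_all
  have ind: "s = 0 \<and> t = 0" if "s *\<^sub>R u + t *\<^sub>R v = 0" for s t
    using uv0[OF that] that u(2) by auto
  have vv: "g v v \<noteq> 0"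
  proof
    assume z: "g v v = 0"
    obtain a b c d where fr: "frame br e2 u v a b c d" "a + d \<noteq> 0"
      using frame_exists[OF tre2 u(1) v ind] by blast
    \<comment> \<open>If the ideal were totally isotropic, \<open>w\<close> would be orthogonal to \<open>e2\<close> as well.\<close>
    define w where "w = v - g v e2 *\<^sub>R u"
    have w0: "g w e2 = 0" "g w u = 0" "g w v = 0"
      using guv z ue2 sym[of v u] by (simp_all add: w_def gs)
    have i3: "indep3 e2 u v" using fr(1) by (simp add: frame_def)
    have "g w y = 0" for y
    proof -
      obtain r s t where "y = r *\<^sub>R e2 + s *\<^sub>R u + t *\<^sub>R v" by (rule indep3_span[OF i3])
      then show ?thesis using w0 by (simp add: gs)
    qed
    then have "w = 0" by (rule nd)
    then show False using ind[of "- g v e2" 1] by (simp add: w_def)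
  qed
  \<comment> \<open>Make \<open>e\<close> orthogonal to \<open>v\<close>, then null; both corrections lie in the ideal.\<close>
  define e3 where "e3 = e2 - (g e2 v / g v v) *\<^sub>R v"
  define e where "e = e3 - (g e3 e3 / 2) *\<^sub>R u"
  have e3: "g e3 v = 0" "g u e3 = 1" "g e3 u = 1"
    using vv guv ue2 sym[of e2 u] sym[of v u] by (simp_all add: e3_def gs)
  have e: "g e e = 0" "g e u = 1" "g e v = 0"
    using e3 guv by (simp_all add: e_def gs)
  have "tr e = tr e2"
    using u(1) v by (simp add: e_def e3_def linear_diff[OF tr_linear] linear_scale[OF tr_linear])
  then have "tr e \<noteq> 0" using tre2 by simp
  obtain a b c d where fr: "frame br e u v a b c d" "a + d \<noteq> 0"
    using frame_exists[OF \<open>tr e \<noteq> 0\<close> u(1) v ind] by blast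
  have "null_frame br e u v a b c d g F H (H e u v / 2) (F e u) (F e v) (g v v)"
  proof (unfold_locales)
    show "g x y = g y x" for x y by (rule sym)
  qed (simp_all add: fr(1) bil H F closed_frame[OF fr(1) F fr(2)] e guv vv)
  then show ?thesis using that fr(2) by blast
qed

text \<open>The vectors dual to \<open>tr \<circ> ad\<close> and to \<open>F(e, \<sqdot>)\<close> serve as \<open>e\<close> and \<open>u\<close>.\<close>

lemma nondegenerate_frame_exists:
  assumes pg: "pseudo_metric g" and nd_ker: "\<not> degenerate_on g (unimodular_kernel br)"
    and nu: "unimodular_kernel br \<noteq> UNIV"
    and H: "three_form H" and F: "two_form F" "closed_two_form br F" and F0: "F \<noteq> (\<lambda>x y. 0)"
  obtains e u v a b c d h \<epsilon> \<phi> \<kappa> where "orth_frame br e u v a b c d g F H h \<phi> 0 \<epsilon> \<phi> \<kappa>" "a + d \<noteq> 0"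
  | e u v a b c d h \<epsilon> where "isotropic_frame br e u v a b c d g F H h 0 1 \<epsilon>" "a + d \<noteq> 0"
proof -
  have bil: "bilinear g" and sym: "\<And>x y. g x y = g y x" and nd: "\<And>x. (\<And>y. g x y = 0) \<Longrightarrow> x = 0"
    using pg by (auto simp: pseudo_metric_def)
  have Fbil: "bilinear F" and Falt: "\<And>x. F x x = 0" using F(1) by (auto simp: two_form_def)
  note gs = bilinear_ladd[OF bil] bilinear_radd[OF bil] bilinear_lmul[OF bil] bilinear_rmul[OF bil]
    bilinear_lsub[OF bil] bilinear_rsub[OF bil] bilinear_lzero[OF bil] bilinear_rzero[OF bil]
  have ndU: "x = 0" if "tr x = 0" "\<And>y. tr y = 0 \<Longrightarrow> g x y = 0" for x
    using nd_ker that unfolding degenerate_on_def kernel_eq by blast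
  obtain e where e: "\<And>y. g e y = tr y" using pseudo_metric_riesz[OF pg tr_linear] by blast
  have "e \<noteq> 0"
  proof
    assume "e = 0"
    then have "tr y = 0" for y using e[of y] by (simp add: gs)
    then show False using nu unfolding kernel_eq by blast
  qed
  have tre: "tr e \<noteq> 0"
    using ndU[of e] e \<open>e \<noteq> 0\<close> by auto
  have "linear (F e)" using Fbil by (simp add: bilinear_def)
  then obtain u where u: "\<And>y. g u y = F e y" using pseudo_metric_riesz[OF pg] by blast
  have tru: "tr u = 0" using e[of u] u[of e] sym[of e u] Falt[of e] by simp
  have gram0: "g e e \<noteq> 0" "g e y = 0" if "tr y = 0" for y
    using tre e that by simp_all
  have u0: "u \<noteq> 0"
  proof
    assume "u = 0"
    then have Fe: "F e y = 0" for y using u[of y] by (simp add: gs)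
    obtain v1 where v1: "tr v1 = 0" "\<And>s t. s *\<^sub>R 0 + t *\<^sub>R v1 = 0 \<Longrightarrow> t = 0"
      using kernel_extend[OF tre, of 0] by (auto simp: linear_0[OF tr_linear])
    obtain v2 where v2: "tr v2 = 0" "\<And>s t. s *\<^sub>R v1 + t *\<^sub>R v2 = 0 \<Longrightarrow> t = 0"
      using kernel_extend[OF tre v1(1)] by blast
    have ind: "s = 0 \<and> t = 0" if "s *\<^sub>R v1 + t *\<^sub>R v2 = 0" for s t
      using v2(2)[OF that] that v1(2)[of 0 s] by simp
    obtain a b c d where fr: "frame br e v1 v2 a b c d" "a + d \<noteq> 0"
      using frame_exists[OF tre v1(1) v2(1) ind] by blast
    have F12: "F v1 v2 = 0" by (rule closed_frame[OF fr(1) F fr(2)])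
    note sk = alternating_skew[OF Fbil Falt]
    have "F v1 e = 0" "F v2 e = 0" using sk[of v1 e] sk[of v2 e] Fe by simp_all
    moreover have "F v2 v1 = 0" using sk[of v2 v1] F12 by simp
    ultimately have "F x y = 0" if "x \<in> {e, v1, v2}" "y \<in> {e, v1, v2}" for x y
      using that Fe Falt F12 by auto
    moreover have "bilinear (\<lambda>x y :: real^3. 0 :: real)" by (rule bilinearI) simp_all
    ultimately have "F x y = 0" for x y
      using bilinear_eq_on_basis[OF _ Fbil, of e v1 v2 "\<lambda>x y. 0"] fr(1) unfolding frame_def by blast
    then show False using F0 by blast
  qed
  show thesis
  proof (cases "g u u = 0")
    case False
    obtain v1 where v1: "tr v1 = 0" "\<And>s t. s *\<^sub>R u + t *\<^sub>R v1 = 0 \<Longrightarrow> t = 0"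
      using kernel_extend[OF tre tru] by blast
    define v where "v = v1 - (g u v1 / g u u) *\<^sub>R u"
    have trv: "tr v = 0" by (simp add: v_def v1 tru linear_diff[OF tr_linear] linear_scale[OF tr_linear])
    have ind: "s = 0 \<and> t = 0" if "s *\<^sub>R u + t *\<^sub>R v = 0" for s t
    proof -
      have "(s - t * (g u v1 / g u u)) *\<^sub>R u + t *\<^sub>R v1 = 0"
        using that by (simp add: v_def algebra_simps)
      then have "t = 0" by (rule v1(2))
      then show ?thesis using that u0 by simp
    qed
    obtain a b c d where fr: "frame br e u v a b c d" "a + d \<noteq> 0"
      using frame_exists[OF tre tru trv ind] by blast
    have guv: "g u v = 0" using False by (simp add: v_def gs)
    have "g v v \<noteq> 0"
    proof
      assume z: "g v v = 0"
      have "v = 0"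
      proof (rule ndU[OF trv])
        fix y assume "tr y = 0"
        then obtain s t where "y = s *\<^sub>R u + t *\<^sub>R v"
          using kernel_frame[OF fr] unfolding kernel_eq by blast
        then show "g v y = 0" using z guv sym[of v u] by (simp add: gs)
      qed
      then show False using ind[of 0 1] by simp
    qed
    then have "orth_frame br e u v a b c d g F H (H e u v / 2) (g u u) 0 (g e e) (g u u) (g v v)"
    proof (unfold_locales)
      show "g x y = g y x" for x y by (rule sym)
    qed (simp_all add: fr(1) bil H F closed_frame[OF fr(1) F fr(2)] False gram0(1)[OF tru]
        gram0(2)[OF tru] gram0(2)[OF trv] guv u[symmetric])
    then show thesis using that(1) fr(2) by blast
  next
    case True
    obtain w where w: "tr w = 0" "g u w \<noteq> 0" using ndU[OF tru] u0 by blast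
    define w' where "w' = (1 / g u w) *\<^sub>R w"
    define v where "v = w' - (g w' w' / 2) *\<^sub>R u"
    have w': "g u w' = 1" "g w' u = 1" using w sym[of w' u] by (simp_all add: w'_def gs)
    have trv: "tr v = 0"
      by (simp add: v_def w'_def w tru linear_diff[OF tr_linear] linear_scale[OF tr_linear])
    have guv: "g u v = 1" "g v v = 0" using True w' by (simp_all add: v_def gs)
    have ind: "s = 0 \<and> t = 0" if "s *\<^sub>R u + t *\<^sub>R v = 0" for s t
    proof -
      have "g u (s *\<^sub>R u + t *\<^sub>R v) = t" using True guv by (simp add: gs)
      then have "t = 0" using that by (simp add: gs)
      then show ?thesis using that u0 by simp
    qed
    obtain a b c d where fr: "frame br e u v a b c d" "a + d \<noteq> 0"
      using frame_exists[OF tre tru trv ind] by blast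
    have "isotropic_frame br e u v a b c d g F H (H e u v / 2) 0 1 (g e e)"
    proof (unfold_locales)
      show "g x y = g y x" for x y by (rule sym)
    qed (simp_all add: fr(1) bil H F closed_frame[OF fr(1) F fr(2)] True gram0(1)[OF tru]
        gram0(2)[OF tru] gram0(2)[OF trv] guv u[symmetric])
    then show thesis using that(2) fr(2) by blast
  qed
qed

lemma frame_degenerate:
  assumes "frame br e u v a b c d" "a + d \<noteq> 0" "bilinear g" "g u u = 0" "g u v = 0"
  shows "degenerate_on g (unimodular_kernel br)"
proof -
  have "u \<noteq> 0"
  proof
    assume "u = 0"
    then have "0 *\<^sub>R e + 1 *\<^sub>R u + 0 *\<^sub>R v = 0" by simp
    then have "(1::real) = 0" using assms(1) unfolding frame_def indep3_def by blast
    then show False by simp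
  qed
  moreover have "u \<in> unimodular_kernel br"
    unfolding kernel_frame[OF assms(1,2)] by (intro CollectI exI[of _ 1] exI[of _ 0]) simp
  moreover have "g u y = 0" if "y \<in> unimodular_kernel br" for y
    using that assms(4,5) unfolding kernel_frame[OF assms(1,2)]
    by (auto simp: bilinear_radd[OF assms(3)] bilinear_rmul[OF assms(3)])
  ultimately show ?thesis unfolding degenerate_on_def by blast
qed

lemma frame_nondegenerate:
  assumes "frame br e u v a b c d" "a + d \<noteq> 0" "bilinear g" "g u v = g v u"
    "g u u * g v v - g u v * g u v \<noteq> 0"
  shows "\<not> degenerate_on g (unimodular_kernel br)"
proof
  assume "degenerate_on g (unimodular_kernel br)"
  then obtain x where x: "x \<in> unimodular_kernel br" "x \<noteq> 0" "\<And>y. y \<in> unimodular_kernel br \<Longrightarrow> g x y = 0"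
    unfolding degenerate_on_def by blast
  obtain s t where st: "x = s *\<^sub>R u + t *\<^sub>R v"
    using x(1) unfolding kernel_frame[OF assms(1,2)] by blast
  have "u \<in> unimodular_kernel br" "v \<in> unimodular_kernel br"
    unfolding kernel_frame[OF assms(1,2)]
    by (intro CollectI exI[of _ 1] exI[of _ 0], simp) (intro CollectI exI[of _ 0] exI[of _ 1], simp)
  then have "s * g u u + t * g u v = 0" "s * g u v + t * g v v = 0"
    using x(3)[of u] x(3)[of v] assms(4)
    by (simp_all add: st bilinear_ladd[OF assms(3)] bilinear_lmul[OF assms(3)])
  then have "s * (g u u * g v v - g u v * g u v) = 0" "t * (g u u * g v v - g u v * g u v) = 0"
    by algebra+
  then have "s = 0" "t = 0" using assms(5) by simp_all
  then show False using x(2) st by simp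
qed

text \<open>In coordinates, \<open>F = e\<^sup>* \<and> \<alpha>\<close> with \<open>\<alpha> = p u\<^sup>* + q v\<^sup>*\<close>; it is closed because brackets lie in the ideal
  and involve \<open>e\<close>.\<close>

lemma forms_exist:
  fixes gee geu gev guu guv gvv h p q :: real
  assumes fr: "frame br e u v a b c d"
  obtains g H F where "bilinear g" "\<And>x y. g x y = g y x" "g e e = gee" "g e u = geu" "g e v = gev"
    "g u u = guu" "g u v = guv" "g v v = gvv" "three_form H" "H e u v = 2 * h"
    "two_form F" "closed_two_form br F" "F e u = p" "F e v = q" "F u v = 0"
proof -
  have i3: "indep3 e u v" and eu: "br e u = a *\<^sub>R u + c *\<^sub>R v" and ev: "br e v = b *\<^sub>R u + d *\<^sub>R v"
    and uv: "br u v = 0" using fr by (auto simp: frame_def)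
  have r: "br u e = - (a *\<^sub>R u + c *\<^sub>R v)" "br v e = - (b *\<^sub>R u + d *\<^sub>R v)" "br v u = 0"
    using skew[of u e] skew[of v e] skew[of v u] eu ev uv by simp_all
  obtain \<phi>0 \<phi>1 \<phi>2 :: "real^3 \<Rightarrow> real" where l: "linear \<phi>0" "linear \<phi>1" "linear \<phi>2"
    and ex: "\<And>x. x = \<phi>0 x *\<^sub>R e + \<phi>1 x *\<^sub>R u + \<phi>2 x *\<^sub>R v"
    and v: "\<And>r s t. \<phi>0 (r *\<^sub>R e + s *\<^sub>R u + t *\<^sub>R v) = r" "\<And>r s t. \<phi>1 (r *\<^sub>R e + s *\<^sub>R u + t *\<^sub>R v) = s"
      "\<And>r s t. \<phi>2 (r *\<^sub>R e + s *\<^sub>R u + t *\<^sub>R v) = t"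
    using coordinates3[OF i3] by blast
  have vals: "\<phi>0 e = 1" "\<phi>1 e = 0" "\<phi>2 e = 0" "\<phi>0 u = 0" "\<phi>1 u = 1" "\<phi>2 u = 0" "\<phi>0 v = 0" "\<phi>1 v = 0" "\<phi>2 v = 1"
    using v[of 1 0 0] v[of 0 1 0] v[of 0 0 1] by simp_all
  have coord_br: "\<phi>0 (br x y) = 0" "\<phi>1 (br x y) = \<phi>0 x * (a * \<phi>1 y + b * \<phi>2 y) - \<phi>0 y * (a * \<phi>1 x + b * \<phi>2 x)"
    "\<phi>2 (br x y) = \<phi>0 x * (c * \<phi>1 y + d * \<phi>2 y) - \<phi>0 y * (c * \<phi>1 x + d * \<phi>2 x)" for x y
  proof -
    have "br x y = br (\<phi>0 x *\<^sub>R e + \<phi>1 x *\<^sub>R u + \<phi>2 x *\<^sub>R v) (\<phi>0 y *\<^sub>R e + \<phi>1 y *\<^sub>R u + \<phi>2 y *\<^sub>R v)"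
      by (rule arg_cong2[OF ex ex])
    also have "\<dots> = 0 *\<^sub>R e + (\<phi>0 x * (a * \<phi>1 y + b * \<phi>2 y) - \<phi>0 y * (a * \<phi>1 x + b * \<phi>2 x)) *\<^sub>R u
        + (\<phi>0 x * (c * \<phi>1 y + d * \<phi>2 y) - \<phi>0 y * (c * \<phi>1 x + d * \<phi>2 x)) *\<^sub>R v"
      by (simp add: bsimps eu ev uv r algebra_simps)
    finally show "\<phi>0 (br x y) = 0" "\<phi>1 (br x y) = \<phi>0 x * (a * \<phi>1 y + b * \<phi>2 y) - \<phi>0 y * (a * \<phi>1 x + b * \<phi>2 x)"
      "\<phi>2 (br x y) = \<phi>0 x * (c * \<phi>1 y + d * \<phi>2 y) - \<phi>0 y * (c * \<phi>1 x + d * \<phi>2 x)"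
      by (simp_all only: v)
  qed
  note ls = linear_add[OF l(1)] linear_add[OF l(2)] linear_add[OF l(3)]
    linear_scale[OF l(1)] linear_scale[OF l(2)] linear_scale[OF l(3)]
  define g where "g = (\<lambda>x y. gee * \<phi>0 x * \<phi>0 y + geu * (\<phi>0 x * \<phi>1 y + \<phi>1 x * \<phi>0 y)
      + gev * (\<phi>0 x * \<phi>2 y + \<phi>2 x * \<phi>0 y) + guu * \<phi>1 x * \<phi>1 y + guv * (\<phi>1 x * \<phi>2 y + \<phi>2 x * \<phi>1 y)
      + gvv * \<phi>2 x * \<phi>2 y)"
  define F where "F = (\<lambda>x y. p * (\<phi>0 x * \<phi>1 y - \<phi>1 x * \<phi>0 y) + q * (\<phi>0 x * \<phi>2 y - \<phi>2 x * \<phi>0 y))"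
  define H where "H = (\<lambda>x y z. 2 * h * (\<phi>0 x * (\<phi>1 y * \<phi>2 z - \<phi>2 y * \<phi>1 z)
      - \<phi>1 x * (\<phi>0 y * \<phi>2 z - \<phi>2 y * \<phi>0 z) + \<phi>2 x * (\<phi>0 y * \<phi>1 z - \<phi>1 y * \<phi>0 z)))"
  show thesis
  proof (rule that[of g H F])
    show "bilinear g" by (rule bilinearI) (simp_all add: g_def ls algebra_simps)
    show "two_form F" unfolding two_form_def
      by (intro conjI bilinearI) (simp_all add: F_def ls algebra_simps)
    show "three_form H" unfolding three_form_def
      by (intro conjI allI linearI) (simp_all add: H_def ls algebra_simps)
    show "closed_two_form br F"
      unfolding closed_two_form_def by (simp add: F_def coord_br algebra_simps)
  qed (simp_all add: g_def H_def F_def vals algebra_simps)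
qed

lemma functional_exists:
  fixes s0 s1 s2 :: real
  assumes "frame br e u v a b c d"
  obtains dp :: "real^3 \<Rightarrow> real" where "linear dp" "dp e = s0" "dp u = s1" "dp v = s2"
proof -
  obtain \<phi>0 \<phi>1 \<phi>2 :: "real^3 \<Rightarrow> real" where l: "linear \<phi>0" "linear \<phi>1" "linear \<phi>2"
    and ex: "\<And>x. x = \<phi>0 x *\<^sub>R e + \<phi>1 x *\<^sub>R u + \<phi>2 x *\<^sub>R v"
    and v: "\<And>r s t. \<phi>0 (r *\<^sub>R e + s *\<^sub>R u + t *\<^sub>R v) = r" "\<And>r s t. \<phi>1 (r *\<^sub>R e + s *\<^sub>R u + t *\<^sub>R v) = s"
      "\<And>r s t. \<phi>2 (r *\<^sub>R e + s *\<^sub>R u + t *\<^sub>R v) = t"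
    using coordinates3[of e u v] assms unfolding frame_def by blast
  have vals: "\<phi>0 e = 1" "\<phi>1 e = 0" "\<phi>2 e = 0" "\<phi>0 u = 0" "\<phi>1 u = 1" "\<phi>2 u = 0" "\<phi>0 v = 0" "\<phi>1 v = 0" "\<phi>2 v = 1"
    using v[of 1 0 0] v[of 0 1 0] v[of 0 0 1] by simp_all
  show thesis
    by (rule that[of "\<lambda>x. s0 * \<phi>0 x + s1 * \<phi>1 x + s2 * \<phi>2 x"])
      (auto simp: vals linear_iff linear_add[OF l(1)] linear_add[OF l(2)] linear_add[OF l(3)]
        linear_scale[OF l(1)] linear_scale[OF l(2)] linear_scale[OF l(3)] algebra_simps)
qed

end

section \<open>Solutions\<close>

context lie_algebra3
begin

text \<open>If the radical of \<open>g\<close> on the ideal is an eigenspace of \<open>ad\<^sub>e\<close>, then \<open>H = 0\<close>, \<open>F = q e\<^sup>* \<and> v\<^sup>*\<close> and a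
  divergence with the only component \<open>s = \<delta>(e)\<close> leave one equation, the one on \<open>(e, e)\<close>.\<close>

lemma isotropic_kernel_solution:
  fixes \<A> :: "('p::topological_space, real^3) chart set"
  assumes lf: "lie_frame \<A> br \<rho>" and fr: "frame br e u v a b 0 d" and tr: "a + d \<noteq> 0"
    and \<epsilon>: "\<epsilon> \<noteq> 0" and q: "q \<noteq> 0" and s: "- a * s = a\<^sup>2 + d\<^sup>2 + q\<^sup>2 / \<epsilon>"
  obtains g \<delta> where "odd_einstein_metric \<A> \<rho> br g \<delta>" "degenerate_on g (unimodular_kernel br)"
    "divergence_free \<delta> \<longleftrightarrow> s = 0"
proof -
  obtain g H F where g: "bilinear g" "\<And>x y. g x y = g y x" "g e e = 0" "g e u = 1" "g e v = 0"
    "g u u = 0" "g u v = 0" "g v v = \<epsilon>" and H: "three_form H" "H e u v = 2 * 0"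
    and F: "two_form F" "closed_two_form br F" "F e u = 0" "F e v = q" "F u v = 0"
    using forms_exist[OF fr, of 0 1 0 0 0 \<epsilon> 0 0 q] by blast
  interpret X: null_frame br e u v a b 0 d g F H 0 0 q \<epsilon>
    using fr g H F \<epsilon> by unfold_locales
  obtain dp where dp: "linear dp" "dp e = s" "dp u = 0" "dp v = 0"
    using functional_exists[OF fr, of s 0 0] by blast
  have eq: "einstein_equations br g H F X.b0 X.b' dp dp 0"
    by (rule X.equations_from_frame)
      (use s \<epsilon> in \<open>auto simp: X.sources X.components X.gram X.gram' dp\<close>)
  have F0: "F \<noteq> (\<lambda>x y. 0)" using F(4) q by auto
  obtain \<delta> where \<delta>: "odd_einstein_metric \<A> \<rho> br g \<delta>"
    "divergence_free \<delta> \<longleftrightarrow> (\<forall>x. dp x = 0) \<and> (\<forall>x. dp x = 0) \<and> (0::real) = 0"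
    using equations_imp_odd_einstein_metric[OF lf X.pseudo_from_dual[OF X.dual] H(1) F(1,2) F0 X.dual dp(1) dp(1) eq]
    by blast
  have "(\<forall>x. dp x = 0) \<longleftrightarrow> s = 0"
    using linear_eq_on_basis[OF X.indep dp(1) linear_zero] dp(2-4) by auto
  then show ?thesis
    using that[OF \<delta>(1) frame_degenerate[OF fr tr g(1) g(6,7)]] \<delta>(2) by simp
qed

text \<open>If it is not an eigenspace, then \<open>c \<noteq> 0\<close>. With \<open>g(v, v) = -1\<close> and \<open>h = c/2\<close> one gets \<open>Q = 0\<close> and
  \<open>P = - c\<close>, so \<open>p = P\<close> cancels \<open>P\<^sup>2 + Q\<^sup>2 - p\<^sup>2\<close>; then \<open>q = - d\<close> follows from the equation of \<open>\<delta>\<^sub>-\<close> on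
  \<open>(v, e)\<close>, and the remaining equations are linear in the divergence, with solution
  \<open>\<delta>(e) = - a\<close>, \<open>\<delta>(v) = \<delta>\<^sub>0 = c\<close>.\<close>

lemma twisted_kernel_solution:
  fixes \<A> :: "('p::topological_space, real^3) chart set"
  assumes lf: "lie_frame \<A> br \<rho>" and fr: "frame br e u v a b c d" and tr: "a + d \<noteq> 0" and c: "c \<noteq> 0"
  obtains g \<delta> where "odd_einstein_metric \<A> \<rho> br g \<delta>" "degenerate_on g (unimodular_kernel br)"
proof -
  obtain g H F where g: "bilinear g" "\<And>x y. g x y = g y x" "g e e = 0" "g e u = 1" "g e v = 0"
    "g u u = 0" "g u v = 0" "g v v = (-1::real)" and H: "three_form H" "H e u v = 2 * (c / 2)"
    and F: "two_form F" "closed_two_form br F" "F e u = - c" "F e v = - d" "F u v = 0"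
    using forms_exist[OF fr, of 0 1 0 0 0 "-1" "c / 2" "- c" "- d"] by blast
  interpret X: null_frame br e u v a b c d g F H "c / 2" "- c" "- d" "-1"
    using fr g H F by unfold_locales simp_all
  obtain dp where dp: "linear dp" "dp e = - a" "dp u = 0" "dp v = c"
    using functional_exists[OF fr, of "- a" 0 c] by blast
  have eq: "einstein_equations br g H F X.b0 X.b' dp dp c"
    by (rule X.equations_from_frame)
      (auto simp: X.expand X.gram X.gram' dp field_simps)
  have F0: "F \<noteq> (\<lambda>x y. 0)" using F(3) c by auto
  show ?thesis
    using equations_imp_odd_einstein_metric[OF lf X.pseudo_from_dual[OF X.dual] H(1) F(1,2) F0 X.dual dp(1) dp(1) eq]
      that frame_degenerate[OF fr tr g(1) g(6,7)] by metis
qed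

text \<open>Here \<open>H = 0\<close>, \<open>u\<close> is dual to \<open>F(e, \<sqdot>)\<close>, and \<open>\<delta>(e) = - a\<close>, the rest of the divergence being zero. The
  last four assumptions are the equations on \<open>(e, e)\<close> and on pairs from the ideal, in solved form.\<close>

lemma orthogonal_solution:
  fixes \<A> :: "('p::topological_space, real^3) chart set" and \<epsilon> :: real
  assumes lf: "lie_frame \<A> br \<rho>" and fr: "frame br e u v a b 0 d" and tr: "a + d \<noteq> 0"
    and nz: "\<epsilon> \<noteq> 0" "\<phi> \<noteq> 0" "\<kappa> \<noteq> 0"
    and b: "b = 0 \<or> d = 2 * a" and ad: "2 * a * d * \<kappa> = - b\<^sup>2 * \<phi>" and \<phi>: "\<phi> = - a\<^sup>2 - a * d"
    and dd: "d\<^sup>2 = 2 * a * d"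
  obtains g \<delta> where "odd_einstein_metric \<A> \<rho> br g \<delta>" "\<not> degenerate_on g (unimodular_kernel br)"
proof -
  obtain g H F where g: "bilinear g" "\<And>x y. g x y = g y x" "g e e = \<epsilon>" "g e u = 0" "g e v = 0"
    "g u u = \<phi>" "g u v = 0" "g v v = \<kappa>" and H: "three_form H" "H e u v = 2 * 0"
    and F: "two_form F" "closed_two_form br F" "F e u = \<phi>" "F e v = 0" "F u v = 0"
    using forms_exist[OF fr, of \<epsilon> 0 0 \<phi> 0 \<kappa> 0 \<phi> 0] by blast
  interpret X: orth_frame br e u v a b 0 d g F H 0 \<phi> 0 \<epsilon> \<phi> \<kappa>
    using fr g H F nz by unfold_locales simp_all
  obtain dp where dp: "linear dp" "dp e = - a" "dp u = 0" "dp v = 0"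
    using functional_exists[OF fr, of "- a" 0 0] by blast
  have bb: "b\<^sup>2 * \<phi> / (2 * \<kappa>) = - a * d" using ad nz by (simp add: field_simps)
  have a2: "\<phi> + a * d = - (a * a)" using \<phi> by (simp add: power2_eq_square)
  have S: "ein_source br g H F X.b0 X.b' e e = 0" "ein_source br g H F X.b0 X.b' u u = - a * a * \<phi> / \<epsilon>"
    "ein_source br g H F X.b0 X.b' v v = - a * d * \<kappa> / \<epsilon>"
    "ein_source br g H F X.b0 X.b' u v = - a * b * \<phi> / (2 * \<epsilon>)"
    "ein_source br g H F X.b0 X.b' v u = - a * b * \<phi> / (2 * \<epsilon>)"
  proof -
    have "ein_source br g H F X.b0 X.b' e e = a\<^sup>2 + d\<^sup>2 + b\<^sup>2 * \<phi> / (2 * \<kappa>) + \<phi>"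
      using nz by (simp add: X.sources field_simps power2_eq_square)
    then have "ein_source br g H F X.b0 X.b' e e = a\<^sup>2 + d\<^sup>2 + - a * d + \<phi>"
      unfolding bb .
    then show "ein_source br g H F X.b0 X.b' e e = 0" using \<phi> dd by linarith
    have "ein_source br g H F X.b0 X.b' u u = \<phi> * (\<phi> - b\<^sup>2 * \<phi> / (2 * \<kappa>)) / \<epsilon>"
      using nz by (simp add: X.sources field_simps power2_eq_square)
    then show "ein_source br g H F X.b0 X.b' u u = - a * a * \<phi> / \<epsilon>"
      unfolding bb using a2 by simp
    have "ein_source br g H F X.b0 X.b' v v = b\<^sup>2 * \<phi> / 2 / \<epsilon>"
      using nz by (simp add: X.sources field_simps power2_eq_square)
    moreover have "b\<^sup>2 * \<phi> / 2 = - a * d * \<kappa>" using ad by simp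
    ultimately show "ein_source br g H F X.b0 X.b' v v = - a * d * \<kappa> / \<epsilon>" by simp
    show "ein_source br g H F X.b0 X.b' u v = - a * b * \<phi> / (2 * \<epsilon>)"
      "ein_source br g H F X.b0 X.b' v u = - a * b * \<phi> / (2 * \<epsilon>)"
      using b by (auto simp: X.sources)
  qed
  have eq: "einstein_equations br g H F X.b0 X.b' dp dp 0"
    by (rule X.equations_from_frame)
      (use nz in \<open>auto simp: S X.sources(6-) X.components X.gram X.gram' dp mult_ac\<close>)
  have F0: "F \<noteq> (\<lambda>x y. 0)" using F(3) nz by auto
  have "\<not> degenerate_on g (unimodular_kernel br)"
    by (rule frame_nondegenerate[OF fr tr g(1,2)]) (simp add: g nz)
  then show ?thesis
    using equations_imp_odd_einstein_metric[OF lf X.pseudo_from_dual[OF X.dual] H(1) F(1,2) F0 X.dual dp(1) dp(1) eq]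
      that by metis
qed

text \<open>Now \<open>F(e, \<sqdot>) = g(u, \<sqdot>)\<close> with \<open>u\<close> null. The relations \<open>d = 2 h\<close>, \<open>\<delta>(e) = - a - 2 h = d\<close> fix the constants up to
  the scale of \<open>e\<close>; the coefficient \<open>b\<close> comes from the equation on \<open>(v, v)\<close>.\<close>

lemma isotropic_solution:
  fixes \<A> :: "('p::topological_space, real^3) chart set"
  assumes lf: "lie_frame \<A> br \<rho>" and fr: "frame br e u v 1 1 0 (-1/2)"
  obtains g \<delta> where "odd_einstein_metric \<A> \<rho> br g \<delta>" "\<not> degenerate_on g (unimodular_kernel br)"
proof -
  obtain g H F where g: "bilinear g" "\<And>x y. g x y = g y x" "g e e = (1::real)" "g e u = 0" "g e v = 0"
    "g u u = 0" "g u v = 1" "g v v = 0" and H: "three_form H" "H e u v = 2 * (-1/4)"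
    and F: "two_form F" "closed_two_form br F" "F e u = 0" "F e v = 1" "F u v = 0"
    using forms_exist[OF fr, of 1 0 0 0 1 0 "-1/4" 0 1] by blast
  interpret X: isotropic_frame br e u v 1 1 0 "-1/2" g F H "-1/4" 0 1 1
    using fr g H F by unfold_locales simp_all
  obtain dp where dp: "linear dp" "dp e = (-1/2::real)" "dp u = 0" "dp v = 0"
    using functional_exists[OF fr, of "-1/2" 0 0] by blast
  have eq: "einstein_equations br g H F X.b0 X.b' dp dp 0"
    by (rule X.equations_from_frame)
      (auto simp: X.expand X.gram X.gram' dp)
  have F0: "F \<noteq> (\<lambda>x y. 0)" using F(4) by auto
  have "\<not> degenerate_on g (unimodular_kernel br)"
    by (rule frame_nondegenerate[OF fr _ g(1,2)]) (simp_all add: g)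
  then show ?thesis
    using equations_imp_odd_einstein_metric[OF lf X.pseudo_from_dual[OF X.dual] H(1) F(1,2) F0 X.dual dp(1) dp(1) eq]
      that by metis
qed

section \<open>Obstructions\<close>

text \<open>Without divergence all sources vanish. In terms of \<open>P + Q = c \<epsilon>\<close> and \<open>P Q = 0\<close>: if \<open>Q = 0\<close>, comparing
  the sources on \<open>(v, e)\<close> and \<open>(e, v)\<close> gives \<open>(a + d) P = 0\<close>; if \<open>Q \<noteq> 0\<close>, then \<open>P = p = 0\<close> and the source
  on \<open>(u, e)\<close> is \<open>- Q\<^sup>2/\<epsilon>\<close>.\<close>

lemma divergence_free_imp_eigenvector:
  assumes "null_frame br e u v a b c d g F H h p q \<epsilon>" "a + d \<noteq> 0"
    and eq: "einstein_equations br g H F (tri e u v) (tri u e ((1 / \<epsilon>) *\<^sub>R v)) (\<lambda>x. 0) (\<lambda>x. 0) 0"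
  shows "c = 0"
proof (rule ccontr)
  assume c: "c \<noteq> 0"
  interpret X: null_frame br e u v a b c d g F H h p q \<epsilon> by (rule assms)
  define P where "P = c * \<epsilon> / 2 - h"
  define Q where "Q = c * \<epsilon> / 2 + h"
  note sources = X.sources[folded P_def Q_def]
  have 1: "ein_source br g H F X.b0 X.b' x y = 0" and 3: "ein_source0 br g H F X.b0 X.b' x = 0" for x y
    using eq unfolding einstein_equations_def by simp_all
  have "P + Q = c * \<epsilon>" by (simp add: P_def Q_def)
  then have PQ: "P + Q \<noteq> 0" using c X.eps by simp
  have e1: "P * Q = 0" using 1[of v v] unfolding sources by simp
  have e2: "- (P\<^sup>2 + Q\<^sup>2) / \<epsilon> - p\<^sup>2 = 0" using 1[of u e] unfolding sources .
  have e3: "Q * p = 0" using 3[of v] unfolding sources by simp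
  have e4: "a * Q - d * P = p * q" "a * P - d * Q = p * q" using 1[of v e] 1[of e v] unfolding sources by simp_all
  show False
  proof (cases "Q = 0")
    case True
    then have "(a + d) * P = 0" using e4 by (simp add: algebra_simps)
    then show False using True PQ assms(2) by simp
  next
    case False
    then have "P = 0" "p = 0" using e1 e3 by simp_all
    then have "Q\<^sup>2 = 0" using e2 X.eps by simp
    then show False using False by simp
  qed
qed

lemma diagonal_isomorphic:
  assumes "frame br e u v a 0 0 d" "a \<noteq> 0"
  shows "lie_isomorphic br (\<tau>3_diag (d / a))"
  using frame_isomorphic[OF frame_scale[OF assms(1), of "1 / a"]] assms(2) by (simp add: \<tau>3_diag_def)

lemma triangular_isomorphic:
  assumes "frame br e u v a b 0 d" "a \<noteq> d" "a \<noteq> 0"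
  shows "lie_isomorphic br (\<tau>3_diag (d / a))"
  using frame_diagonal[OF assms(1,2)] diagonal_isomorphic[OF _ assms(3)] by metis

lemma triangular_isomorphic':
  assumes "frame br e u v a b 0 d" "a \<noteq> d" "d \<noteq> 0"
  shows "lie_isomorphic br (\<tau>3_diag (a / d))"
  using frame_diagonal[OF assms(1,2)] diagonal_isomorphic[OF frame_flip assms(3)] by metis

lemma tau2_eq: "\<tau>2_plus_R = \<tau>3_diag 0"
  by (simp add: \<tau>2_plus_R_def \<tau>3_diag_def)

text \<open>If \<open>H = 0\<close> then \<open>c = 0\<close> and eliminating \<open>b\<close> and \<open>\<phi>\<close> leaves \<open>d (d - 2 a) = 0\<close> for the eigenvalues \<open>a\<close>, \<open>d\<close>.
  If \<open>H \<noteq> 0\<close>, the skew part of the equations gives \<open>s = - (a + d)\<close>, so \<open>d = 0\<close>, and the equation on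
  \<open>(v, v)\<close> gives \<open>b = 0\<close>: the eigenvalues are \<open>0\<close> and \<open>a\<close>.\<close>

lemma orth_frame_classification:
  assumes "orth_frame br e u v a b c d g F H h \<phi> 0 \<epsilon> \<phi> \<kappa>" "a + d \<noteq> 0"
    and eq: "einstein_equations br g H F (tri e u v)
      (tri ((1 / \<epsilon>) *\<^sub>R e) ((1 / \<phi>) *\<^sub>R u) ((1 / \<kappa>) *\<^sub>R v)) dp dm d0"
  shows "dp e \<noteq> 0 \<and> (lie_isomorphic br (\<tau>3_diag 0) \<or> lie_isomorphic br (\<tau>3_diag (1/2)))"
proof -
  interpret X: orth_frame br e u v a b c d g F H h \<phi> 0 \<epsilon> \<phi> \<kappa> by (rule assms)
  note E = X.equations[OF eq refl refl]
  note nz = X.nz(2,3)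
  have fr: "frame br e u v a b c d" by (rule X.fr)
  show ?thesis
  proof (cases "h = 0")
    case True
    then have c: "c = 0" using E(2) nz by simp
    have bd: "b\<^sup>2 * \<phi> = - 2 * a * d * \<kappa>"
    proof -
      have "\<phi> * (b\<^sup>2 * \<phi> + 2 * a * d * \<kappa>) = 0"
        using E(5) unfolding E(1) c True by (simp add: power2_eq_square algebra_simps)
      then show ?thesis using nz by simp
    qed
    have \<phi>: "\<phi> = - a\<^sup>2 - a * d"
    proof -
      have "\<phi> * (2 * \<kappa> * \<phi> + 2 * \<kappa> * a\<^sup>2 - b\<^sup>2 * \<phi>) = 0"
        using E(4) unfolding E(1) c True by (simp add: power2_eq_square algebra_simps)
      then have "2 * \<kappa> * \<phi> + 2 * \<kappa> * a\<^sup>2 - b\<^sup>2 * \<phi> = 0" by (metis mult_eq_0_iff nz(1))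
      then have "2 * \<kappa> * (\<phi> + a\<^sup>2 + a * d) = 0" unfolding bd by (simp add: algebra_simps)
      then show ?thesis using nz by simp
    qed
    have "2 * \<kappa> * \<phi> * (d * (d - 2 * a)) = 0"
    proof -
      have "\<phi> * (2 * (a\<^sup>2 + d\<^sup>2) * \<kappa> + b\<^sup>2 * \<phi> + 2 * \<phi> * \<kappa>) = 0"
        using E(3) unfolding c True by (simp add: power2_eq_square algebra_simps)
      then show ?thesis unfolding bd by (simp add: \<phi> power2_eq_square algebra_simps)
    qed
    then have d: "d = 0 \<or> d = 2 * a" using nz by simp
    then have a: "a \<noteq> 0" using assms(2) by auto
    have "lie_isomorphic br (\<tau>3_diag 0) \<or> lie_isomorphic br (\<tau>3_diag (1/2))"
      using d
    proof
      assume "d = 0"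
      then show ?thesis using triangular_isomorphic[OF fr[unfolded c]] a by simp
    next
      assume "d = 2 * a"
      then show ?thesis using triangular_isomorphic'[OF fr[unfolded c]] a by simp
    qed
    then show ?thesis using E(1) a by simp
  next
    case False
    then have "dp e + a + d = 0" using E(6) by simp
    then have d: "d = 0" using E(1) by simp
    then have a: "a \<noteq> 0" using assms(2) by simp
    have "(c * \<kappa> + b * \<phi>) * (c * \<kappa> - b * \<phi>) = 4 * h\<^sup>2"
      using E(5) unfolding d by (simp add: algebra_simps)
    then have "(b * \<phi>)\<^sup>2 = 0" unfolding E(2) by (simp add: power2_eq_square algebra_simps)
    then have b: "b = 0" using nz by simp
    have "lie_isomorphic br (\<tau>3_diag 0)"
      using triangular_isomorphic'[OF frame_flip[OF fr[unfolded b]]] a d by simp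
    then show ?thesis using E(1) a by simp
  qed
qed

text \<open>The equation on \<open>(e, e)\<close> excludes \<open>H = 0\<close>. Hence \<open>s = - (a + d)\<close> and \<open>2 h = d\<close>, which turns
  \<open>(a + d)\<^sup>2 = 4 h\<^sup>2\<close> into \<open>a (a + 2 d) = 0\<close> for the eigenvalues \<open>a\<close>, \<open>d\<close>.\<close>

lemma isotropic_frame_classification:
  assumes "isotropic_frame br e u v a b c d g F H h 0 1 \<epsilon>" "a + d \<noteq> 0"
    and eq: "einstein_equations br g H F (tri e u v) (tri ((1 / \<epsilon>) *\<^sub>R e) v u) dp dm d0"
  shows "dp e \<noteq> 0 \<and> (lie_isomorphic br (\<tau>3_diag 0) \<or> lie_isomorphic br (\<tau>3_diag (-1/2)))"
proof -
  interpret X: isotropic_frame br e u v a b c d g F H h 0 1 \<epsilon> by (rule assms)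
  note E = X.equations[OF eq refl refl]
  have fr: "frame br e u v a b 0 d" using X.fr E(1) by simp
  have "h \<noteq> 0" using E(3) assms(2) by auto
  then have s: "dp e = - (a + d)" using E(4) by simp
  then have h: "2 * h = d" using E(2) by simp
  have "(a + d)\<^sup>2 = d\<^sup>2" using E(3) h[symmetric] by (simp add: power2_eq_square)
  then have "a * (a + 2 * d) = 0" by (simp add: power2_eq_square algebra_simps)
  then have ad: "a = 0 \<or> a = - 2 * d" by auto
  have d: "d \<noteq> 0" using h \<open>h \<noteq> 0\<close> by auto
  have "lie_isomorphic br (\<tau>3_diag 0) \<or> lie_isomorphic br (\<tau>3_diag (-1/2))"
    using ad
  proof
    assume "a = 0"
    then show ?thesis using triangular_isomorphic'[OF fr] d by simp
  next
    assume "a = - 2 * d"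
    then show ?thesis using triangular_isomorphic[OF fr] d by simp
  qed
  then show ?thesis using s assms(2) by simp
qed

text \<open>\<open>c = 0\<close> would make \<open>u\<close> a real eigenvector of a matrix with eigenvalues \<open>r (l \<plusminus> i)\<close>, \<open>r \<noteq> 0\<close>.\<close>

lemma rotation_no_eigenvector:
  assumes rot: "lie_isomorphic br (\<tau>3_rot l)" and l: "l \<noteq> 0"
    and fr: "frame br e u v a b c d" and tr: "a + d \<noteq> 0"
  shows "c \<noteq> 0"
proof
  assume c: "c = 0"
  obtain e' u' v' where fr': "frame br e' u' v' l (-1) 1 l"
    using isomorphic_frame[OF rot[unfolded \<tau>3_rot_def]] by blast
  have tr': "l + l \<noteq> 0" using l by simp
  have i3: "indep3 e' u' v'" and br': "br e' u' = l *\<^sub>R u' + v'" "br e' v' = - u' + l *\<^sub>R v'" "br u' v' = 0"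
    using fr' by (simp_all add: frame_def)
  have br'': "br v' u' = 0" using skew[of v' u'] br' by simp
  have "u \<in> unimodular_kernel br"
    unfolding kernel_frame[OF fr tr] by (intro CollectI exI[of _ 1] exI[of _ 0]) simp
  then obtain s t where u: "u = s *\<^sub>R u' + t *\<^sub>R v'"
    unfolding kernel_frame[OF fr' tr'] by blast
  obtain r x y where e: "e = r *\<^sub>R e' + x *\<^sub>R u' + y *\<^sub>R v'" by (rule indep3_span[OF i3])
  have "br e u = a *\<^sub>R u" using fr c by (simp add: frame_def)
  then have "0 *\<^sub>R e' + (r * (s * l - t) - a * s) *\<^sub>R u' + (r * (s + t * l) - a * t) *\<^sub>R v' = 0"
    unfolding e u by (simp add: bsimps br' br'' algebra_simps)
  then have z: "r * (s * l - t) - a * s = 0" "r * (s + t * l) - a * t = 0"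
    using i3 unfolding indep3_def by blast+
  have "r * (s\<^sup>2 + t\<^sup>2) = s * (r * (s + t * l) - a * t) - t * (r * (s * l - t) - a * s)"
    by (simp add: power2_eq_square algebra_simps)
  then have "r = 0 \<or> s\<^sup>2 + t\<^sup>2 = 0" unfolding z by simp
  then show False
  proof
    assume "r = 0"
    then have "tr e = 0" using frame_tr[OF fr', of r x y] by (simp add: e)
    then show False using frame_tr[OF fr, of 1 0 0] tr by simp
  next
    assume "s\<^sup>2 + t\<^sup>2 = 0"
    then have "u = 0" by (simp add: u)
    then have "0 *\<^sub>R e + 1 *\<^sub>R u + 0 *\<^sub>R v = 0" by simp
    then have "(1::real) = 0" using fr unfolding frame_def indep3_def by blast
    then show False by simp
  qed
qed

end

section \<open>The classification\<close>

lemma lie_frame_of_lie_group: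
  assumes "lie_group \<A>" "lie_algebra_of \<A> br \<rho>"
  shows "lie_frame \<A> br \<rho>"
proof
  show "smooth_atlas \<A>" using assms(1) by (simp add: lie_group_def)
  show "bilinear br" "br x x = 0" for x
    using assms(2) by (auto simp: lie_algebra_of_def lie_bracket_def)
  have "\<rho> x \<in> {V. left_invariant_field \<A> V}" for x
    using assms(2) unfolding lie_algebra_of_def bij_betw_def by blast
  then show "vector_field \<A> (\<rho> x)" for x by (simp add: left_invariant_field_def)
  show "\<rho> (x + y) f p = \<rho> x f p + \<rho> y f p" "\<rho> (c *\<^sub>R x) f p = c * \<rho> x f p" for x y f p c
    using assms(2) by (auto simp: lie_algebra_of_def)
  show "\<rho> (br x y) f p = \<rho> x (\<rho> y f) p - \<rho> y (\<rho> x f) p" if "smooth_map \<A> f" for x y f p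
    using assms(2) that by (auto simp: lie_algebra_of_def)
qed

context lie_algebra3
begin

context
  fixes \<A> :: "('p::topological_space, real^3) chart set" and \<rho>
  assumes lf: "lie_frame \<A> br \<rho>"
begin

text \<open>The equation \<open>- a s = a\<^sup>2 + d\<^sup>2 + q\<^sup>2/\<epsilon>\<close> has a solution with \<open>s = 0\<close> for \<open>\<epsilon> = -1\<close>, and only solutions with
  \<open>s \<noteq> 0\<close> for \<open>\<epsilon> = 1\<close>.\<close>

lemma eigenvector_solutions:
  assumes fr: "frame br e u v a b 0 d" and a: "a \<noteq> 0" and tr: "a + d \<noteq> 0"
  shows "\<exists>g \<delta>. odd_einstein_metric \<A> \<rho> br g \<delta> \<and> degenerate_on g (unimodular_kernel br) \<and> divergence_free \<delta>"
    and "\<exists>g \<delta>. odd_einstein_metric \<A> \<rho> br g \<delta> \<and> degenerate_on g (unimodular_kernel br) \<and> \<not> divergence_free \<delta>"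
proof -
  have pos: "a\<^sup>2 + d\<^sup>2 > 0" using a by (simp add: sum_power2_gt_zero_iff)
  have q: "(-1::real) \<noteq> 0" "sqrt (a\<^sup>2 + d\<^sup>2) \<noteq> 0" "- a * 0 = a\<^sup>2 + d\<^sup>2 + (sqrt (a\<^sup>2 + d\<^sup>2))\<^sup>2 / (-1)"
    using pos a by (simp_all add: real_sqrt_pow2)
  obtain g \<delta> where "odd_einstein_metric \<A> \<rho> br g \<delta>" "degenerate_on g (unimodular_kernel br)"
    "divergence_free \<delta> \<longleftrightarrow> (0::real) = 0"
    using isotropic_kernel_solution[OF lf fr tr q] by blast
  then show "\<exists>g \<delta>. odd_einstein_metric \<A> \<rho> br g \<delta> \<and> degenerate_on g (unimodular_kernel br) \<and> divergence_free \<delta>"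
    by blast
  define s where "s = - (a\<^sup>2 + d\<^sup>2 + 1) / a"
  have s0: "s \<noteq> 0" using pos a by (simp add: s_def)
  have q: "(1::real) \<noteq> 0" "(1::real) \<noteq> 0" "- a * s = a\<^sup>2 + d\<^sup>2 + 1\<^sup>2 / 1"
    using a by (simp_all add: s_def)
  obtain g \<delta> where "odd_einstein_metric \<A> \<rho> br g \<delta>" "degenerate_on g (unimodular_kernel br)"
    "divergence_free \<delta> \<longleftrightarrow> s = 0"
    using isotropic_kernel_solution[OF lf fr tr q] by blast
  then show "\<exists>g \<delta>. odd_einstein_metric \<A> \<rho> br g \<delta> \<and> degenerate_on g (unimodular_kernel br) \<and> \<not> divergence_free \<delta>"
    using s0 by blast
qed

text \<open>A frame whose first ideal vector is not an eigenvector admits the twisted solution. Otherwise \<open>ad\<^sub>e\<close>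
  has real eigenvalues on the ideal; their sum is nonzero, so one can start from an eigenvector with
  nonzero eigenvalue.\<close>

lemma degenerate_metric_exists:
  assumes fr: "frame br e u v a b c d" and tr: "a + d \<noteq> 0"
  shows "\<exists>g \<delta>. odd_einstein_metric \<A> \<rho> br g \<delta> \<and> degenerate_on g (unimodular_kernel br)"
proof (cases "c = 0")
  case False
  then show ?thesis using twisted_kernel_solution[OF lf fr tr] by blast
next
  case c: True
  show ?thesis
  proof (cases "a = 0")
    case False
    then show ?thesis using eigenvector_solutions(1)[OF fr[unfolded c] _ tr] by blast
  next
    case True
    then have "d \<noteq> 0" "a \<noteq> d" using tr by auto
    obtain v' where "frame br e u v' a 0 0 d" using frame_diagonal[OF fr[unfolded c] \<open>a \<noteq> d\<close>] by blast
    then have "frame br e v' u d 0 0 a" by (rule frame_flip)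
    from eigenvector_solutions(1)[OF this \<open>d \<noteq> 0\<close>] show ?thesis using tr by (auto simp: add.commute)
  qed
qed

lemma rotation_divergence:
  assumes rot: "lie_isomorphic br (\<tau>3_rot l)" "l \<noteq> 0"
    and E: "odd_einstein_metric \<A> \<rho> br g \<delta>" and deg: "degenerate_on g (unimodular_kernel br)"
  shows "\<not> divergence_free \<delta>"
proof
  assume df: "divergence_free \<delta>"
  obtain H F dp dm d0 where pg: "pseudo_metric g" and HF: "three_form H" "two_form F" "closed_two_form br F"
    and "F \<noteq> (\<lambda>x y. 0)" and "linear dp" "linear dm"
    and eq: "\<And>b b'. dual_bases g b b' \<Longrightarrow> einstein_equations br g H F b b' dp dm d0"
    and div: "divergence_free \<delta> \<longleftrightarrow> (\<forall>x. dp x = 0) \<and> (\<forall>x. dm x = 0) \<and> d0 = 0"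
    by (rule odd_einstein_metric_imp_equations[OF lf E]) (rule that, assumption+)
  have z: "dp = (\<lambda>x. 0)" "dm = (\<lambda>x. 0)" "d0 = 0" using df div by auto
  obtain e u v a b c d h p q \<epsilon> where nf: "null_frame br e u v a b c d g F H h p q \<epsilon>" and tr: "a + d \<noteq> 0"
    using null_frame_exists[OF pg deg HF] by blast
  interpret X: null_frame br e u v a b c d g F H h p q \<epsilon> by (rule nf)
  have "c = 0"
    using divergence_free_imp_eigenvector[OF nf tr] eq[OF X.dual] unfolding z by blast
  then show False using rotation_no_eigenvector[OF rot X.fr tr] by simp
qed

lemma nondegenerate_classification:
  assumes nu: "unimodular_kernel br \<noteq> UNIV"
    and E: "odd_einstein_metric \<A> \<rho> br g \<delta>" and nd: "\<not> degenerate_on g (unimodular_kernel br)"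
  shows "\<not> divergence_free \<delta> \<and> (lie_isomorphic br \<tau>2_plus_R \<or> lie_isomorphic br (\<tau>3_diag (1/2)) \<or>
        lie_isomorphic br (\<tau>3_diag (-1/2)))"
proof -
  obtain H F dp dm d0 where pg: "pseudo_metric g" and HF: "three_form H" "two_form F" "closed_two_form br F"
    and F0: "F \<noteq> (\<lambda>x y. 0)" and "linear dp" "linear dm"
    and eq: "\<And>b b'. dual_bases g b b' \<Longrightarrow> einstein_equations br g H F b b' dp dm d0"
    and div: "divergence_free \<delta> \<longleftrightarrow> (\<forall>x. dp x = 0) \<and> (\<forall>x. dm x = 0) \<and> d0 = 0"
    by (rule odd_einstein_metric_imp_equations[OF lf E]) (rule that, assumption+)
  have "\<exists>e. dp e \<noteq> 0 \<and> (lie_isomorphic br (\<tau>3_diag 0) \<or> lie_isomorphic br (\<tau>3_diag (1/2)) \<or>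
        lie_isomorphic br (\<tau>3_diag (-1/2)))"
    using nondegenerate_frame_exists[OF pg nd nu HF F0]
  proof cases
    case (1 e u v a b c d h \<epsilon> \<phi> \<kappa>)
    interpret X: orth_frame br e u v a b c d g F H h \<phi> 0 \<epsilon> \<phi> \<kappa> by (rule 1)
    show ?thesis using orth_frame_classification[OF 1 eq[OF X.dual]] by blast
  next
    case (2 e u v a b c d h \<epsilon>)
    interpret X: isotropic_frame br e u v a b c d g F H h 0 1 \<epsilon> by (rule 2)
    show ?thesis using isotropic_frame_classification[OF 2 eq[OF X.dual]] by blast
  qed
  then show ?thesis using div unfolding tau2_eq by blast
qed

text \<open>Starting from eigenvectors, a shear produces the off-diagonal entry that the equations demand.\<close>

lemma nondegenerate_metric_exists:
  assumes "lie_isomorphic br \<tau>2_plus_R \<or> lie_isomorphic br (\<tau>3_diag (1/2)) \<or> lie_isomorphic br (\<tau>3_diag (-1/2))"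
  shows "\<exists>g \<delta>. odd_einstein_metric \<A> \<rho> br g \<delta> \<and> \<not> degenerate_on g (unimodular_kernel br)"
  using assms
proof (elim disjE)
  assume "lie_isomorphic br \<tau>2_plus_R"
  then obtain e u v where "frame br e u v 1 0 0 0"
    using isomorphic_frame unfolding \<tau>2_plus_R_def by blast
  then obtain g \<delta> where "odd_einstein_metric \<A> \<rho> br g \<delta>" "\<not> degenerate_on g (unimodular_kernel br)"
    by (rule orthogonal_solution[OF lf, where \<epsilon> = 1 and \<phi> = "-1" and \<kappa> = 1]) simp_all
  then show ?thesis by blast
next
  assume "lie_isomorphic br (\<tau>3_diag (1/2))"
  then obtain e u v where "frame br e u v 1 0 0 (1/2)"
    using isomorphic_frame unfolding \<tau>3_diag_def by blast
  \<comment> \<open>The eigenvector of \<open>1/2\<close> comes first, as \<open>d = 2 a\<close>; then \<open>2 a d \<kappa> = - b\<^sup>2 \<phi>\<close> is solved by \<open>b = -1\<close>.\<close>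
  from frame_shear[OF frame_flip[OF this], of 2]
  have "frame br e v (u + 2 *\<^sub>R v) (1/2) (-1) 0 1" by simp
  then obtain g \<delta> where "odd_einstein_metric \<A> \<rho> br g \<delta>" "\<not> degenerate_on g (unimodular_kernel br)"
    by (rule orthogonal_solution[OF lf, where \<epsilon> = 1 and \<phi> = "-3/4" and \<kappa> = "3/4"])
      (simp_all add: power2_eq_square)
  then show ?thesis by blast
next
  assume "lie_isomorphic br (\<tau>3_diag (-1/2))"
  then obtain e u v where "frame br e u v 1 0 0 (-1/2)"
    using isomorphic_frame unfolding \<tau>3_diag_def by blast
  from frame_shear[OF this, of "2/3"]
  have "frame br e u (v + (2/3) *\<^sub>R u) 1 1 0 (-1/2)" by simp
  from isotropic_solution[OF lf this] show ?thesis by blast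
qed

lemma real_eigenvector_solutions:
  assumes "lie_isomorphic br \<tau>2_plus_R \<or> lie_isomorphic br \<tau>3 \<or>
      (\<exists>l. l \<noteq> -1 \<and> 0 < \<bar>l\<bar> \<and> \<bar>l\<bar> \<le> 1 \<and> lie_isomorphic br (\<tau>3_diag l))"
  shows "(\<exists>g \<delta>. odd_einstein_metric \<A> \<rho> br g \<delta> \<and> degenerate_on g (unimodular_kernel br) \<and> divergence_free \<delta>) \<and>
    (\<exists>g \<delta>. odd_einstein_metric \<A> \<rho> br g \<delta> \<and> degenerate_on g (unimodular_kernel br) \<and> \<not> divergence_free \<delta>)"
proof -
  obtain b d where iso: "lie_isomorphic br (semidirect (vector [vector [1, b], vector [0, d]]))" and d: "d \<noteq> -1"
    using assms
  proof (elim disjE exE conjE)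
    assume "lie_isomorphic br \<tau>2_plus_R"
    then show ?thesis using that[of 0 0] by (simp add: \<tau>2_plus_R_def)
  next
    assume "lie_isomorphic br \<tau>3"
    then show ?thesis using that[of 1 1] by (simp add: \<tau>3_def)
  next
    fix l assume "l \<noteq> -1" "lie_isomorphic br (\<tau>3_diag l)"
    then show ?thesis using that[of 0 l] by (simp add: \<tau>3_diag_def)
  qed
  obtain e u v where fr: "frame br e u v 1 b 0 d" using isomorphic_frame[OF iso] by blast
  have "1 + d \<noteq> 0" using d by (simp add: add_eq_0_iff)
  then show ?thesis using eigenvector_solutions[OF fr one_neq_zero] by blast
qed

end

lemma frame_of_kernel:
  assumes "unimodular_kernel br \<noteq> UNIV"
  obtains e u v a b c d where "frame br e u v a b c d" "a + d \<noteq> 0"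
proof -
  obtain e where e: "tr e \<noteq> 0" using assms unfolding kernel_eq by blast
  obtain u where u: "tr u = 0" "\<And>s t. s *\<^sub>R 0 + t *\<^sub>R u = 0 \<Longrightarrow> t = 0"
    using kernel_extend[OF e linear_0[OF tr_linear]] by blast
  obtain v where v: "tr v = 0" "\<And>s t. s *\<^sub>R u + t *\<^sub>R v = 0 \<Longrightarrow> t = 0"
    using kernel_extend[OF e u(1)] by blast
  have ind: "s = 0 \<and> t = 0" if "s *\<^sub>R u + t *\<^sub>R v = 0" for s t
    using v(2)[OF that] that u(2)[of 0 s] by simp
  obtain a b c d where "frame br e u v a b c d" "a + d \<noteq> 0"
    using frame_exists[OF e u(1) v(1) ind] by blast
  then show ?thesis by (rule that)
qed

end

theorem theorem2:
  fixes \<A> :: "('p::{topological_group_add, t2_space, second_countable_topology}, real^3) chart set"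
    and br :: "real^3 \<Rightarrow> real^3 \<Rightarrow> real^3"
    and \<rho> :: "('p, 3) frame"
  assumes "lie_group \<A>"
    and "lie_algebra_of \<A> br \<rho>"
    and "unimodular_kernel br \<noteq> UNIV"
  shows
    "(\<exists>g \<delta>. odd_einstein_metric \<A> \<rho> br g \<delta> \<and> degenerate_on g (unimodular_kernel br)) \<and>
     (lie_isomorphic br \<tau>2_plus_R \<or> lie_isomorphic br \<tau>3 \<or>
      (\<exists>l. l \<noteq> -1 \<and> 0 < \<bar>l\<bar> \<and> \<bar>l\<bar> \<le> 1 \<and> lie_isomorphic br (\<tau>3_diag l)) \<longrightarrow>
        (\<exists>g \<delta>. odd_einstein_metric \<A> \<rho> br g \<delta> \<and> degenerate_on g (unimodular_kernel br) \<and>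
           divergence_free \<delta>) \<and>
        (\<exists>g \<delta>. odd_einstein_metric \<A> \<rho> br g \<delta> \<and> degenerate_on g (unimodular_kernel br) \<and>
           \<not> divergence_free \<delta>)) \<and>
     ((\<exists>l. l \<noteq> 0 \<and> lie_isomorphic br (\<tau>3_rot l)) \<longrightarrow>
        (\<forall>g \<delta>. odd_einstein_metric \<A> \<rho> br g \<delta> \<and> degenerate_on g (unimodular_kernel br) \<longrightarrow>
           \<not> divergence_free \<delta>)) \<and>
     ((\<exists>g \<delta>. odd_einstein_metric \<A> \<rho> br g \<delta> \<and> \<not> degenerate_on g (unimodular_kernel br)) \<longleftrightarrow>
        lie_isomorphic br \<tau>2_plus_R \<or> lie_isomorphic br (\<tau>3_diag (1/2)) \<or>
        lie_isomorphic br (\<tau>3_diag (-1/2))) \<and>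
     (\<forall>g \<delta>. odd_einstein_metric \<A> \<rho> br g \<delta> \<and> \<not> degenerate_on g (unimodular_kernel br) \<longrightarrow>
        \<not> divergence_free \<delta>)"
proof -
  have lf: "lie_frame \<A> br \<rho>" by (rule lie_frame_of_lie_group[OF assms(1,2)])
  interpret lie_algebra3 br
    using assms(2) by unfold_locales (simp add: lie_algebra_of_def)
  obtain e u v a b c d where fr: "frame br e u v a b c d" "a + d \<noteq> 0"
    using frame_of_kernel[OF assms(3)] by blast
  show ?thesis
    by (intro conjI impI iffI allI)
      (use degenerate_metric_exists[OF lf fr] real_eigenvector_solutions[OF lf]
        rotation_divergence[OF lf] nondegenerate_classification[OF lf assms(3)]
        nondegenerate_metric_exists[OF lf] in blast)+
qed

end
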